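(* Let $I\subseteq\mathbb{C}[\partial]$ be an $A$-graded binomial ideal and let $\beta\in\mathbb{C}^d$. Assume that $-\beta$ lies outside of the primary arrangement $\mathcal{Z}_{\mathrm{primary}}(I)$. Then $$\mathcal{H}_i(E-\beta;\mathbb{C}[\partial]/I)\cong\bigoplus_{I_{\rho,J}\ \mathrm{toral}}\mathcal{H}_i(E-\beta;\mathbb{C}[\partial]/\mathcal{C}_{\rho,J})$$ for all $i$, the sum being over all toral associated primes of $I$. In particular, $$D/H_A(I,\beta)\cong\bigoplus_{I_{\rho,J}\ \mathrm{toral}}D/H_A(\mathcal{C}_{\rho,J},\beta).$$
   Context: Grading. $A=(a_{ij})\in\mathbb{Z}^{d\times n}$ is an integer matrix of rank $d$ whose columns $a_1,\dots,a_n$ all lie in a single open linear half-space of $\mathbb{R}^d$ and generate $\mathbb{Z}^d$ as an abelian group. $\mathbb{C}[\partial]=\mathbb{C}[\partial_1,\dots,\partial_n]$, and $D$ is the Weyl algebra over $\mathbb{C}$ in $x_1,\dots,x_n$ and $\partial_j=\partial/\partial x_j$. Both are $\mathbb{Z}^d$-graded ("$A$-graded") by $\deg\partial_j=-a_j$, $\deg x_j=a_j$. A binomial ideal is an ideal generated by elements $\partial^u-\lambda\partial^v$ with $u,v\in\mathbb{N}^n$, $\lambda\in\mathbb{C}$ ($\lambda=0$ allowed); it is $A$-graded if it is homogeneous for the $A$-grading. Euler-Koszul homology. $E_i=\sum_j a_{ij}x_j\partial_j$ for $1\le i\le d$, and $H_A(I,\beta)=D\cdot I+D\cdot\langle E_1-\beta_1,\dots,E_d-\beta_d\rangle$.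 For an $A$-graded $\mathbb{C}[\partial]$-module $V$, $E_i-\beta_i$ denotes the $D$-linear endomorphism of $D\otimes_{\mathbb{C}[\partial]}V$ sending each homogeneous $z$ of degree $\alpha\in\mathbb{Z}^d$ to $(E_i-\beta_i-\alpha_i)z$. These commute; $\mathcal{H}_i(E-\beta;V)$ is the $i$-th homology of the resulting Koszul complex of left $D$-modules. In particular $\mathcal{H}_0(E-\beta;\mathbb{C}[\partial]/I)=D/H_A(I,\beta)$. Quasidegrees. For an $A$-graded $\mathbb{C}[\partial]$-module $V$, $\mathrm{qdeg}(V)$ is the Zariski closure in $\mathbb{C}^d$ of $\{\alpha\in\mathbb{Z}^d:V_\alpha\ne0\}$. Toral and Andean components. For $J\subseteq\{1,\dots,n\}$, $A_J$ is the submatrix of $A$ with columns indexed by $J$. For a homomorphism $\rho:L\to\mathbb{C}^*$ on a saturated sublattice $L\subseteq\mathbb{Z}^J\subseteq\mathbb{Z}^n$ (saturated: $\mathbb{Q}L\cap\mathbb{Z}^n=L$) put $I_\rho=\langle\partial^{u_+}-\rho(u)\partial^{u_-}:u=u_+-u_-\in L\rangle$, where $u_+,u_-$ are the positive and negative parts of $u$, and $I_{\rho,J}=I_\rho+\langle\partial_j:j\notin J\rangle$. Every binomial prime has this form, and if $I_{\rho,J}$ is $A$-graded then $L\subseteq\ker_{\mathbb{Z}}(A_J)$. An $A$-graded prime $I_{\rho,J}$, and any $A$-graded binomial $I_{\rho,J}$-primary ideal, is called toral if $L=\ker_{\mathbb{Z}}(A_J)$ and Andean otherwise. Fix an irredundant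 primary decomposition $I=\bigcap_{I_{\rho,J}\in\mathrm{Ass}(I)}\mathcal{C}_{\rho,J}$ into $A$-graded binomial ideals, $\mathcal{C}_{\rho,J}$ being $I_{\rho,J}$-primary of the form $((I+I_\rho):(\prod_{j\in J}\partial_j)^\infty)+U_{\rho,J}$ with $U_{\rho,J}$ a monomial ideal (such decompositions exist). The Andean arrangement $\mathcal{Z}_{\mathrm{Andean}}(I)$ is the union of $\mathrm{qdeg}(\mathbb{C}[\partial]/\mathcal{C}_{\rho,J})$ over the Andean components $\mathcal{C}_{\rho,J}$. Primary arrangement. $P_I$ is the cokernel of the natural map $\mathbb{C}[\partial]/I\to\bigoplus_{I_{\rho,J}\in\mathrm{Ass}(I)}\mathbb{C}[\partial]/\mathcal{C}_{\rho,J}$, and $\mathcal{Z}_{\mathrm{primary}}(I)=\mathrm{qdeg}(P_I)\cup\mathcal{Z}_{\mathrm{Andean}}(I)$. *)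

theory Defs
  imports
    "HOL-Analysis.Cartesian_Space"
    "HOL-Algebra.Ideal"
    "HOL-Algebra.Module"
    "HOL-Algebra.Generated_Groups"
    "HOL-Algebra.Free_Abelian_Groups"
begin

section \<open>Polynomials, ideals and integer matrices\<close>

text \<open>
  The finite index types \<open>'n\<close> and \<open>'d\<close> play the role of \<open>{1..n}\<close> and \<open>{1..d}\<close>.  The type
  \<open>'n cpoly\<close> serves as \<open>\<complex>[\<partial>\<^sub>1,\<dots>,\<partial>\<^sub>n]\<close>, as \<open>\<complex>[x\<^sub>1,\<dots>,x\<^sub>n]\<close> (on which the Weyl algebra acts),
  and, over \<open>'d\<close>, as the coordinate ring of \<open>\<complex>\<^sup>d\<close>.
\<close>

type_synonym 'n cpoly = "('n \<Rightarrow>\<^sub>0 nat) \<Rightarrow>\<^sub>0 complex"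

abbreviation monomial :: "('n \<Rightarrow>\<^sub>0 nat) \<Rightarrow> complex \<Rightarrow> 'n cpoly" where
  "monomial u c \<equiv> Poly_Mapping.single u c"

abbreviation pvar :: "'n \<Rightarrow> 'n cpoly" where
  "pvar j \<equiv> monomial (Poly_Mapping.single j 1) 1"

definition poly_ring :: "'n cpoly ring" where
  "poly_ring = \<lparr>carrier = UNIV, mult = (*), one = 1, ring.zero = 0, ring.add = (+)\<rparr>"

definition poly_eval :: "'d::finite cpoly \<Rightarrow> complex^'d \<Rightarrow> complex" where
  "poly_eval p z =
     (\<Sum>m\<in>Poly_Mapping.keys p. Poly_Mapping.lookup p m * (\<Prod>i\<in>UNIV. z $ i ^ Poly_Mapping.lookup m i))"

definition zariski_closure :: "(complex^'d::finite) set \<Rightarrow> (complex^'d) set" where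
  "zariski_closure S = {z. \<forall>p. (\<forall>s\<in>S. poly_eval p s = 0) \<longrightarrow> poly_eval p z = 0}"

definition of_int_vec :: "int^'k::finite \<Rightarrow> 'a::ring_1^'k" where
  "of_int_vec v = (\<chi> i. of_int (v $ i))"

definition grading_matrix :: "int^'n::finite^'d::finite \<Rightarrow> bool" where
  "grading_matrix A \<longleftrightarrow>
     rank ((\<chi> i j. of_int (A $ i $ j)) :: real^'n^'d) = CARD('d) \<and>
     (\<exists>h::real^'d. \<forall>j. (\<Sum>i\<in>UNIV. h $ i * of_int (A $ i $ j)) > 0) \<and>
     (\<forall>v::int^'d. \<exists>c::'n \<Rightarrow> int. v = (\<Sum>j\<in>UNIV. c j *s column j A))"

definition exp_vec :: "('n::finite \<Rightarrow>\<^sub>0 nat) \<Rightarrow> int^'n" where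
  "exp_vec u = (\<chi> j. int (Poly_Mapping.lookup u j))"

definition poly_degree_part :: "int^'n::finite^'d::finite \<Rightarrow> int^'d \<Rightarrow> 'n cpoly set" where
  "poly_degree_part A \<alpha> = {p. \<forall>u\<in>Poly_Mapping.keys p. - (A *v exp_vec u) = \<alpha>}"

definition A_graded_ideal :: "int^'n::finite^'d::finite \<Rightarrow> 'n cpoly set \<Rightarrow> bool" where
  "A_graded_ideal A I \<longleftrightarrow> (\<exists>S \<subseteq> (\<Union>\<alpha>. poly_degree_part A \<alpha>). I = Idl\<^bsub>poly_ring\<^esub> S)"

definition binomial_ideal :: "'n cpoly set \<Rightarrow> bool" where
  "binomial_ideal I \<longleftrightarrow>
     (\<exists>S \<subseteq> {monomial u 1 - monomial v c | u v c. True}. I = Idl\<^bsub>poly_ring\<^esub> S)"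

definition monomial_ideal :: "'n cpoly set \<Rightarrow> bool" where
  "monomial_ideal U \<longleftrightarrow> (\<exists>S. U = Idl\<^bsub>poly_ring\<^esub> ((\<lambda>u. monomial u 1) ` S))"

definition ideal_radical :: "'n cpoly set \<Rightarrow> 'n cpoly set" where
  "ideal_radical I = {f. \<exists>k::nat. f ^ k \<in> I}"

definition ideal_saturation :: "'n cpoly set \<Rightarrow> 'n cpoly \<Rightarrow> 'n cpoly set" where
  "ideal_saturation I g = {f. \<exists>k::nat. f * g ^ k \<in> I}"

definition primary_to :: "'n cpoly set \<Rightarrow> 'n cpoly set \<Rightarrow> bool" where
  "primary_to Q C \<longleftrightarrow> ideal C poly_ring \<and> C \<noteq> UNIV \<and>
     (\<forall>f g. f * g \<in> C \<longrightarrow> f \<in> C \<or> g \<in> ideal_radical C) \<and> ideal_radical C = Q"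

definition assoc_primes :: "'n cpoly set \<Rightarrow> 'n cpoly set set" where
  "assoc_primes I = {Q. primeideal Q poly_ring \<and> (\<exists>f. Q = {g. g * f \<in> I})}"


section \<open>Binomial primes and primary decompositions\<close>

definition partial_character :: "(int^'n::finite) set \<Rightarrow> (int^'n \<Rightarrow> complex) \<Rightarrow> 'n set \<Rightarrow> bool" where
  "partial_character L \<rho> J \<longleftrightarrow>
     0 \<in> L \<and> (\<forall>u\<in>L. \<forall>v\<in>L. u - v \<in> L) \<and> (\<forall>u\<in>L. \<forall>j. j \<notin> J \<longrightarrow> u $ j = 0) \<and>
     {u. of_int_vec u \<in> vec.span ((of_int_vec :: int^'n \<Rightarrow> rat^'n) ` L)} = L \<and>
     (\<forall>u\<in>L. \<rho> u \<noteq> 0) \<and> (\<forall>u\<in>L. \<forall>v\<in>L. \<rho> (u + v) = \<rho> u * \<rho> v)"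

definition pos_part :: "int^'n::finite \<Rightarrow> 'n \<Rightarrow>\<^sub>0 nat" where
  "pos_part u = Abs_poly_mapping (\<lambda>j. nat (u $ j))"

definition lattice_ideal :: "(int^'n::finite) set \<Rightarrow> (int^'n \<Rightarrow> complex) \<Rightarrow> 'n cpoly set" where
  "lattice_ideal L \<rho> =
     Idl\<^bsub>poly_ring\<^esub> {monomial (pos_part u) 1 - monomial (pos_part (- u)) (\<rho> u) | u. u \<in> L}"

definition lattice_prime ::
  "(int^'n::finite) set \<Rightarrow> (int^'n \<Rightarrow> complex) \<Rightarrow> 'n set \<Rightarrow> 'n cpoly set" where
  "lattice_prime L \<rho> J = lattice_ideal L \<rho> <+>\<^bsub>poly_ring\<^esub> Idl\<^bsub>poly_ring\<^esub> (pvar ` (- J))"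

text \<open>The kernel of \<open>A\<^sub>J\<close> on \<open>\<int>\<^sup>J\<close>, where \<open>\<int>\<^sup>J\<close> is embedded in \<open>\<int>\<^sup>n\<close> by extension with zeros.\<close>

definition kernel_lattice :: "int^'n::finite^'d::finite \<Rightarrow> 'n set \<Rightarrow> (int^'n) set" where
  "kernel_lattice A J = {u. (\<forall>j. j \<notin> J \<longrightarrow> u $ j = 0) \<and> A *v u = 0}"

text \<open>A prime of the form \<open>I\<^bsub>\<rho>,J\<^esub>\<close> determines \<open>J\<close>, \<open>L\<close> and the values of \<open>\<rho>\<close> on \<open>L\<close>.\<close>

definition toral :: "int^'n::finite^'d::finite \<Rightarrow> 'n cpoly set \<Rightarrow> bool" where
  "toral A Q \<longleftrightarrow>
     (\<exists>L \<rho> J. partial_character L \<rho> J \<and> Q = lattice_prime L \<rho> J \<and> L = kernel_lattice A J)"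

definition Andean :: "int^'n::finite^'d::finite \<Rightarrow> 'n cpoly set \<Rightarrow> bool" where
  "Andean A Q \<longleftrightarrow>
     (\<exists>L \<rho> J. partial_character L \<rho> J \<and> Q = lattice_prime L \<rho> J \<and> L \<noteq> kernel_lattice A J)"

text \<open>The component belonging to the associated prime \<open>Q = I\<^bsub>\<rho>,J\<^esub>\<close> is \<open>C Q\<close>.\<close>

definition binomial_primary_decomposition ::
  "int^'n::finite^'d::finite \<Rightarrow> 'n cpoly set \<Rightarrow> ('n cpoly set \<Rightarrow> 'n cpoly set) \<Rightarrow> bool" where
  "binomial_primary_decomposition A I C \<longleftrightarrow>
     (\<forall>Q\<in>assoc_primes I.
        binomial_ideal (C Q) \<and> A_graded_ideal A (C Q) \<and> primary_to Q (C Q) \<and>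
        (\<exists>L \<rho> J U. partial_character L \<rho> J \<and> Q = lattice_prime L \<rho> J \<and> monomial_ideal U \<and>
           C Q = ideal_saturation (I <+>\<^bsub>poly_ring\<^esub> lattice_ideal L \<rho>) (\<Prod>j\<in>J. pvar j)
                   <+>\<^bsub>poly_ring\<^esub> U)) \<and>
     I = (\<Inter>Q\<in>assoc_primes I. C Q) \<and>
     (\<forall>Q\<in>assoc_primes I. I \<noteq> (\<Inter>Q'\<in>assoc_primes I - {Q}. C Q'))"


section \<open>Modules\<close>

text \<open>
  Left modules over a (possibly noncommutative) ring are records of the library's type
  \<open>('r, 'm) module\<close>; the components \<open>mult\<close> and \<open>one\<close> of these records are irrelevant.
  A grading of \<open>M\<close> by \<open>\<int>\<^sup>d\<close> is given separately, as the map sending a degree \<open>\<alpha>\<close> to the set of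
  all homogeneous elements of degree \<open>\<alpha>\<close>, including zero.
\<close>

definition regular_module :: "'r ring \<Rightarrow> ('r, 'r) module" where
  "regular_module R = \<lparr>carrier = carrier R, mult = mult R, one = one R, ring.zero = ring.zero R,
     ring.add = ring.add R, smult = mult R\<rparr>"

definition quot_module :: "('r, 'm) module \<Rightarrow> 'm set \<Rightarrow> ('r, 'm set) module" where
  "quot_module M N = \<lparr>carrier = a_rcosets\<^bsub>M\<^esub> N, mult = undefined, one = undefined,
     ring.zero = N, ring.add = set_add M, smult = (\<lambda>r X. N <+>\<^bsub>M\<^esub> ((\<lambda>x. r \<odot>\<^bsub>M\<^esub> x) ` X))\<rparr>"

definition quot_grading ::
  "('r, 'm) module \<Rightarrow> ('k \<Rightarrow> 'm set) \<Rightarrow> 'm set \<Rightarrow> 'k \<Rightarrow> 'm set set" where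
  "quot_grading M G N \<alpha> = (\<lambda>x. N +>\<^bsub>M\<^esub> x) ` G \<alpha>"

definition direct_sum :: "'i set \<Rightarrow> ('i \<Rightarrow> ('r, 'm) module) \<Rightarrow> ('r, 'i \<Rightarrow> 'm) module" where
  "direct_sum S M = \<lparr>
     carrier = {f \<in> (\<Pi>\<^sub>E i\<in>S. carrier (M i)). finite {i \<in> S. f i \<noteq> \<zero>\<^bsub>M i\<^esub>}},
     mult = undefined, one = undefined,
     ring.zero = (\<lambda>i\<in>S. \<zero>\<^bsub>M i\<^esub>),
     ring.add = (\<lambda>f g. \<lambda>i\<in>S. f i \<oplus>\<^bsub>M i\<^esub> g i),
     smult = (\<lambda>r f. \<lambda>i\<in>S. r \<odot>\<^bsub>M i\<^esub> f i)\<rparr>"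

definition direct_sum_grading ::
  "'i set \<Rightarrow> ('i \<Rightarrow> ('r, 'm) module) \<Rightarrow> ('i \<Rightarrow> 'k \<Rightarrow> 'm set) \<Rightarrow> 'k \<Rightarrow> ('i \<Rightarrow> 'm) set" where
  "direct_sum_grading S M G \<alpha> = {f \<in> carrier (direct_sum S M). \<forall>i\<in>S. f i \<in> G i \<alpha>}"

definition lmodule_hom :: "'r ring \<Rightarrow> ('r, 'm) module \<Rightarrow> ('r, 'k) module \<Rightarrow> ('m \<Rightarrow> 'k) set" where
  "lmodule_hom R M N = {h \<in> carrier M \<rightarrow> carrier N.
     (\<forall>x\<in>carrier M. \<forall>y\<in>carrier M. h (x \<oplus>\<^bsub>M\<^esub> y) = h x \<oplus>\<^bsub>N\<^esub> h y) \<and>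
     (\<forall>r\<in>carrier R. \<forall>x\<in>carrier M. h (r \<odot>\<^bsub>M\<^esub> x) = r \<odot>\<^bsub>N\<^esub> h x)}"

definition lmodule_iso :: "'r ring \<Rightarrow> ('r, 'm) module \<Rightarrow> ('r, 'k) module \<Rightarrow> bool" where
  "lmodule_iso R M N \<longleftrightarrow> (\<exists>h \<in> lmodule_hom R M N. bij_betw h (carrier M) (carrier N))"

definition left_ideal_generated :: "'r ring \<Rightarrow> 'r set \<Rightarrow> 'r set" where
  "left_ideal_generated R S =
     generate (add_monoid R) {r \<otimes>\<^bsub>R\<^esub> s | r s. r \<in> carrier R \<and> s \<in> S}"


subsection \<open>Extension of scalars\<close>

text \<open>
  For a ring homomorphism \<open>\<phi>\<close> from a commutative ring \<open>R\<close> to \<open>D\<close>, the left \<open>D\<close>-module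
  \<open>D \<otimes>\<^sub>R V\<close> is the free abelian group on \<open>D \<times> V\<close> modulo the subgroup
  expressing biadditivity and \<open>R\<close>-balancedness; \<open>D\<close> acts from the left on the first factor.
\<close>

definition free_pairs :: "'a ring \<Rightarrow> ('r, 'v) module \<Rightarrow> ('a, ('a \<times> 'v) \<Rightarrow>\<^sub>0 int) module" where
  "free_pairs D V = \<lparr>carrier = carrier (free_Abelian_group (carrier D \<times> carrier V)),
     mult = undefined, one = undefined, ring.zero = 0, ring.add = (+),
     smult = (\<lambda>P. frag_extend (\<lambda>(Q, v). frag_of (P \<otimes>\<^bsub>D\<^esub> Q, v)))\<rparr>"

definition tensor_relations ::
  "'r ring \<Rightarrow> 'a ring \<Rightarrow> ('r \<Rightarrow> 'a) \<Rightarrow> ('r, 'v) module \<Rightarrow> (('a \<times> 'v) \<Rightarrow>\<^sub>0 int) set" where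
  "tensor_relations R D \<phi> V = generate (free_Abelian_group (carrier D \<times> carrier V))
     ({frag_of (P \<oplus>\<^bsub>D\<^esub> Q, v) - frag_of (P, v) - frag_of (Q, v) | P Q v.
         P \<in> carrier D \<and> Q \<in> carrier D \<and> v \<in> carrier V} \<union>
      {frag_of (P, v \<oplus>\<^bsub>V\<^esub> w) - frag_of (P, v) - frag_of (P, w) | P v w.
         P \<in> carrier D \<and> v \<in> carrier V \<and> w \<in> carrier V} \<union>
      {frag_of (P \<otimes>\<^bsub>D\<^esub> \<phi> r, v) - frag_of (P, r \<odot>\<^bsub>V\<^esub> v) | P r v.
         P \<in> carrier D \<and> r \<in> carrier R \<and> v \<in> carrier V})"

definition tensor_module ::
  "'r ring \<Rightarrow> 'a ring \<Rightarrow> ('r \<Rightarrow> 'a) \<Rightarrow> ('r, 'v) module \<Rightarrow> ('a, (('a \<times> 'v) \<Rightarrow>\<^sub>0 int) set) module" where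
  "tensor_module R D \<phi> V = quot_module (free_pairs D V) (tensor_relations R D \<phi> V)"

definition pure_tensor ::
  "'r ring \<Rightarrow> 'a ring \<Rightarrow> ('r \<Rightarrow> 'a) \<Rightarrow> ('r, 'v) module \<Rightarrow> 'a \<Rightarrow> 'v \<Rightarrow> (('a \<times> 'v) \<Rightarrow>\<^sub>0 int) set" where
  "pure_tensor R D \<phi> V P v = tensor_relations R D \<phi> V +>\<^bsub>free_pairs D V\<^esub> frag_of (P, v)"

definition tensor_grading ::
  "'r ring \<Rightarrow> 'a ring \<Rightarrow> ('r \<Rightarrow> 'a) \<Rightarrow> ('r, 'v) module \<Rightarrow> ('k::plus \<Rightarrow> 'a set) \<Rightarrow> ('k \<Rightarrow> 'v set)
     \<Rightarrow> 'k \<Rightarrow> (('a \<times> 'v) \<Rightarrow>\<^sub>0 int) set set" where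
  "tensor_grading R D \<phi> V GD GV \<alpha> = generate (add_monoid (tensor_module R D \<phi> V))
     {pure_tensor R D \<phi> V P v | P v \<gamma> \<delta>. P \<in> GD \<gamma> \<and> v \<in> GV \<delta> \<and> \<gamma> + \<delta> = \<alpha>}"


subsection \<open>Koszul homology\<close>

text \<open>
  The Koszul complex of commuting endomorphisms \<open>\<phi> i\<close> of \<open>M\<close>, with
  \<open>K\<^sub>p = \<Oplus>\<^bsub>card S = p\<^esub> M \<cdot> e\<^sub>S\<close> and
  \<open>d (m \<cdot> e\<^sub>S) = (\<Sum>i\<in>S. (-1) ^ card {k\<in>S. k < i} \<cdot> \<phi> i m \<cdot> e\<^bsub>S-{i}\<^esub>)\<close>.
  For \<open>p = 0\<close> the target of \<open>koszul_d M \<phi> p\<close> is a direct sum over the empty set, hence zero.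
\<close>

definition koszul_module :: "('r, 'm) module \<Rightarrow> nat \<Rightarrow> ('r, 'd::finite set \<Rightarrow> 'm) module" where
  "koszul_module M p = direct_sum {S. card S = p} (\<lambda>_. M)"

definition koszul_d ::
  "('r, 'm) module \<Rightarrow> ('d::{finite,linorder} \<Rightarrow> 'm \<Rightarrow> 'm) \<Rightarrow> nat \<Rightarrow> ('d set \<Rightarrow> 'm) \<Rightarrow> 'd set \<Rightarrow> 'm" where
  "koszul_d M \<phi> p f = (\<lambda>T\<in>{T. Suc (card T) = p}.
     finsum M (\<lambda>i. if even (card {k\<in>T. k < i}) then \<phi> i (f (insert i T))
                   else \<ominus>\<^bsub>M\<^esub> \<phi> i (f (insert i T))) (- T))"

definition koszul_cycles ::
  "('r, 'm) module \<Rightarrow> ('d::{finite,linorder} \<Rightarrow> 'm \<Rightarrow> 'm) \<Rightarrow> nat \<Rightarrow> ('d set \<Rightarrow> 'm) set" where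
  "koszul_cycles M \<phi> p = {f \<in> carrier (koszul_module M p).
     koszul_d M \<phi> p f = (\<lambda>T\<in>{T. Suc (card T) = p}. \<zero>\<^bsub>M\<^esub>)}"

definition koszul_homology ::
  "('r, 'm) module \<Rightarrow> ('d::{finite,linorder} \<Rightarrow> 'm \<Rightarrow> 'm) \<Rightarrow> nat \<Rightarrow> ('r, ('d set \<Rightarrow> 'm) set) module" where
  "koszul_homology M \<phi> p =
     quot_module ((koszul_module M p)\<lparr>carrier := koszul_cycles M \<phi> p\<rparr>)
       (koszul_d M \<phi> (Suc p) ` carrier (koszul_module M (Suc p)))"


section \<open>The Weyl algebra\<close>

text \<open>The operator \<open>\<partial>\<^sup>u\<close>, given by \<open>\<partial>\<^sup>u x\<^sup>m = (\<Prod>j. m\<^sub>j (m\<^sub>j - 1) \<cdots> (m\<^sub>j - u\<^sub>j + 1)) x\<^bsup>m-u\<^esup>\<close>.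
  If \<open>m\<^sub>j < u\<^sub>j\<close> for some \<open>j\<close>, then the coefficient contains the factor \<open>0\<close>.\<close>

definition dmon :: "('n::finite \<Rightarrow>\<^sub>0 nat) \<Rightarrow> 'n cpoly \<Rightarrow> 'n cpoly" where
  "dmon u f = (\<Sum>m\<in>Poly_Mapping.keys f. monomial (m - u)
     (of_nat (\<Prod>j\<in>UNIV. \<Prod>k<Poly_Mapping.lookup u j. Poly_Mapping.lookup m j - k)
        * Poly_Mapping.lookup f m))"

abbreviation partial_deriv :: "'n::finite \<Rightarrow> 'n cpoly \<Rightarrow> 'n cpoly" where
  "partial_deriv j \<equiv> dmon (Poly_Mapping.single j 1)"

text \<open>The Weyl algebra as the algebra of linear operators on \<open>\<complex>[x]\<close> that is generated by the
  multiplications by the variables and the partial derivatives.\<close>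

inductive_set weyl_ops :: "('n::finite cpoly \<Rightarrow> 'n cpoly) set" where
  scalar: "(\<lambda>f. monomial 0 c * f) \<in> weyl_ops"
| var: "(\<lambda>f. pvar j * f) \<in> weyl_ops"
| deriv: "partial_deriv j \<in> weyl_ops"
| add: "P \<in> weyl_ops \<Longrightarrow> Q \<in> weyl_ops \<Longrightarrow> (\<lambda>f. P f + Q f) \<in> weyl_ops"
| comp: "P \<in> weyl_ops \<Longrightarrow> Q \<in> weyl_ops \<Longrightarrow> P \<circ> Q \<in> weyl_ops"

definition weyl :: "('n::finite cpoly \<Rightarrow> 'n cpoly) ring" where
  "weyl = \<lparr>carrier = weyl_ops, mult = (\<circ>), one = id,
     ring.zero = (\<lambda>f. 0), ring.add = (\<lambda>P Q f. P f + Q f)\<rparr>"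

text \<open>The inclusion of \<open>\<complex>[\<partial>]\<close> into the Weyl algebra.\<close>

definition diff_op :: "'n::finite cpoly \<Rightarrow> 'n cpoly \<Rightarrow> 'n cpoly" where
  "diff_op p f = (\<Sum>u\<in>Poly_Mapping.keys p. monomial 0 (Poly_Mapping.lookup p u) * dmon u f)"

definition weyl_degree_part ::
  "int^'n::finite^'d::finite \<Rightarrow> int^'d \<Rightarrow> ('n cpoly \<Rightarrow> 'n cpoly) set" where
  "weyl_degree_part A \<alpha> = generate (add_monoid weyl)
     {(\<lambda>f. monomial u c * dmon v f) | u v c. A *v exp_vec u - A *v exp_vec v = \<alpha>}"

definition euler_op ::
  "int^'n::finite^'d::finite \<Rightarrow> complex^'d \<Rightarrow> 'd \<Rightarrow> 'n cpoly \<Rightarrow> 'n cpoly" where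
  \<comment> \<open>\<open>E\<^sub>i - \<beta>\<^sub>i\<close> as an element of the Weyl algebra\<close>
  "euler_op A \<beta> i f =
     (\<Sum>j\<in>UNIV. monomial 0 (of_int (A $ i $ j)) * (pvar j * partial_deriv j f)) - monomial 0 (\<beta> $ i) * f"

definition H_ideal ::
  "int^'n::finite^'d::finite \<Rightarrow> 'n cpoly set \<Rightarrow> complex^'d \<Rightarrow> ('n cpoly \<Rightarrow> 'n cpoly) set" where
  "H_ideal A I \<beta> = left_ideal_generated weyl (diff_op ` I)
     <+>\<^bsub>weyl\<^esub> left_ideal_generated weyl (range (euler_op A \<beta>))"

definition D_mod_H ::
  "int^'n::finite^'d::finite \<Rightarrow> 'n cpoly set \<Rightarrow> complex^'d
     \<Rightarrow> ('n cpoly \<Rightarrow> 'n cpoly, ('n cpoly \<Rightarrow> 'n cpoly) set) module" where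
  "D_mod_H A I \<beta> = quot_module (regular_module weyl) (H_ideal A I \<beta>)"


section \<open>Euler-Koszul homology\<close>

type_synonym ('n, 'v) weyl_tensor = "((('n cpoly \<Rightarrow> 'n cpoly) \<times> 'v) \<Rightarrow>\<^sub>0 int) set"

definition weyl_tensor ::
  "('n::finite cpoly, 'v) module \<Rightarrow> ('n cpoly \<Rightarrow> 'n cpoly, ('n, 'v) weyl_tensor) module" where
  "weyl_tensor V = tensor_module poly_ring weyl diff_op V"

definition weyl_tensor_grading ::
  "int^'n::finite^'d::finite \<Rightarrow> ('n cpoly, 'v) module \<Rightarrow> (int^'d \<Rightarrow> 'v set)
     \<Rightarrow> int^'d \<Rightarrow> ('n, 'v) weyl_tensor set" where
  "weyl_tensor_grading A V G = tensor_grading poly_ring weyl diff_op V (weyl_degree_part A) G"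

text \<open>
  The endomorphism \<open>E\<^sub>i - \<beta>\<^sub>i\<close> of \<open>D \<otimes> V\<close>, for an \<open>A\<close>-graded module \<open>V\<close> with grading \<open>G\<close>:
  the unique \<open>D\<close>-linear map acting on every homogeneous \<open>z\<close> of degree \<open>\<alpha>\<close> as left
  multiplication by \<open>E\<^sub>i - \<beta>\<^sub>i - \<alpha>\<^sub>i\<close>.  (Extensionality only pins down its values outside the carrier.)
\<close>

definition euler_endo ::
  "int^'n::finite^'d::finite \<Rightarrow> complex^'d \<Rightarrow> ('n cpoly, 'v) module \<Rightarrow> (int^'d \<Rightarrow> 'v set)
     \<Rightarrow> 'd \<Rightarrow> ('n, 'v) weyl_tensor \<Rightarrow> ('n, 'v) weyl_tensor" where
  "euler_endo A \<beta> V G i = (THE \<phi>.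
     \<phi> \<in> lmodule_hom weyl (weyl_tensor V) (weyl_tensor V) \<and>
     \<phi> \<in> extensional (carrier (weyl_tensor V)) \<and>
     (\<forall>\<alpha>. \<forall>z\<in>weyl_tensor_grading A V G \<alpha>.
        \<phi> z = euler_op A (\<beta> + of_int_vec \<alpha>) i \<odot>\<^bsub>weyl_tensor V\<^esub> z))"

definition euler_koszul_homology ::
  "int^'n::finite^'d::{finite,linorder} \<Rightarrow> complex^'d::{finite,linorder} \<Rightarrow> ('n cpoly, 'v) module
     \<Rightarrow> (int^'d::{finite,linorder} \<Rightarrow> 'v set) \<Rightarrow> nat \<Rightarrow> ('n cpoly \<Rightarrow> 'n cpoly, ('d set \<Rightarrow> ('n, 'v) weyl_tensor) set) module" where
  "euler_koszul_homology A \<beta> V G = koszul_homology (weyl_tensor V) (euler_endo A \<beta> V G)"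

definition qdeg :: "('r, 'v) module \<Rightarrow> (int^'d::finite \<Rightarrow> 'v set) \<Rightarrow> (complex^'d) set" where
  "qdeg V G = zariski_closure (of_int_vec ` {\<alpha>. \<exists>v\<in>G \<alpha>. v \<noteq> \<zero>\<^bsub>V\<^esub>})"


subsection \<open>The modules attached to a primary decomposition\<close>

definition poly_quot :: "'n cpoly set \<Rightarrow> ('n cpoly, 'n cpoly set) module" where
  "poly_quot I = quot_module (regular_module poly_ring) I"

definition poly_quot_grading ::
  "int^'n::finite^'d::finite \<Rightarrow> 'n cpoly set \<Rightarrow> int^'d \<Rightarrow> 'n cpoly set set" where
  "poly_quot_grading A I = quot_grading (regular_module poly_ring) (poly_degree_part A) I"

definition EK_quot ::
  "int^'n::finite^'d::{finite,linorder} \<Rightarrow> complex^'d::{finite,linorder} \<Rightarrow> 'n cpoly set \<Rightarrow> nat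
     \<Rightarrow> ('n cpoly \<Rightarrow> 'n cpoly, ('d set \<Rightarrow> ('n, 'n cpoly set) weyl_tensor) set) module" where
  "EK_quot A \<beta> I = euler_koszul_homology A \<beta> (poly_quot I) (poly_quot_grading A I)"

definition component_sum ::
  "'n cpoly set \<Rightarrow> ('n cpoly set \<Rightarrow> 'n cpoly set) \<Rightarrow> ('n cpoly, 'n cpoly set \<Rightarrow> 'n cpoly set) module" where
  "component_sum I C = direct_sum (assoc_primes I) (\<lambda>Q. poly_quot (C Q))"

text \<open>The natural map sends the coset \<open>X = I + f\<close> to the family of cosets \<open>C Q + X = C Q + f\<close>.\<close>

definition natural_map ::
  "'n cpoly set \<Rightarrow> ('n cpoly set \<Rightarrow> 'n cpoly set) \<Rightarrow> 'n cpoly set \<Rightarrow> 'n cpoly set \<Rightarrow> 'n cpoly set" where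
  "natural_map I C X = (\<lambda>Q\<in>assoc_primes I. C Q <+>\<^bsub>poly_ring\<^esub> X)"

definition P_module ::
  "'n cpoly set \<Rightarrow> ('n cpoly set \<Rightarrow> 'n cpoly set)
     \<Rightarrow> ('n cpoly, ('n cpoly set \<Rightarrow> 'n cpoly set) set) module" where
  "P_module I C = quot_module (component_sum I C) (natural_map I C ` carrier (poly_quot I))"

definition P_grading ::
  "int^'n::finite^'d::finite \<Rightarrow> 'n cpoly set \<Rightarrow> ('n cpoly set \<Rightarrow> 'n cpoly set)
     \<Rightarrow> int^'d \<Rightarrow> ('n cpoly set \<Rightarrow> 'n cpoly set) set set" where
  "P_grading A I C = quot_grading (component_sum I C)
     (direct_sum_grading (assoc_primes I) (\<lambda>Q. poly_quot (C Q)) (\<lambda>Q. poly_quot_grading A (C Q)))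
     (natural_map I C ` carrier (poly_quot I))"

definition Z_Andean ::
  "int^'n::finite^'d::finite \<Rightarrow> 'n cpoly set \<Rightarrow> ('n cpoly set \<Rightarrow> 'n cpoly set) \<Rightarrow> (complex^'d) set" where
  "Z_Andean A I C =
     (\<Union>Q\<in>{Q\<in>assoc_primes I. Andean A Q}. qdeg (poly_quot (C Q)) (poly_quot_grading A (C Q)))"

definition Z_primary ::
  "int^'n::finite^'d::finite \<Rightarrow> 'n cpoly set \<Rightarrow> ('n cpoly set \<Rightarrow> 'n cpoly set) \<Rightarrow> (complex^'d) set" where
  "Z_primary A I C = qdeg (P_module I C) (P_grading A I C) \<union> Z_Andean A I C"

end

theory Submission
  imports Defs "HOL-Library.Function_Algebras" "HOL-Computational_Algebra.Polynomial"
begin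

text \<open>
  Write \<open>D\<close> for the Weyl algebra.  If \<open>P \<in> D\<close> is homogeneous of degree \<open>\<alpha>\<close>, then
  \<open>P (E\<^sub>i - \<beta>\<^sub>i) = (E\<^sub>i - \<beta>\<^sub>i - \<alpha>\<^sub>i) P\<close>.  For a graded ideal \<open>C\<close> the module
  \<open>D \<otimes> \<complex>[\<partial>]/C\<close> is \<open>D/DC\<close>, and the endomorphism \<open>E\<^sub>i - \<beta>\<^sub>i\<close> of it is therefore nothing but
  right multiplication by the operator \<open>E\<^sub>i - \<beta>\<^sub>i\<close> (lemma \<open>euler_endo_pt\<close>).  So the Euler-Koszul
  homology of \<open>\<complex>[\<partial>]/C\<close> is the Koszul homology of \<open>D/DC\<close> for commuting right multiplications, and
  cycles and boundaries can be represented by families of operators (lemma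
  \<open>presentation_EK_quot\<close>).

  Since \<open>D\<close> is a free right \<open>\<complex>[\<partial>]\<close>-module on the monomials in \<open>x\<close>, tensoring
  \<open>0 \<rightarrow> \<complex>[\<partial>]/I \<rightarrow> \<Oplus>\<^sub>Q \<complex>[\<partial>]/C\<^sub>Q \<rightarrow> P\<^sub>I \<rightarrow> 0\<close> with \<open>D\<close> preserves exactness; in terms of
  operators, \<open>\<Inter>\<^sub>Q D C\<^sub>Q = D I\<close> (lemma \<open>weyl_ext_INT\<close>).  If the homology of \<open>P\<^sub>I\<close> and that of all
  Andean components vanishes, the long exact sequence gives the asserted isomorphism.  The lemmas
  \<open>boundary_if_component_boundaries\<close> (injectivity) and \<open>cycle_lifts\<close> (surjectivity) carry out this
  part of the diagram chase on representatives.  As \<open>D/H\<^sub>A\<close> is the homology in degree zero, the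
  second isomorphism is the case \<open>i = 0\<close>.

  What remains is that the Euler-Koszul homology of \<open>V\<close> vanishes if \<open>-\<beta>\<close> is not a quasidegree of
  \<open>V\<close>, for a graded quotient \<open>V\<close> of a finitely generated free module with generators of degree
  zero (lemma \<open>acyclic_families\<close>).  Let \<open>p\<close> be a polynomial that vanishes on the degrees of \<open>V\<close> but
  not at \<open>-\<beta>\<close>.  The module is built up by cyclic extensions \<open>X \<subseteq> X + D v\<close> with \<open>v\<close> homogeneous of
  some degree \<open>\<alpha>\<close>.  Let \<open>J\<close> be the set of all \<open>j\<close> with \<open>\<partial>\<^sub>j v \<notin> X\<close>.  If no monomial in the
  variables from \<open>J\<close> maps \<open>v\<close> into \<open>X\<close>, then \<open>p\<close> vanishes on \<open>\<alpha> - \<nat> A\<^sub>J\<close>, hence on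
  \<open>\<alpha> + \<complex> A\<^sub>J\<close>, so that \<open>\<beta> + \<alpha> \<notin> \<complex> A\<^sub>J\<close>; a linear form \<open>l\<close> that kills \<open>\<complex> A\<^sub>J\<close> and takes the value \<open>-1\<close>
  at \<open>\<beta> + \<alpha>\<close> makes \<open>\<Sum>\<^sub>i l\<^sub>i (E\<^sub>i - \<beta>\<^sub>i)\<close> act as the identity on \<open>(X + D v)/X\<close>, and the Koszul
  complex is contractible.  Otherwise a monomial in the variables from \<open>J\<close> kills \<open>v\<close>, and peeling
  off its variables one by one inserts extensions for which fewer variables act nontrivially on the
  generator.  This replaces the usual filtration by prime quotients and yields an induction on the
  cardinality of \<open>J\<close>.
\<close>

section \<open>The Koszul complex of commuting endomorphisms\<close>

definition koszul_sign :: "'d::linorder \<Rightarrow> 'd set \<Rightarrow> 'a::ab_group_add \<Rightarrow> 'a" where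
  "koszul_sign i T x = (if even (card {k\<in>T. k < i}) then x else - x)"

text \<open>
  A chain is a function on all subsets of the index set, \<open>z T\<close> being the coefficient of \<open>e\<^sub>T\<close>.
  Thus one chain has coefficients in all homological degrees \<open>card T\<close> at once, and the differential
  needs no degree argument.
\<close>

definition kdiff :: "('d::{finite,linorder} \<Rightarrow> 'a::ab_group_add \<Rightarrow> 'a) \<Rightarrow> ('d set \<Rightarrow> 'a) \<Rightarrow> 'd set \<Rightarrow> 'a" where
  "kdiff \<theta> z T = (\<Sum>i\<in>-T. koszul_sign i T (\<theta> i (z (insert i T))))"

text \<open>
  Exterior multiplication by \<open>e\<^sub>i\<close> from the left.
\<close>

definition kwedge :: "'d::{finite,linorder} \<Rightarrow> ('d set \<Rightarrow> 'a::ab_group_add) \<Rightarrow> 'd set \<Rightarrow> 'a" where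
  "kwedge i z T = (if i \<in> T then koszul_sign i (T - {i}) (z (T - {i})) else 0)"

text \<open>
  For subgroups \<open>X \<subseteq> Y\<close> that are stable under all \<open>\<theta> i\<close>, this is the vanishing of the Koszul
  homology of \<open>Y/X\<close>, expressed with representatives so that no quotient has to be formed.
\<close>

definition acyclic_over ::
  "('d::{finite,linorder} \<Rightarrow> 'a::ab_group_add \<Rightarrow> 'a) \<Rightarrow> 'a set \<Rightarrow> 'a set \<Rightarrow> bool" where
  "acyclic_over \<theta> Y X \<longleftrightarrow>
     (\<forall>z. (\<forall>T. z T \<in> Y) \<and> (\<forall>T. kdiff \<theta> z T \<in> X) \<longrightarrow>
        (\<exists>w. (\<forall>T. w T \<in> Y) \<and> (\<forall>T. z T - kdiff \<theta> w T \<in> X)))"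

definition additive_subgroup_set :: "'a::ab_group_add set \<Rightarrow> bool" where
  "additive_subgroup_set X \<longleftrightarrow> 0 \<in> X \<and> (\<forall>x\<in>X. \<forall>y\<in>X. x - y \<in> X)"

lemma subgroup_setD:
  assumes "additive_subgroup_set X"
  shows "0 \<in> X" "x \<in> X \<Longrightarrow> y \<in> X \<Longrightarrow> x - y \<in> X" "x \<in> X \<Longrightarrow> - x \<in> X"
    "x \<in> X \<Longrightarrow> y \<in> X \<Longrightarrow> x + y \<in> X"
proof -
  show 0: "0 \<in> X" and d: "x \<in> X \<Longrightarrow> y \<in> X \<Longrightarrow> x - y \<in> X" for x y
    using assms by (auto simp: additive_subgroup_set_def)
  show m: "x \<in> X \<Longrightarrow> - x \<in> X" for x using d[of 0 x] 0 by simp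
  show "x \<in> X \<Longrightarrow> y \<in> X \<Longrightarrow> x + y \<in> X" using d[of x "- y"] m[of y] by simp
qed

lemma subgroup_set_sum:
  assumes "additive_subgroup_set X" "\<And>i. i \<in> S \<Longrightarrow> f i \<in> X"
  shows "sum f S \<in> X"
  using assms(2) by (induction S rule: infinite_finite_induct) (auto intro: subgroup_setD[OF assms(1)])

lemma koszul_sign_add: "koszul_sign i T (x + y) = koszul_sign i T x + koszul_sign i T y"
  by (simp add: koszul_sign_def)

lemma koszul_sign_diff: "koszul_sign i T (x - y) = koszul_sign i T x - koszul_sign i T y"
  by (simp add: koszul_sign_def)

lemma koszul_sign_minus: "koszul_sign i T (- x) = - koszul_sign i T x"
  by (simp add: koszul_sign_def)

lemma koszul_sign_0 [simp]: "koszul_sign i T 0 = 0"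
  by (simp add: koszul_sign_def)

lemma koszul_sign_sum: "koszul_sign i T (sum f S) = (\<Sum>s\<in>S. koszul_sign i T (f s))"
  by (simp add: koszul_sign_def sum_negf)

lemma koszul_sign_involutive [simp]: "koszul_sign i T (koszul_sign i T x) = x"
  by (simp add: koszul_sign_def)

lemma koszul_sign_commute: "koszul_sign i T (koszul_sign k U x) = koszul_sign k U (koszul_sign i T x)"
  by (simp add: koszul_sign_def)

lemma koszul_sign_in:
  assumes "additive_subgroup_set X" "x \<in> X" shows "koszul_sign i T x \<in> X"
  using assms by (simp add: koszul_sign_def subgroup_setD)

lemma koszul_sign_insert:
  fixes T :: "'d::{finite,linorder} set"
  assumes "i \<notin> T"
  shows "koszul_sign k (insert i T) x = (if i < k then - koszul_sign k T x else koszul_sign k T x)"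
proof -
  have "{l \<in> insert i T. l < k} = (if i < k then insert i {l \<in> T. l < k} else {l \<in> T. l < k})"
    by auto
  then show ?thesis using assms by (auto simp: koszul_sign_def)
qed

text \<open>
  Passing from \<open>e\<^sub>T \<and> e\<^sub>i \<and> e\<^sub>k\<close> to \<open>e\<^sub>T\<close> in the two possible orders produces opposite signs: the
  larger of the two indices counts the smaller one exactly if that one is still present.
\<close>

lemma koszul_sign_swap:
  fixes T :: "'d::{finite,linorder} set"
  assumes "i \<notin> T" "k \<notin> T" "i \<noteq> k"
  shows "koszul_sign i T (koszul_sign k (insert i T) x) = - koszul_sign k T (koszul_sign i (insert k T) x)"
  using assms by (cases "i < k")
    (auto simp: koszul_sign_insert koszul_sign_minus koszul_sign_commute[of i T k])

locale commuting_endos =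
  fixes \<theta> :: "'d::{finite,linorder} \<Rightarrow> 'a::ab_group_add \<Rightarrow> 'a"
  assumes endo_add: "\<theta> i (x + y) = \<theta> i x + \<theta> i y"
    and endo_commute: "\<theta> i (\<theta> k x) = \<theta> k (\<theta> i x)"
begin

lemma endo_0 [simp]: "\<theta> i 0 = 0"
  using endo_add[of i 0 0] by simp

lemma endo_minus: "\<theta> i (- x) = - \<theta> i x"
  using endo_add[of i x "- x"] by (simp add: eq_neg_iff_add_eq_0 add.commute)

lemma endo_diff: "\<theta> i (x - y) = \<theta> i x - \<theta> i y"
  using endo_add[of i x "- y"] by (simp add: endo_minus)

lemma endo_sum: "\<theta> i (sum f S) = (\<Sum>s\<in>S. \<theta> i (f s))"
  by (induction S rule: infinite_finite_induct) (auto simp: endo_add)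

lemma endo_sign: "\<theta> i (koszul_sign k T x) = koszul_sign k T (\<theta> i x)"
  by (simp add: koszul_sign_def endo_minus)

lemma kdiff_add: "kdiff \<theta> (\<lambda>T. z T + w T) T = kdiff \<theta> z T + kdiff \<theta> w T"
  by (simp add: kdiff_def endo_add koszul_sign_add sum.distrib)

lemma kdiff_diff: "kdiff \<theta> (\<lambda>T. z T - w T) T = kdiff \<theta> z T - kdiff \<theta> w T"
  by (simp add: kdiff_def endo_diff koszul_sign_diff sum_subtractf)

lemma kdiff_sum: "kdiff \<theta> (\<lambda>T. \<Sum>s\<in>S. z s T) T = (\<Sum>s\<in>S. kdiff \<theta> (z s) T)"
  unfolding kdiff_def endo_sum koszul_sign_sum by (rule sum.swap)

lemma kdiff_in:
  assumes "additive_subgroup_set X" "\<And>i x. x \<in> X \<Longrightarrow> \<theta> i x \<in> X" "\<And>i. i \<notin> T \<Longrightarrow> z (insert i T) \<in> X"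
  shows "kdiff \<theta> z T \<in> X"
  unfolding kdiff_def using assms by (intro subgroup_set_sum koszul_sign_in) auto

text \<open>
  The double sum runs over ordered pairs of distinct indices; the pairs \<open>(i, k)\<close> and \<open>(k, i)\<close>
  cancel by the sign rule and because the endomorphisms commute.
\<close>

lemma kdiff_kdiff: "kdiff \<theta> (kdiff \<theta> z) T = 0"
proof -
  \<comment> \<open>The contribution of removing first \<open>k\<close>, then \<open>i\<close>.\<close>
  define g where "g = (\<lambda>(i, k). koszul_sign i T (koszul_sign k (insert i T) (\<theta> i (\<theta> k (z (insert k (insert i T)))))))"
  define P where "P = {(i, k). i \<notin> T \<and> k \<notin> T \<and> i < k}"
  define P' where "P' = {(i, k). i \<notin> T \<and> k \<notin> T \<and> k < i}"
  have anti: "g (k, i) = - g (i, k)" if "(i, k) \<in> P" for i k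
  proof -
    have ik: "i \<notin> T" "k \<notin> T" "k \<noteq> i" using that by (auto simp: P_def)
    have "g (k, i) = koszul_sign k T (koszul_sign i (insert k T) (\<theta> k (\<theta> i (z (insert i (insert k T))))))"
      by (simp add: g_def)
    also have "\<dots> = - koszul_sign i T (koszul_sign k (insert i T) (\<theta> k (\<theta> i (z (insert i (insert k T))))))"
      by (rule koszul_sign_swap) (use ik in auto)
    also have "\<dots> = - g (i, k)"
      unfolding g_def prod.case by (subst endo_commute, subst insert_commute) (rule refl)
    finally show ?thesis .
  qed
  have "kdiff \<theta> (kdiff \<theta> z) T = (\<Sum>i\<in>-T. \<Sum>k\<in>-insert i T. g (i, k))"
    by (simp add: kdiff_def g_def endo_sum endo_sign koszul_sign_sum)
  also have "\<dots> = sum g (SIGMA i:-T. -insert i T)"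
    by (simp add: sum.Sigma case_prod_eta)
  also have "(SIGMA i:-T. -insert i T) = P \<union> P'"
    by (auto simp: P_def P'_def)
  also have "sum g (P \<union> P') = sum g P + sum g P'"
    by (rule sum.union_disjoint) (auto simp: P_def P'_def)
  also have "sum g P' = (\<Sum>x\<in>P. g (prod.swap x))"
    by (rule sum.reindex_bij_witness[of _ prod.swap prod.swap]) (auto simp: P_def P'_def)
  also have "\<dots> = (\<Sum>x\<in>P. - g x)"
    by (rule sum.cong) (auto simp: anti)
  finally show ?thesis by (simp add: sum_negf)
qed

text \<open>
  Exterior multiplication by \<open>e\<^sub>i\<close> is a homotopy between zero and \<open>\<theta> i\<close>.  In particular \<open>\<theta> i\<close> acts
  as zero on Koszul homology.
\<close>

lemma kdiff_kwedge: "kdiff \<theta> (kwedge i z) T + kwedge i (kdiff \<theta> z) T = \<theta> i (z T)"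
proof (cases "i \<in> T")
  case False
  have "kdiff \<theta> (kwedge i z) T = (\<Sum>k\<in>-T. if k = i then \<theta> i (z T) else 0)"
    unfolding kdiff_def
    using False by (intro sum.cong) (auto simp: kwedge_def endo_sign)
  also have "\<dots> = \<theta> i (z T)" using False by simp
  finally show ?thesis using False by (simp add: kwedge_def)
next
  case True
  define U where "U = T - {i}"
  have T: "T = insert i U" "i \<notin> U" using True by (auto simp: U_def)
  have "kwedge i (kdiff \<theta> z) T
      = (\<Sum>k\<in>-U. koszul_sign i U (koszul_sign k U (\<theta> k (z (insert k U)))))"
    using True by (simp add: kwedge_def kdiff_def koszul_sign_sum flip: U_def)
  also have "-U = insert i (-T)" using T by auto
  also have "(\<Sum>k\<in>insert i (-T). koszul_sign i U (koszul_sign k U (\<theta> k (z (insert k U)))))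
      = \<theta> i (z T) + (\<Sum>k\<in>-T. koszul_sign i U (koszul_sign k U (\<theta> k (z (insert k U)))))"
    using True T by simp
  \<comment> \<open>The summand \<open>k = i\<close> of the second term is \<open>\<theta> i (z T)\<close>; the others cancel against the first.\<close>
  finally have 1: "kwedge i (kdiff \<theta> z) T = \<dots>" .
  have "kdiff \<theta> (kwedge i z) T = (\<Sum>k\<in>-T. - koszul_sign i U (koszul_sign k U (\<theta> k (z (insert k U)))))"
    unfolding kdiff_def
  proof (rule sum.cong)
    fix k assume k: "k \<in> - T"
    then have "insert k T - {i} = insert k U" "k \<notin> U" "k \<noteq> i" using T by auto
    then have "\<theta> k (kwedge i z (insert k T)) = koszul_sign i (insert k U) (\<theta> k (z (insert k U)))"
      using T by (simp add: kwedge_def endo_sign)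
    moreover have "koszul_sign k T (koszul_sign i (insert k U) x) = - koszul_sign i U (koszul_sign k U x)" for x :: 'a
    proof -
      have "koszul_sign k T (koszul_sign i (insert k U) x) = koszul_sign i (insert k U) (koszul_sign k (insert i U) x)"
        unfolding T(1) by (rule koszul_sign_commute)
      then show ?thesis
        using \<open>k \<noteq> i\<close> by (cases "i < k") (auto simp: koszul_sign_insert[OF \<open>k \<notin> U\<close>]
          koszul_sign_insert[OF \<open>i \<notin> U\<close>] koszul_sign_minus)
    qed
    ultimately show "koszul_sign k T (\<theta> k (kwedge i z (insert k T)))
        = - koszul_sign i U (koszul_sign k U (\<theta> k (z (insert k U))))" by simp
  qed simp
  then show ?thesis by (simp add: 1 sum_negf)
qed

lemma acyclic_refl: "additive_subgroup_set X \<Longrightarrow> acyclic_over \<theta> X X"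
  unfolding acyclic_over_def
  by (intro allI impI exI[of _ "\<lambda>_. 0"]) (auto simp: kdiff_def subgroup_setD)

text \<open>
  The part of the long exact sequence of \<open>0 \<rightarrow> Y/X \<rightarrow> Z/X \<rightarrow> Z/Y \<rightarrow> 0\<close> that shows the vanishing in
  the middle: subtracting a boundary moves a cycle from \<open>Z\<close> to \<open>Y\<close>, where it is a boundary.
\<close>

lemma acyclic_trans:
  assumes "acyclic_over \<theta> Z Y" "acyclic_over \<theta> Y X" "X \<subseteq> Y" "Y \<subseteq> Z"
    "additive_subgroup_set Z"
  shows "acyclic_over \<theta> Z X"
  unfolding acyclic_over_def
proof (intro allI impI)
  fix z :: "'d set \<Rightarrow> 'a" assume z: "(\<forall>T. z T \<in> Z) \<and> (\<forall>T. kdiff \<theta> z T \<in> X)"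
  then have "(\<forall>T. z T \<in> Z) \<and> (\<forall>T. kdiff \<theta> z T \<in> Y)" using assms(3) by auto
  then obtain w where w: "\<forall>T. w T \<in> Z" "\<forall>T. z T - kdiff \<theta> w T \<in> Y"
    using assms(1) unfolding acyclic_over_def by blast
  let ?z = "\<lambda>T. z T - kdiff \<theta> w T"
  have "kdiff \<theta> ?z T = kdiff \<theta> z T" for T
    using kdiff_diff[of z "kdiff \<theta> w" T] by (simp add: kdiff_kdiff)
  then have "(\<forall>T. ?z T \<in> Y) \<and> (\<forall>T. kdiff \<theta> ?z T \<in> X)" using w z by auto
  then obtain v where v: "\<forall>T. v T \<in> Y" "\<forall>T. ?z T - kdiff \<theta> v T \<in> X"
    using assms(2)[unfolded acyclic_over_def, rule_format, of ?z] by blast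
  \<comment> \<open>After subtracting the boundary of \<open>w\<close>, the rest of \<open>z\<close> is the boundary of \<open>v\<close> modulo \<open>X\<close>.\<close>
  show "\<exists>w. (\<forall>T. w T \<in> Z) \<and> (\<forall>T. z T - kdiff \<theta> w T \<in> X)"
  proof (intro exI[of _ "\<lambda>T. w T + v T"] conjI allI)
    show "w T + v T \<in> Z" for T
      using subgroup_setD(4)[OF assms(5), of "w T" "v T"] w(1) v(1) assms(4) by blast
    show "z T - kdiff \<theta> (\<lambda>T. w T + v T) T \<in> X" for T
      using v(2) by (simp add: kdiff_add diff_diff_eq)
  qed
qed

text \<open>
  Acyclicity speaks of chains with coefficients in all degrees.  A cycle of degree \<open>p\<close> becomes one
  of these if its coefficients in the other degrees are replaced by zero.
\<close>

lemma acyclic_over_at: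
  assumes acy: "acyclic_over \<theta> Y X" and X: "additive_subgroup_set X" and Y: "0 \<in> Y"
    and z: "\<And>T. card T = p \<Longrightarrow> z T \<in> Y" and dz: "\<And>T. Suc (card T) = p \<Longrightarrow> kdiff \<theta> z T \<in> X"
  shows "\<exists>w. (\<forall>T. w T \<in> Y) \<and> (\<forall>T. card T = p \<longrightarrow> z T - kdiff \<theta> w T \<in> X)"
proof -
  let ?z = "\<lambda>T. if card T = p then z T else 0"
  have "kdiff \<theta> ?z T = (if Suc (card T) = p then kdiff \<theta> z T else 0)" for T
    by (auto simp: kdiff_def intro!: sum.cong sum.neutral)
  then have "(\<forall>T. ?z T \<in> Y) \<and> (\<forall>T. kdiff \<theta> ?z T \<in> X)"
    using Y z dz subgroup_setD(1)[OF X] by auto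
  then obtain w where w: "\<forall>T. w T \<in> Y" "\<forall>T. ?z T - kdiff \<theta> w T \<in> X"
    using acy[unfolded acyclic_over_def, rule_format, of ?z] by blast
  have "z T - kdiff \<theta> w T \<in> X" if "card T = p" for T
    using w(2)[rule_format, of T] that by simp
  then show ?thesis using w(1) by blast
qed

text \<open>
  If \<open>\<Sum>\<^sub>i \<mu>\<^sub>i \<theta>\<^sub>i\<close> acts as the identity on \<open>Y/X\<close>, then \<open>\<Sum>\<^sub>i \<mu>\<^sub>i e\<^sub>i \<and> \<dots>\<close> is a contracting homotopy, by
  the homotopy formula for each single \<open>\<theta>\<^sub>i\<close>.
\<close>

lemma acyclic_over_if_combination_identity:
  fixes \<mu> :: "'d \<Rightarrow> 'a \<Rightarrow> 'a"
  assumes X: "additive_subgroup_set X" and Y: "additive_subgroup_set Y"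
    and \<mu>_add: "\<And>i x y. \<mu> i (x + y) = \<mu> i x + \<mu> i y"
    and \<mu>_commute: "\<And>i k x. \<mu> i (\<theta> k x) = \<theta> k (\<mu> i x)"
    and \<mu>_X: "\<And>i x. x \<in> X \<Longrightarrow> \<mu> i x \<in> X" and \<mu>_Y: "\<And>i x. x \<in> Y \<Longrightarrow> \<mu> i x \<in> Y"
    and ident: "\<And>y. y \<in> Y \<Longrightarrow> y - (\<Sum>i\<in>UNIV. \<mu> i (\<theta> i y)) \<in> X"
  shows "acyclic_over \<theta> Y X"
  unfolding acyclic_over_def
proof (intro allI impI)
  fix z :: "'d set \<Rightarrow> 'a" assume z: "(\<forall>T. z T \<in> Y) \<and> (\<forall>T. kdiff \<theta> z T \<in> X)"
  have \<mu>_0: "\<mu> i 0 = 0" for i using \<mu>_add[of i 0 0] by simp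
  have \<mu>_minus: "\<mu> i (- x) = - \<mu> i x" for i x
    using \<mu>_add[of i x "- x"] by (simp add: eq_neg_iff_add_eq_0 add.commute \<mu>_0)
  have \<mu>_sum: "\<mu> i (sum f S) = (\<Sum>s\<in>S. \<mu> i (f s))" for i and f :: "'d \<Rightarrow> 'a" and S
    by (induction S rule: infinite_finite_induct) (auto simp: \<mu>_add \<mu>_0)
  have \<mu>_sign: "\<mu> i (koszul_sign k T x) = koszul_sign k T (\<mu> i x)" for i k x and T :: "'d set"
    by (simp add: koszul_sign_def \<mu>_minus)
  \<comment> \<open>The contracting homotopy applied to \<open>z\<close>.\<close>
  define w where "w = (\<lambda>T. \<Sum>i\<in>UNIV. \<mu> i (kwedge i z T))"
  have "kwedge i z T \<in> Y" for i T
    using z by (auto simp: kwedge_def intro!: koszul_sign_in subgroup_setD[OF Y] Y)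
  then have wY: "w T \<in> Y" for T
    unfolding w_def by (intro subgroup_set_sum[OF Y] \<mu>_Y)
  have "kdiff \<theta> (\<lambda>T. \<mu> i (kwedge i z T)) T = \<mu> i (\<theta> i (z T)) - \<mu> i (kwedge i (kdiff \<theta> z) T)" for i T
  proof -
    have "kdiff \<theta> (\<lambda>T. \<mu> i (kwedge i z T)) T = \<mu> i (kdiff \<theta> (kwedge i z) T)"
      by (simp add: kdiff_def \<mu>_sum \<mu>_sign \<mu>_commute)
    then show ?thesis
      using \<mu>_add[of i "kdiff \<theta> (kwedge i z) T" "kwedge i (kdiff \<theta> z) T"]
      by (simp add: kdiff_kwedge algebra_simps)
  qed
  then have dw: "kdiff \<theta> w T =
      (\<Sum>i\<in>UNIV. \<mu> i (\<theta> i (z T))) - (\<Sum>i\<in>UNIV. \<mu> i (kwedge i (kdiff \<theta> z) T))" for T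
    unfolding w_def kdiff_sum by (simp add: sum_subtractf)
  have "kwedge i (kdiff \<theta> z) T \<in> X" for i T
    using z by (auto simp: kwedge_def intro!: koszul_sign_in subgroup_setD[OF X] X)
  then have "(\<Sum>i\<in>UNIV. \<mu> i (kwedge i (kdiff \<theta> z) T)) \<in> X" for T
    by (intro subgroup_set_sum[OF X] \<mu>_X)
  then have "z T - kdiff \<theta> w T \<in> X" for T
    using subgroup_setD(4)[OF X ident[of "z T"], of "\<Sum>i\<in>UNIV. \<mu> i (kwedge i (kdiff \<theta> z) T)"] z
    by (simp add: dw diff_diff_eq2 diff_add_eq)
  then show "\<exists>w. (\<forall>T. w T \<in> Y) \<and> (\<forall>T. z T - kdiff \<theta> w T \<in> X)"
    using wY by blast
qed

end

section \<open>Polynomials and partial derivatives\<close>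

lemma poly_mapping_sum_single: "(\<Sum>k\<in>Poly_Mapping.keys f. Poly_Mapping.single k (Poly_Mapping.lookup f k)) = f"
  by (rule poly_mapping_eqI)
    (auto simp: lookup_sum lookup_single when_def in_keys_iff sum.delta[OF finite_keys] cong: if_cong)

lemma poly_mapping_add_induct [case_names single add]:
  fixes f :: "'k \<Rightarrow>\<^sub>0 'b::comm_monoid_add"
  assumes "\<And>k c. P (Poly_Mapping.single k c)" and add: "\<And>f g. P f \<Longrightarrow> P g \<Longrightarrow> P (f + g)"
  shows "P f"
proof -
  have "P (\<Sum>k\<in>S. Poly_Mapping.single k (Poly_Mapping.lookup f k))" if "finite S" for S
    using that
  proof induction
    case empty then show ?case using assms(1)[of undefined 0] by simp
  qed (auto intro: assms)
  from this[OF finite_keys, of f] show ?thesis by (simp add: poly_mapping_sum_single)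
qed

lemma additive_eqI:
  fixes F G :: "('k \<Rightarrow>\<^sub>0 'b::comm_monoid_add) \<Rightarrow> 'c::plus"
  assumes "\<And>f g. F (f + g) = F f + F g" "\<And>f g. G (f + g) = G f + G g"
    and "\<And>k c. F (Poly_Mapping.single k c) = G (Poly_Mapping.single k c)"
  shows "F = G"
proof
  show "F f = G f" for f by (induction f rule: poly_mapping_add_induct) (simp_all add: assms)
qed

text \<open>
  The product of the falling factorials \<open>m\<^sub>j (m\<^sub>j - 1) \<cdots> (m\<^sub>j - u\<^sub>j + 1)\<close>, which is the coefficient in
  \<open>\<partial>\<^sup>u x\<^sup>m\<close>.
\<close>

definition falling :: "('n::finite \<Rightarrow>\<^sub>0 nat) \<Rightarrow> ('n \<Rightarrow>\<^sub>0 nat) \<Rightarrow> nat" where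
  "falling u m = (\<Prod>j\<in>UNIV. \<Prod>k<Poly_Mapping.lookup u j. Poly_Mapping.lookup m j - k)"

lemma sum_fun_apply: "sum F S x = (\<Sum>s\<in>S. F s x)" for F :: "'s \<Rightarrow> 'b \<Rightarrow> 'c::comm_monoid_add"
  by (induction S rule: infinite_finite_induct) simp_all

lemma falling_add: "falling (u + v) m = falling v m * falling u (m - v)"
proof -
  have "(\<Prod>k<a + b. l - k) = (\<Prod>k<b. l - k) * (\<Prod>k<a. l - b - k)" for a b l :: nat
    by (induction a) (simp_all add: add.commute[of b])
  then show ?thesis
    by (simp add: falling_def lookup_add lookup_minus prod.distrib)
qed

lemma falling_0 [simp]: "falling 0 m = 1"
  by (simp add: falling_def)

lemma falling_single [simp]: "falling (Poly_Mapping.single j (Suc 0)) m = Poly_Mapping.lookup m j"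
proof -
  have "falling (Poly_Mapping.single j (Suc 0)) m = (\<Prod>i\<in>UNIV. if i = j then Poly_Mapping.lookup m i else 1)"
    unfolding falling_def by (rule prod.cong) (auto simp: lookup_single when_def)
  then show ?thesis by simp
qed

lemma falling_eq_0_iff: "falling u m = 0 \<longleftrightarrow> (\<exists>j. Poly_Mapping.lookup m j < Poly_Mapping.lookup u j)"
  by (auto simp: falling_def prod_zero_iff)
    (meson diff_is_0_eq dual_order.refl le_less_trans lessThan_iff)+

lemma dmon_single: "dmon u (monomial m c) = monomial (m - u) (of_nat (falling u m) * c)"
  by (simp add: dmon_def falling_def)

lemma dmon_add: "dmon u (f + g) = dmon u f + dmon u g"
  unfolding dmon_def by (rule setsum_keys_plus_distrib) (simp_all add: algebra_simps single_add)

lemma dmon_plus: "dmon (u + v) = dmon u \<circ> dmon v"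
  by (rule additive_eqI) (simp_all add: dmon_add dmon_single falling_add diff_diff_eq add.commute[of v] mult_ac)

lemma dmon_0: "dmon 0 = id"
  by (rule additive_eqI) (simp_all add: dmon_add dmon_single)

lemma dmon_scale: "dmon u (monomial 0 c * f) = monomial 0 c * dmon u f"
  by (induction f rule: poly_mapping_add_induct)
    (simp_all add: dmon_add dmon_single distrib_left mult_single mult.left_commute)

text \<open>
  The Leibniz rule.  The truncated subtraction in the exponent \<open>u - e\<^sub>j\<close> does no harm, because the
  coefficient vanishes if \<open>u\<^sub>j = 0\<close>.
\<close>

lemma partial_deriv_monomial_mult:
  "partial_deriv j (monomial u 1 * g) =
     monomial u 1 * partial_deriv j g + monomial (u - Poly_Mapping.single j 1) (of_nat (Poly_Mapping.lookup u j)) * g"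
proof (induction g rule: poly_mapping_add_induct)
  case (single m c)
  have 1: "u + (m - Poly_Mapping.single j 1) = u + m - Poly_Mapping.single j 1" if "Poly_Mapping.lookup m j \<noteq> 0"
    using that by (intro poly_mapping_eqI) (auto simp: lookup_add lookup_minus lookup_single when_def)
  have 2: "u - Poly_Mapping.single j 1 + m = u + m - Poly_Mapping.single j 1" if "Poly_Mapping.lookup u j \<noteq> 0"
    using that by (intro poly_mapping_eqI) (auto simp: lookup_add lookup_minus lookup_single when_def)
  show ?case using 1 2
    by (cases "Poly_Mapping.lookup m j = 0"; cases "Poly_Mapping.lookup u j = 0")
      (auto simp: dmon_single mult_single lookup_add algebra_simps simp flip: single_add)
qed (simp add: dmon_add algebra_simps)

section \<open>Operators of the Weyl algebra\<close>

lemma weyl_ops_add: "P \<in> weyl_ops \<Longrightarrow> P (f + g) = P f + P g"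
  by (induction arbitrary: f g rule: weyl_ops.induct) (simp_all add: dmon_add algebra_simps)

lemma weyl_ops_scale: "P \<in> weyl_ops \<Longrightarrow> P (monomial 0 c * f) = monomial 0 c * P f"
  by (induction arbitrary: f rule: weyl_ops.induct) (simp_all add: dmon_scale distrib_left mult.left_commute)

lemma weyl_ops_zero_apply: "P \<in> weyl_ops \<Longrightarrow> P 0 = 0"
  using weyl_ops_add[of P 0 0] by simp

lemma weyl_ops_sum_apply: "P \<in> weyl_ops \<Longrightarrow> P (sum f S) = (\<Sum>s\<in>S. P (f s))"
  by (induction S rule: infinite_finite_induct) (simp_all add: weyl_ops_add weyl_ops_zero_apply)

lemma weyl_ops_minus_apply: "P \<in> weyl_ops \<Longrightarrow> P (- f) = - P f"
  using weyl_ops_add[of P f "- f"] weyl_ops_zero_apply[of P] by (simp add: eq_neg_iff_add_eq_0 add.commute)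

lemma weyl_ops_diff_apply: "P \<in> weyl_ops \<Longrightarrow> P (f - g) = P f - P g"
  using weyl_ops_add[of P f "- g"] by (simp add: weyl_ops_minus_apply)

lemma weyl_ops_plus: "P \<in> weyl_ops \<Longrightarrow> Q \<in> weyl_ops \<Longrightarrow> P + Q \<in> weyl_ops"
  using weyl_ops.add[of P Q] by (simp add: plus_fun_def)

lemma weyl_ops_scalar: "P \<in> weyl_ops \<Longrightarrow> (\<lambda>f. monomial 0 c * P f) \<in> weyl_ops"
  using weyl_ops.comp[OF weyl_ops.scalar[of c], of P] by (simp add: o_def)

lemma weyl_ops_zero: "0 \<in> weyl_ops"
proof -
  have "(\<lambda>f :: 'a cpoly. monomial 0 0 * f) = 0" by auto
  then show ?thesis using weyl_ops.scalar[of 0] by metis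
qed

lemma weyl_ops_uminus: "P \<in> weyl_ops \<Longrightarrow> - P \<in> weyl_ops"
proof -
  assume "P \<in> weyl_ops"
  moreover have "(\<lambda>f. monomial 0 (- 1) * P f) = - P" by (auto simp: single_uminus)
  ultimately show ?thesis using weyl_ops_scalar[of P "- 1"] by simp
qed

lemma weyl_ops_id: "id \<in> weyl_ops"
proof -
  have "(\<lambda>f :: 'a cpoly. monomial 0 1 * f) = id" by auto
  then show ?thesis using weyl_ops.scalar[of 1] by metis
qed

lemma weyl_ops_subgroup: "additive_subgroup_set weyl_ops"
  unfolding additive_subgroup_set_def
  using weyl_ops_zero weyl_ops_plus[OF _ weyl_ops_uminus] by (metis diff_conv_add_uminus)

lemma weyl_ops_monomial: "(\<lambda>f. monomial u c * f) \<in> weyl_ops"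
proof (induction u rule: poly_mapping_add_induct)
  case (single j k)
  have "(\<lambda>f. monomial (Poly_Mapping.single j k) 1 * f) \<in> weyl_ops"
  proof (induction k)
    case (Suc k)
    have "(\<lambda>f. pvar j * f) \<circ> (\<lambda>f. monomial (Poly_Mapping.single j k) 1 * f)
        = (\<lambda>f. monomial (Poly_Mapping.single j (Suc k)) 1 * f)"
      by (simp add: o_def mult_single flip: mult.assoc single_add)
    then show ?case using weyl_ops.comp[OF weyl_ops.var Suc] by metis
  next
    case 0
    have "(\<lambda>f :: 'a cpoly. monomial (Poly_Mapping.single j 0) 1 * f) = id" by auto
    then show ?case using weyl_ops_id by metis
  qed
  from weyl_ops.comp[OF weyl_ops.scalar[of c] this] show ?case
    by (simp add: o_def mult_single flip: mult.assoc)
next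
  case (add u v)
  show ?case
  proof (cases "c = 0")
    case False
    have "(\<lambda>f. monomial 0 (1/c) * f) \<circ> ((\<lambda>f. monomial u c * f) \<circ> (\<lambda>f. monomial v c * f)) = (\<lambda>f. monomial (u + v) c * f)"
      using False by (simp add: o_def mult_single flip: mult.assoc)
    then show ?thesis using weyl_ops.comp[OF weyl_ops.scalar weyl_ops.comp[OF add]] by metis
  next
    case True
    have "(\<lambda>f :: 'a cpoly. monomial (u + v) 0 * f) = 0" by auto
    then show ?thesis using weyl_ops_zero True by metis
  qed
qed

lemma dmon_in_weyl: "dmon u \<in> weyl_ops"
proof (induction u rule: poly_mapping_add_induct)
  case (single j k)
  show ?case
  proof (induction k)
    case (Suc k)
    have "Poly_Mapping.single j (Suc k) = Poly_Mapping.single j 1 + Poly_Mapping.single j k"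
      by (simp flip: single_add)
    then show ?case by (simp only: dmon_plus weyl_ops.comp[OF weyl_ops.deriv Suc])
  next
    case 0
    show ?case unfolding single_zero dmon_0 by (rule weyl_ops_id)
  qed
next
  case (add u v)
  then show ?case unfolding dmon_plus by (rule weyl_ops.comp)
qed

lemma diff_op_single: "diff_op (monomial u c) f = monomial 0 c * dmon u f"
  by (simp add: diff_op_def)

lemma diff_op_add: "diff_op (p + q) = diff_op p + diff_op q"
proof
  show "diff_op (p + q) f = (diff_op p + diff_op q) f" for f
    unfolding diff_op_def plus_fun_apply
    by (rule setsum_keys_plus_distrib) (simp_all add: algebra_simps single_add)
qed

lemma diff_op_0: "diff_op 0 = 0"
  by (auto simp: diff_op_def)

lemma diff_op_uminus: "diff_op (- p) = - diff_op p"
  using diff_op_add[of p "- p"] by (simp add: diff_op_0 eq_neg_iff_add_eq_0 add.commute)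

lemma diff_op_diff: "diff_op (p - q) = diff_op p - diff_op q"
  using diff_op_add[of p "- q"] by (simp add: diff_op_uminus)

lemma diff_op_in_weyl: "diff_op p \<in> weyl_ops"
proof (induction p rule: poly_mapping_add_induct)
  case (single u c)
  have "diff_op (monomial u c) = (\<lambda>f. monomial 0 c * dmon u f)" by (auto simp: diff_op_single)
  then show ?case using weyl_ops_scalar[OF dmon_in_weyl] by metis
next
  case (add f g)
  then show ?case unfolding diff_op_add by (rule weyl_ops_plus)
qed

lemma diff_op_1: "diff_op 1 = id"
proof
  show "diff_op 1 f = id f" for f
    using diff_op_single[of 0 1 f] by (simp add: dmon_0)
qed

lemma diff_op_mult: "diff_op (p * q) = diff_op p \<circ> diff_op q"
proof (induction p rule: poly_mapping_add_induct)
  case (single u c)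
  show ?case
  proof (induction q rule: poly_mapping_add_induct)
    case (single v d)
    show ?case
      by (auto simp: mult_single diff_op_single dmon_plus dmon_scale fun_eq_iff simp flip: mult.assoc)
  next
    case (add f g)
    then show ?case
      by (auto simp: distrib_left diff_op_add fun_eq_iff weyl_ops_add[OF diff_op_in_weyl])
  qed
qed (auto simp: distrib_right diff_op_add fun_eq_iff)

section \<open>Normal forms of differential operators\<close>

text \<open>
  The operator \<open>\<Sum>\<^sub>u x\<^sup>u c\<^sub>u(\<partial>)\<close>.  Writing the coefficients on the right exhibits \<open>D\<close> as a right
  module over \<open>\<complex>[\<partial>]\<close> with the monomials in \<open>x\<close> as basis.
\<close>

definition normal_op :: "(('n::finite \<Rightarrow>\<^sub>0 nat) \<Rightarrow>\<^sub>0 'n cpoly) \<Rightarrow> 'n cpoly \<Rightarrow> 'n cpoly" where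
  "normal_op c f = (\<Sum>u\<in>Poly_Mapping.keys c. monomial u 1 * diff_op (Poly_Mapping.lookup c u) f)"

lemma normal_op_add: "normal_op (c + d) = normal_op c + normal_op d"
proof
  show "normal_op (c + d) f = (normal_op c + normal_op d) f" for f
    unfolding normal_op_def plus_fun_apply
    by (rule setsum_keys_plus_distrib) (simp_all add: diff_op_0 diff_op_add algebra_simps)
qed

lemma normal_op_single: "normal_op (Poly_Mapping.single u p) = (\<lambda>f. monomial u 1 * diff_op p f)"
  by (auto simp: normal_op_def diff_op_0)

lemma normal_op_0: "normal_op 0 = 0"
  by (auto simp: normal_op_def)

lemma normal_op_diff: "normal_op (c - d) = normal_op c - normal_op d"
  using normal_op_add[of "c - d" d] by simp

text \<open>
  The derivative \<open>\<partial>\<^bsup>v'\<^esup> x\<^sup>v\<close> is nonzero only if \<open>v' \<le> v\<close> holds componentwise, which for total degree at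
  least that of \<open>v\<close> forces \<open>v' = v\<close>.
\<close>

lemma falling_eq_0_if_degree_le:
  assumes "(\<Sum>j\<in>UNIV. Poly_Mapping.lookup v j) \<le> (\<Sum>j\<in>UNIV. Poly_Mapping.lookup v' j)" "v' \<noteq> v"
  shows "falling v' v = 0"
proof (rule ccontr)
  assume "falling v' v \<noteq> 0"
  then have le: "Poly_Mapping.lookup v' j \<le> Poly_Mapping.lookup v j" for j
    by (auto simp: falling_eq_0_iff not_less)
  obtain j where "Poly_Mapping.lookup v' j \<noteq> Poly_Mapping.lookup v j"
    using assms(2) poly_mapping_eqI[of v' v] by blast
  then have "Poly_Mapping.lookup v' j < Poly_Mapping.lookup v j" using le[of j] by simp
  then have "(\<Sum>j\<in>UNIV. Poly_Mapping.lookup v' j) < (\<Sum>j\<in>UNIV. Poly_Mapping.lookup v j)"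
    using sum_strict_mono_ex1[of UNIV "Poly_Mapping.lookup v'" "Poly_Mapping.lookup v"] le by auto
  then show False using assms(1) by simp
qed

text \<open>
  Among all exponents of derivatives that occur in \<open>c\<close>, pick a \<open>v\<close> of least total degree and apply
  the operator to \<open>x\<^sup>v\<close>.  Only the terms with \<open>\<partial>\<^sup>v\<close> survive, and they contribute the distinct monomials
  \<open>x\<^sup>u\<close> with nonzero multiples of their coefficients.
\<close>

lemma normal_op_eq_0D:
  assumes "normal_op c = 0"
  shows "c = 0"
proof (rule ccontr)
  assume "c \<noteq> 0"
  define V where "V = {v. \<exists>u. Poly_Mapping.lookup (Poly_Mapping.lookup c u) v \<noteq> 0}"
  define size where "size = (\<lambda>v :: 'a \<Rightarrow>\<^sub>0 nat. \<Sum>j\<in>UNIV. Poly_Mapping.lookup v j)"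
  obtain u where "Poly_Mapping.lookup c u \<noteq> 0" using \<open>c \<noteq> 0\<close> poly_mapping_eqI[of c 0] by auto
  then have "V \<noteq> {}"
    unfolding V_def using poly_mapping_eqI[of "Poly_Mapping.lookup c u" 0] by force
  then obtain v where v: "v \<in> V" "\<And>v'. v' \<in> V \<Longrightarrow> size v \<le> size v'"
    using ex_has_least_nat[of "\<lambda>v. v \<in> V" _ size] by blast
  obtain u0 where u0: "Poly_Mapping.lookup (Poly_Mapping.lookup c u0) v \<noteq> 0" using v(1) by (auto simp: V_def)
  define N :: complex where "N = of_nat (falling v v)"
  have N: "N \<noteq> 0" using falling_eq_0_iff[of v v] by (simp add: N_def)
  have "diff_op (Poly_Mapping.lookup c u) (monomial v 1)
      = monomial 0 (Poly_Mapping.lookup (Poly_Mapping.lookup c u) v * N)" for u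
  proof -
    let ?p = "Poly_Mapping.lookup c u"
    have "diff_op ?p (monomial v 1) =
        (\<Sum>v'\<in>Poly_Mapping.keys ?p. if v' = v then monomial 0 (Poly_Mapping.lookup ?p v * N) else 0)"
      unfolding diff_op_def
    proof (rule sum.cong)
      fix v' assume "v' \<in> Poly_Mapping.keys ?p"
      then have "v' \<in> V" unfolding V_def in_keys_iff by blast
      then have le: "size v \<le> size v'" by (rule v(2))
      then show "monomial 0 (Poly_Mapping.lookup ?p v') * dmon v' (monomial v 1)
          = (if v' = v then monomial 0 (Poly_Mapping.lookup ?p v * N) else 0)"
      proof (cases "v' = v")
        case False
        have "falling v' v = 0" by (rule falling_eq_0_if_degree_le[OF le[unfolded size_def] False])
        then show ?thesis using False by (simp add: dmon_single)
      qed (simp add: dmon_single mult_single N_def del: single_of_nat)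
    qed (rule refl)
    then show ?thesis by (auto simp: sum.delta[OF finite_keys] in_keys_iff)
  qed
  then have "normal_op c (monomial v 1)
      = (\<Sum>u\<in>Poly_Mapping.keys c. monomial u (Poly_Mapping.lookup (Poly_Mapping.lookup c u) v * N))"
    by (simp add: normal_op_def mult_single)
  then have "0 = Poly_Mapping.lookup (\<Sum>u\<in>Poly_Mapping.keys c. monomial u (Poly_Mapping.lookup (Poly_Mapping.lookup c u) v * N)) u0"
    using assms by simp
  also have "\<dots> = Poly_Mapping.lookup (Poly_Mapping.lookup c u0) v * N"
    by (auto simp: lookup_sum lookup_single when_def in_keys_iff sum.delta[OF finite_keys] cong: if_cong)
  finally show False using N u0 by simp
qed

lemma normal_op_inj: "normal_op c = normal_op d \<Longrightarrow> c = d"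
  using normal_op_eq_0D[of "c - d"] by (simp add: normal_op_diff)

section \<open>Euler operators and degrees\<close>

lemma euler_op_in_weyl: "euler_op A \<beta> i \<in> weyl_ops"
proof -
  have s: "(\<Sum>j\<in>S. h j) \<in> weyl_ops" if "\<And>j. h j \<in> weyl_ops" for h :: "'a \<Rightarrow> 'a cpoly \<Rightarrow> 'a cpoly" and S
    using that by (intro subgroup_set_sum weyl_ops_subgroup)
  have "euler_op A \<beta> i = (\<Sum>j\<in>UNIV. (\<lambda>f. monomial 0 (of_int (A $ i $ j)) * (pvar j * partial_deriv j f)))
      - (\<lambda>f. monomial 0 (\<beta> $ i) * f)"
    by (auto simp: euler_op_def fun_eq_iff sum_fun_apply)
  moreover have "(\<lambda>f. pvar j * partial_deriv j f) \<in> weyl_ops" for j :: 'a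
    using weyl_ops.comp[OF weyl_ops.var weyl_ops.deriv, of j j] unfolding o_def .
  ultimately show ?thesis
    by (simp only:) (intro subgroup_setD(2)[OF weyl_ops_subgroup] s weyl_ops_scalar weyl_ops.scalar)
qed

lemma single_sum: "Poly_Mapping.single m (sum f S) = (\<Sum>s\<in>S. Poly_Mapping.single m (f s))"
  for f :: "'s \<Rightarrow> 'b::comm_monoid_add"
  by (induction S rule: infinite_finite_induct) (simp_all add: single_add)

text \<open>
  The monomials form a basis of simultaneous eigenvectors of all Euler operators.  So they commute,
  and their commutation with monomial operators is a comparison of eigenvalues.
\<close>

lemma euler_op_single:
  "euler_op A \<beta> i (monomial m c) = monomial m ((of_int ((A *v exp_vec m) $ i) - \<beta> $ i) * c)"
proof -
  have "pvar j * partial_deriv j (monomial m c) = monomial m (of_nat (Poly_Mapping.lookup m j) * c)" for j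
  proof (cases "Poly_Mapping.lookup m j = 0")
    case False
    then have "Poly_Mapping.single j 1 + (m - Poly_Mapping.single j 1) = m"
      by (intro poly_mapping_eqI) (auto simp: lookup_add lookup_minus lookup_single when_def)
    then show ?thesis by (simp add: dmon_single mult_single)
  qed (simp add: dmon_single)
  then have "euler_op A \<beta> i (monomial m c) =
     (\<Sum>j\<in>UNIV. monomial m (of_int (A $ i $ j) * (of_nat (Poly_Mapping.lookup m j) * c))) - monomial m (\<beta> $ i * c)"
    by (simp add: euler_op_def mult_single del: single_of_int)
  also have "(\<Sum>j\<in>UNIV. monomial m (of_int (A $ i $ j) * (of_nat (Poly_Mapping.lookup m j) * c)))
      = monomial m (\<Sum>j\<in>UNIV. of_int (A $ i $ j) * (of_nat (Poly_Mapping.lookup m j) * c))"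
    by (rule single_sum[symmetric])
  finally have "euler_op A \<beta> i (monomial m c) =
      monomial m ((\<Sum>j\<in>UNIV. of_int (A $ i $ j) * (of_nat (Poly_Mapping.lookup m j) * c)) - \<beta> $ i * c)"
    by (simp only: single_diff)
  moreover have "(\<Sum>j\<in>UNIV. of_int (A $ i $ j) * (of_nat (Poly_Mapping.lookup m j) * c)) = of_int ((A *v exp_vec m) $ i) * c"
    by (simp only: matrix_vector_mult_def exp_vec_def vec_lambda_beta of_int_sum of_int_mult
      of_int_of_nat_eq sum_distrib_right mult.assoc)
  ultimately show ?thesis by (simp only: left_diff_distrib)
qed

lemma euler_op_commute: "euler_op A \<beta> i \<circ> euler_op A \<beta> k = euler_op A \<beta> k \<circ> euler_op A \<beta> i"
  by (rule additive_eqI)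
    (simp_all only: o_apply euler_op_single weyl_ops_add[OF euler_op_in_weyl] mult.left_commute)

lemma exp_vec_add: "exp_vec (u + v) = exp_vec u + exp_vec v"
  by (simp add: exp_vec_def vec_eq_iff lookup_add)

text \<open>
  The operator \<open>x\<^sup>u \<partial>\<^sup>v\<close> maps \<open>x\<^sup>m\<close> to a multiple of \<open>x\<^bsup>u+m-v\<^esup>\<close>, and the eigenvalue of \<open>E\<^sub>i\<close> on the
  latter is larger by \<open>\<alpha>\<^sub>i\<close>.  If \<open>v \<le> m\<close> fails, both sides are zero.
\<close>

lemma monomial_dmon_euler:
  assumes "A *v exp_vec u - A *v exp_vec v = \<alpha>"
  shows "(\<lambda>f. monomial u c * dmon v f) \<circ> euler_op A \<beta> i
       = euler_op A (\<beta> + of_int_vec \<alpha>) i \<circ> (\<lambda>f. monomial u c * dmon v f)"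
proof (rule additive_eqI)
  fix m a
  show "((\<lambda>f. monomial u c * dmon v f) \<circ> euler_op A \<beta> i) (monomial m a) =
     (euler_op A (\<beta> + of_int_vec \<alpha>) i \<circ> (\<lambda>f. monomial u c * dmon v f)) (monomial m a)"
  proof (cases "falling v m = 0")
    case False
    then have "m - v + v = m"
      by (intro poly_mapping_eqI) (auto simp: falling_eq_0_iff not_less lookup_add lookup_minus)
    then have "exp_vec m = exp_vec (m - v) + exp_vec v" by (metis exp_vec_add)
    then have "A *v exp_vec (u + (m - v)) = A *v exp_vec m + \<alpha>"
      using assms by (simp add: exp_vec_add matrix_vector_right_distrib algebra_simps)
    then show ?thesis
      by (simp add: euler_op_single dmon_single mult_single of_int_vec_def mult_ac)
  qed (simp add: euler_op_single dmon_single weyl_ops_zero_apply[OF euler_op_in_weyl])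
qed (simp_all add: dmon_add distrib_left weyl_ops_add[OF euler_op_in_weyl])

lemma poly_degree_part_key: "p \<in> poly_degree_part A \<alpha> \<Longrightarrow> u \<in> Poly_Mapping.keys p \<Longrightarrow> - (A *v exp_vec u) = \<alpha>"
  by (auto simp: poly_degree_part_def)

lemma diff_op_euler:
  assumes "p \<in> poly_degree_part A \<alpha>"
  shows "diff_op p \<circ> euler_op A \<beta> i = euler_op A (\<beta> + of_int_vec \<alpha>) i \<circ> diff_op p"
proof -
  have e: "(\<lambda>f. monomial 0 c * dmon u f) \<circ> euler_op A \<beta> i
      = euler_op A (\<beta> + of_int_vec \<alpha>) i \<circ> (\<lambda>f. monomial 0 c * dmon u f)" if "u \<in> Poly_Mapping.keys p" for u c
    using poly_degree_part_key[OF assms that] by (intro monomial_dmon_euler) (simp add: exp_vec_def vec_eq_iff matrix_vector_mult_def)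
  show ?thesis
  proof
    fix f
    have "(diff_op p \<circ> euler_op A \<beta> i) f
        = (\<Sum>u\<in>Poly_Mapping.keys p. ((\<lambda>f. monomial 0 (Poly_Mapping.lookup p u) * dmon u f) \<circ> euler_op A \<beta> i) f)"
      by (simp add: diff_op_def)
    also have "\<dots> = (\<Sum>u\<in>Poly_Mapping.keys p. (euler_op A (\<beta> + of_int_vec \<alpha>) i \<circ> (\<lambda>f. monomial 0 (Poly_Mapping.lookup p u) * dmon u f)) f)"
      using e by (intro sum.cong) simp_all
    also have "\<dots> = (euler_op A (\<beta> + of_int_vec \<alpha>) i \<circ> diff_op p) f"
      by (simp add: diff_op_def weyl_ops_sum_apply[OF euler_op_in_weyl])
    finally show "(diff_op p \<circ> euler_op A \<beta> i) f = (euler_op A (\<beta> + of_int_vec \<alpha>) i \<circ> diff_op p) f" .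
  qed
qed

section \<open>Ideals of the polynomial ring\<close>

text \<open>
  If a group is written with the addition of its type, then its subgroups can be handled by the
  arithmetic of that type.
\<close>

lemma subgroup_if_additive:
  assumes "group G" and m: "\<And>x y. x \<otimes>\<^bsub>G\<^esub> y = x + y" and o: "\<one>\<^bsub>G\<^esub> = 0"
  shows "subgroup X G \<longleftrightarrow> X \<subseteq> carrier G \<and> additive_subgroup_set X"
proof -
  interpret group G by fact
  have i: "inv\<^bsub>G\<^esub> x = - x" if "x \<in> carrier G" for x
  proof -
    have "x + inv\<^bsub>G\<^esub> x = 0" using r_inv[OF that] by (simp add: m o)
    then show ?thesis by (simp add: eq_neg_iff_add_eq_0 add.commute)
  qed
  show ?thesis
  proof
    assume "subgroup X G"
    then interpret X: subgroup X G .
    have "x - y \<in> X" if "x \<in> X" "y \<in> X" for x y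
      using X.m_closed[OF that(1) X.m_inv_closed[OF that(2)]] i[OF X.mem_carrier[OF that(2)]] by (simp add: m)
    then show "X \<subseteq> carrier G \<and> additive_subgroup_set X"
      using X.subset X.one_closed by (auto simp: additive_subgroup_set_def o)
  next
    assume X: "X \<subseteq> carrier G \<and> additive_subgroup_set X"
    then have "inv\<^bsub>G\<^esub> x \<in> X" if "x \<in> X" for x
      using i[of x] subgroup_setD(3)[of X x] that by auto
    then show "subgroup X G"
      using X subgroup_setD(1,4)[of X] by (intro subgroupI) (auto simp: m)
  qed
qed

lemma poly_ring_cring: "cring poly_ring"
proof (rule cringI)
  show "abelian_group poly_ring"
    by (rule abelian_groupI) (auto simp: poly_ring_def intro: exI[of _ "- _"] left_minus)
  show "comm_monoid poly_ring"
    by (rule comm_monoidI) (auto simp: poly_ring_def)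
qed (auto simp: poly_ring_def algebra_simps)

definition poly_ideal :: "'n cpoly set \<Rightarrow> bool" where
  "poly_ideal C \<longleftrightarrow> additive_subgroup_set C \<and> (\<forall>r. \<forall>c\<in>C. r * c \<in> C)"

lemma group_add_poly_ring: "group (add_monoid poly_ring)"
  using poly_ring_cring abelian_group.a_group cring.axioms(1) ring_def by blast

lemma ideal_poly_ring_iff: "ideal C poly_ring \<longleftrightarrow> poly_ideal C"
proof -
  have s: "subgroup C (add_monoid poly_ring) \<longleftrightarrow> additive_subgroup_set C"
    by (subst subgroup_if_additive[OF group_add_poly_ring]) (auto simp: poly_ring_def)
  have r: "ring poly_ring" using poly_ring_cring cring.axioms(1) by blast
  have a: "r * c \<in> C" if "ideal C poly_ring" "c \<in> C" for r c
    using ideal.I_l_closed[OF that(1,2), of r] by (simp add: poly_ring_def)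
  show ?thesis
  proof
    assume C: "ideal C poly_ring"
    then have "additive_subgroup C poly_ring" by (rule ideal.axioms(1))
    then show "poly_ideal C" using s a[OF C] by (simp add: poly_ideal_def additive_subgroup_def)
  next
    assume C: "poly_ideal C"
    then have "c * x \<in> C" "x * c \<in> C" if "c \<in> C" for c x
      using that by (auto simp: poly_ideal_def mult.commute[of c x])
    then show "ideal C poly_ring"
      using C s by (intro idealI r) (simp_all add: poly_ideal_def poly_ring_def)
  qed
qed

lemma poly_idealD:
  assumes "poly_ideal C"
  shows "additive_subgroup_set C" "c \<in> C \<Longrightarrow> r * c \<in> C"
  using assms by (auto simp: poly_ideal_def)

lemma poly_ideal_genideal: "poly_ideal (Idl\<^bsub>poly_ring\<^esub> S)"
  using ring.genideal_ideal[of poly_ring S] poly_ring_cring cring.axioms(1)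
  by (auto simp: ideal_poly_ring_iff[symmetric] poly_ring_def)

lemma genideal_subset: "S \<subseteq> Idl\<^bsub>poly_ring\<^esub> S"
  using ring.genideal_self[of poly_ring S] poly_ring_cring cring.axioms(1)
  by (auto simp: poly_ring_def)

lemma genideal_least: "poly_ideal C \<Longrightarrow> S \<subseteq> C \<Longrightarrow> Idl\<^bsub>poly_ring\<^esub> S \<subseteq> C"
  using ring.genideal_minimal[of poly_ring C S] poly_ring_cring cring.axioms(1)
  by (auto simp: ideal_poly_ring_iff)

lemma A_graded_idealD: "A_graded_ideal A C \<Longrightarrow> poly_ideal C"
  by (auto simp: A_graded_ideal_def poly_ideal_genideal)

section \<open>Left ideals of the Weyl algebra and flatness\<close>

lemma abelian_group_weyl: "abelian_group (weyl :: ('n::finite cpoly \<Rightarrow> 'n cpoly) ring)"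
proof (rule abelian_groupI)
  fix P :: "'n cpoly \<Rightarrow> 'n cpoly" assume "P \<in> carrier weyl"
  then show "\<exists>Q\<in>carrier weyl. Q \<oplus>\<^bsub>weyl\<^esub> P = \<zero>\<^bsub>weyl\<^esub>"
    by (intro bexI[of _ "- P"]) (auto simp: weyl_def weyl_ops_uminus)
qed (auto simp: weyl_def algebra_simps weyl_ops.add intro: weyl_ops_zero[unfolded zero_fun_def])

lemma weyl_simps [simp]: "carrier weyl = weyl_ops" "P \<otimes>\<^bsub>weyl\<^esub> Q = P \<circ> Q" "P \<oplus>\<^bsub>weyl\<^esub> Q = P + Q"
  "\<zero>\<^bsub>weyl\<^esub> = 0" "\<one>\<^bsub>weyl\<^esub> = id"
  by (auto simp: weyl_def)

lemma subgroup_weyl_iff: "subgroup X (add_monoid weyl) \<longleftrightarrow> X \<subseteq> weyl_ops \<and> additive_subgroup_set X"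
  by (subst subgroup_if_additive[OF abelian_group.a_group[OF abelian_group_weyl]]) auto

lemma generate_weyl_subgroup:
  assumes "H \<subseteq> weyl_ops"
  shows "generate (add_monoid weyl) H \<subseteq> weyl_ops" "additive_subgroup_set (generate (add_monoid weyl) H)"
  using group.generate_is_subgroup[OF abelian_group.a_group[OF abelian_group_weyl], of H] assms
  unfolding subgroup_weyl_iff by simp_all

lemma generate_weyl_least:
  assumes "H \<subseteq> X" "X \<subseteq> weyl_ops" "additive_subgroup_set X"
  shows "generate (add_monoid weyl) H \<subseteq> X"
  using group.generate_subgroup_incl[OF abelian_group.a_group[OF abelian_group_weyl], of H X] assms
  unfolding subgroup_weyl_iff by simp

definition left_stable :: "('n::finite cpoly \<Rightarrow> 'n cpoly) set \<Rightarrow> bool" where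
  "left_stable X \<longleftrightarrow> X \<subseteq> weyl_ops \<and> additive_subgroup_set X \<and> (\<forall>P\<in>weyl_ops. \<forall>x\<in>X. P \<circ> x \<in> X)"

lemma weyl_ops_comp_add: "P \<in> weyl_ops \<Longrightarrow> P \<circ> (x + y) = (P \<circ> x) + (P \<circ> y)"
  by (auto simp: weyl_ops_add)

lemma weyl_ops_comp_diff: "P \<in> weyl_ops \<Longrightarrow> P \<circ> (x - y) = (P \<circ> x) - (P \<circ> y)"
  by (auto simp: weyl_ops_diff_apply)

lemma weyl_ops_comp_0: "P \<in> weyl_ops \<Longrightarrow> P \<circ> 0 = 0"
  by (auto simp: weyl_ops_zero_apply)

text \<open>
  The generated left ideal is defined as the additive span of products; multiplying a product from
  the left gives a product again, so this span is stable and is the least left ideal over \<open>S\<close>.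
\<close>

lemma left_ideal_generated_props:
  fixes S :: "('n::finite cpoly \<Rightarrow> 'n cpoly) set"
  assumes S: "S \<subseteq> weyl_ops"
  shows "left_stable (left_ideal_generated weyl S)" "S \<subseteq> left_ideal_generated weyl S"
    and left_ideal_generated_least: "left_stable X \<Longrightarrow> S \<subseteq> X \<Longrightarrow> left_ideal_generated weyl S \<subseteq> X"
proof -
  define H where "H = {P \<circ> s |P s :: 'n cpoly \<Rightarrow> 'n cpoly. P \<in> weyl_ops \<and> s \<in> S}"
  define L where "L = left_ideal_generated weyl S"
  have L: "L = generate (add_monoid weyl) H" by (simp add: L_def H_def left_ideal_generated_def)
  have H: "H \<subseteq> weyl_ops" unfolding H_def using S by (auto intro: weyl_ops.comp)
  note L1 = generate_weyl_subgroup[OF H, folded L] and least = generate_weyl_least[of H, folded L]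
  have HL: "H \<subseteq> L" unfolding L by (auto intro: generate.incl)
  have "L \<subseteq> {x \<in> weyl_ops. \<forall>P\<in>weyl_ops. P \<circ> x \<in> L}"
  proof (rule least)
    show "H \<subseteq> {x \<in> weyl_ops. \<forall>P\<in>weyl_ops. P \<circ> x \<in> L}"
    proof
      fix x assume "x \<in> H"
      then obtain P s where x: "x = P \<circ> s" "P \<in> weyl_ops" "s \<in> S" unfolding H_def by blast
      have "Q \<circ> x \<in> L" if "Q \<in> weyl_ops" for Q
      proof -
        have "(Q \<circ> P) \<circ> s \<in> H" unfolding H_def using that x weyl_ops.comp by blast
        then show ?thesis using HL by (auto simp: x(1) comp_assoc)
      qed
      then show "x \<in> {x \<in> weyl_ops. \<forall>P\<in>weyl_ops. P \<circ> x \<in> L}" using \<open>x \<in> H\<close> H by blast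
    qed
    show "additive_subgroup_set {x \<in> weyl_ops. \<forall>P\<in>weyl_ops. P \<circ> x \<in> L}"
      using subgroup_setD(1,2)[OF L1(2)] subgroup_setD(1,2)[OF weyl_ops_subgroup]
      unfolding additive_subgroup_set_def by (auto simp: weyl_ops_comp_diff weyl_ops_comp_0)
  qed blast
  then show "left_stable (left_ideal_generated weyl S)"
    using L1 unfolding left_stable_def L_def[symmetric] by blast
  have "id \<circ> s \<in> L" if "s \<in> S" for s using HL weyl_ops_id that unfolding H_def by blast
  then show "S \<subseteq> left_ideal_generated weyl S" unfolding L_def[symmetric] by auto
  show "left_ideal_generated weyl S \<subseteq> X" if "left_stable X" "S \<subseteq> X"
    unfolding L_def[symmetric] using that by (intro least) (auto simp: left_stable_def H_def)
qed

text \<open>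
  The left ideal \<open>D C\<close>, with \<open>D/DC \<cong> D \<otimes> \<complex>[\<partial>]/C\<close>.
\<close>

definition weyl_ext :: "'n::finite cpoly set \<Rightarrow> ('n cpoly \<Rightarrow> 'n cpoly) set" where
  "weyl_ext C = left_ideal_generated weyl (diff_op ` C)"

lemma weyl_ext_left_stable: "left_stable (weyl_ext C)"
  and diff_op_in_weyl_ext: "c \<in> C \<Longrightarrow> diff_op c \<in> weyl_ext C"
  and weyl_ext_least: "left_stable X \<Longrightarrow> diff_op ` C \<subseteq> X \<Longrightarrow> weyl_ext C \<subseteq> X"
proof -
  have S: "diff_op ` C \<subseteq> weyl_ops" by (auto intro: diff_op_in_weyl)
  show "left_stable (weyl_ext C)" "c \<in> C \<Longrightarrow> diff_op c \<in> weyl_ext C"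
    "left_stable X \<Longrightarrow> diff_op ` C \<subseteq> X \<Longrightarrow> weyl_ext C \<subseteq> X"
    using left_ideal_generated_props[OF S] unfolding weyl_ext_def by blast+
qed

lemma weyl_extD:
  shows "additive_subgroup_set (weyl_ext C)" "x \<in> weyl_ext C \<Longrightarrow> x \<in> weyl_ops"
    "x \<in> weyl_ext C \<Longrightarrow> P \<in> weyl_ops \<Longrightarrow> P \<circ> x \<in> weyl_ext C"
  using weyl_ext_left_stable[of C] unfolding left_stable_def by blast+

lemma weyl_ext_mono: "C \<subseteq> C' \<Longrightarrow> weyl_ext C \<subseteq> weyl_ext C'"
  by (rule weyl_ext_least[OF weyl_ext_left_stable]) (auto intro: diff_op_in_weyl_ext)

lemma comp_diff_left:
  fixes P Q :: "'b \<Rightarrow> 'c::ab_group_add" and e :: "'a \<Rightarrow> 'b"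
  shows "(P - Q) \<circ> e = (P \<circ> e) - (Q \<circ> e)"
  by auto

text \<open>
  A left ideal need not be stable under multiplication from the right.  Here the grading helps: a
  homogeneous generator \<open>s\<close> of degree \<open>\<alpha>\<close> satisfies \<open>s (E\<^sub>i - \<beta>\<^sub>i) = (E\<^sub>i - \<beta>\<^sub>i - \<alpha>\<^sub>i) s\<close>, which lies in
  \<open>D s\<close>.
\<close>

lemma weyl_ext_euler_stable:
  assumes "A_graded_ideal A C" "x \<in> weyl_ext C"
  shows "x \<circ> euler_op A \<beta> i \<in> weyl_ext C"
proof -
  let ?e = "euler_op A \<beta> i"
  obtain S where S: "S \<subseteq> (\<Union>\<alpha>. poly_degree_part A \<alpha>)" "C = Idl\<^bsub>poly_ring\<^esub> S"
    using assms(1) by (auto simp: A_graded_ideal_def)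
  have C: "poly_ideal C" using assms(1) by (rule A_graded_idealD)
  have "0 \<circ> ?e = 0" by auto
  \<comment> \<open>The property is verified for homogeneous generators and then extended, first to all of \<open>C\<close> and
    finally to \<open>D C\<close>, as the elements having it form an ideal and a left ideal.\<close>
  have "C \<subseteq> {c \<in> C. diff_op c \<circ> ?e \<in> weyl_ext C}"
  proof (subst S(2), rule genideal_least)
    show "poly_ideal {c \<in> C. diff_op c \<circ> ?e \<in> weyl_ext C}"
      unfolding poly_ideal_def additive_subgroup_set_def
      using poly_idealD[OF C] weyl_extD(3)[of _ C] subgroup_setD(1,2)[of C] subgroup_setD(1,2)[OF weyl_extD(1)[of C]]
      by (auto simp: diff_op_0 diff_op_diff diff_op_mult comp_diff_left comp_assoc diff_op_in_weyl \<open>0 \<circ> ?e = 0\<close>)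
    show "S \<subseteq> {c \<in> C. diff_op c \<circ> ?e \<in> weyl_ext C}"
    proof
      fix s assume "s \<in> S"
      then obtain \<alpha> where "s \<in> poly_degree_part A \<alpha>" using S(1) by auto
      moreover have "s \<in> C" using \<open>s \<in> S\<close> genideal_subset S(2) by auto
      ultimately show "s \<in> {c \<in> C. diff_op c \<circ> ?e \<in> weyl_ext C}"
        by (auto simp: diff_op_euler intro: weyl_extD(3) diff_op_in_weyl_ext euler_op_in_weyl)
    qed
  qed
  then have "weyl_ext C \<subseteq> {x \<in> weyl_ext C. x \<circ> ?e \<in> weyl_ext C}"
    using weyl_extD(2,3)[of _ C] subgroup_setD(1,2)[OF weyl_extD(1)[of C]]
    by (intro weyl_ext_least)
      (auto simp: left_stable_def additive_subgroup_set_def comp_diff_left comp_assoc \<open>0 \<circ> ?e = 0\<close> intro: diff_op_in_weyl_ext)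
  then show ?thesis using assms(2) by auto
qed

lemma diff_op_scalar_mult: "diff_op (monomial 0 a * p) f = monomial 0 a * diff_op p f"
  by (simp add: diff_op_mult diff_op_single dmon_0)

text \<open>
  The direct sum of the \<open>x\<^sup>u C\<close>, which will turn out to be \<open>D C\<close>.
\<close>

definition normal_ops :: "'n::finite cpoly set \<Rightarrow> ('n cpoly \<Rightarrow> 'n cpoly) set" where
  "normal_ops C = {normal_op c |c. \<forall>u. Poly_Mapping.lookup c u \<in> C}"

text \<open>
  The only generators of \<open>D\<close> for which this is not immediate are the derivatives, where
  \<open>\<partial>\<^sub>j x\<^sup>u p = x\<^sup>u (\<partial>\<^sub>j p) + u\<^sub>j x\<^bsup>u-e\<^sub>j\<^esup> p\<close> has its coefficients in \<open>C\<close> again.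
\<close>

lemma left_stable_normal_ops:
  assumes "poly_ideal C"
  shows "left_stable (normal_ops C)"
proof -
  note sC = poly_idealD(1)[OF assms] and mC = poly_idealD(2)[OF assms]
  have sub: "additive_subgroup_set (normal_ops C)"
    unfolding additive_subgroup_set_def
  proof (intro conjI ballI)
    show "0 \<in> normal_ops C"
      unfolding normal_ops_def using subgroup_setD(1)[OF sC] normal_op_0[symmetric] by force
    fix x y assume "x \<in> normal_ops C" "y \<in> normal_ops C"
    then obtain c d where "x = normal_op c" "\<forall>u. Poly_Mapping.lookup c u \<in> C"
      "y = normal_op d" "\<forall>u. Poly_Mapping.lookup d u \<in> C" unfolding normal_ops_def by blast
    then show "x - y \<in> normal_ops C"
      unfolding normal_ops_def using subgroup_setD(2)[OF sC]
      by (auto simp: normal_op_diff lookup_minus intro!: exI[of _ "c - d"])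
  qed
  have gen: "(\<lambda>f. monomial u 1 * diff_op p f) \<in> normal_ops C" if "p \<in> C" for u p
    unfolding normal_ops_def normal_op_single[symmetric]
    using that subgroup_setD(1)[OF sC] by (auto simp: lookup_single when_def)
  have in_weyl: "normal_op c \<in> weyl_ops" for c :: "('a \<Rightarrow>\<^sub>0 nat) \<Rightarrow>\<^sub>0 'a cpoly"
  proof -
    have "normal_op c = (\<Sum>u\<in>Poly_Mapping.keys c. (\<lambda>f. monomial u 1 * f) \<circ> diff_op (Poly_Mapping.lookup c u))"
      by (auto simp: normal_op_def sum_fun_apply)
    then show ?thesis
      by (simp only:) (intro subgroup_set_sum[OF weyl_ops_subgroup] weyl_ops.comp weyl_ops_monomial diff_op_in_weyl)
  qed
  have left: "P \<circ> x \<in> normal_ops C"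
    if P: "P \<in> weyl_ops" and step: "\<And>u p. p \<in> C \<Longrightarrow> P \<circ> (\<lambda>f. monomial u 1 * diff_op p f) \<in> normal_ops C"
      and x: "x \<in> normal_ops C" for P x
  proof -
    obtain c where c: "x = normal_op c" "\<And>u. Poly_Mapping.lookup c u \<in> C"
      using x unfolding normal_ops_def by blast
    have "P \<circ> x = (\<Sum>u\<in>Poly_Mapping.keys c. P \<circ> (\<lambda>f. monomial u 1 * diff_op (Poly_Mapping.lookup c u) f))"
      by (auto simp: c(1) normal_op_def sum_fun_apply weyl_ops_sum_apply[OF P])
    then show ?thesis by (simp only:) (intro subgroup_set_sum[OF sub] step c(2))
  qed
  have "P \<circ> x \<in> normal_ops C" if "P \<in> weyl_ops" "x \<in> normal_ops C" for P x
    using that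
  proof (induction arbitrary: x rule: weyl_ops.induct)
    case (scalar c)
    have eq: "(\<lambda>f. monomial 0 c * f) \<circ> (\<lambda>f. monomial u 1 * diff_op p f)
        = (\<lambda>f. monomial u 1 * diff_op (monomial 0 c * p) f)" for u p
      by (auto simp: diff_op_scalar_mult mult.left_commute)
    have "(\<lambda>f. monomial 0 c * f) \<circ> (\<lambda>f. monomial u 1 * diff_op p f) \<in> normal_ops C" if "p \<in> C" for u p
      unfolding eq by (rule gen[OF mC[OF that]])
    then show ?case by (rule left[OF weyl_ops.scalar _ scalar])
  next
    case (var j)
    have eq: "(\<lambda>f. pvar j * f) \<circ> (\<lambda>f. monomial u 1 * diff_op p f)
        = (\<lambda>f. monomial (Poly_Mapping.single j 1 + u) 1 * diff_op p f)" for u p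
      by (simp only: o_def mult.assoc[symmetric] mult_single mult_1_left)
    have "(\<lambda>f. pvar j * f) \<circ> (\<lambda>f. monomial u 1 * diff_op p f) \<in> normal_ops C" if "p \<in> C" for u p
      unfolding eq by (rule gen[OF that])
    then show ?case by (rule left[OF weyl_ops.var _ var])
  next
    case (deriv j)
    have eq: "partial_deriv j \<circ> (\<lambda>f. monomial u 1 * diff_op p f)
        = (\<lambda>f. monomial u 1 * diff_op (pvar j * p) f)
          + (\<lambda>f. monomial (u - Poly_Mapping.single j 1) 1
                * diff_op (monomial 0 (of_nat (Poly_Mapping.lookup u j)) * p) f)" for u p
    proof
      fix f
      have "monomial (u - Poly_Mapping.single j 1) (of_nat (Poly_Mapping.lookup u j))
          = monomial (u - Poly_Mapping.single j 1) 1 * monomial 0 (of_nat (Poly_Mapping.lookup u j))"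
        by (simp add: mult_single del: single_of_nat)
      then show "(partial_deriv j \<circ> (\<lambda>f. monomial u 1 * diff_op p f)) f
        = ((\<lambda>f. monomial u 1 * diff_op (pvar j * p) f)
          + (\<lambda>f. monomial (u - Poly_Mapping.single j 1) 1
                * diff_op (monomial 0 (of_nat (Poly_Mapping.lookup u j)) * p) f)) f"
        by (simp only: o_apply plus_fun_apply partial_deriv_monomial_mult diff_op_scalar_mult diff_op_mult
            diff_op_single mult.assoc single_one mult_1_left dmon_0 id_apply)
    qed
    have "partial_deriv j \<circ> (\<lambda>f. monomial u 1 * diff_op p f) \<in> normal_ops C" if "p \<in> C" for u p
      unfolding eq by (intro subgroup_setD(4)[OF sub] gen mC that)
    then show ?case by (rule left[OF weyl_ops.deriv _ deriv])
  next
    case (add P Q)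
    have eq: "(\<lambda>f. P f + Q f) \<circ> x = (P \<circ> x) + (Q \<circ> x)" by auto
    show ?case
      unfolding eq by (intro subgroup_setD(4)[OF sub] add.IH add.prems)
  next
    case (comp P Q)
    then show ?case unfolding comp_assoc by blast
  qed
  then show ?thesis unfolding left_stable_def using sub in_weyl by (auto simp: normal_ops_def)
qed

text \<open>
  Membership in \<open>D C\<close> can be read off from the coefficients of the normal form.
\<close>

lemma weyl_ext_normal_ops:
  assumes "poly_ideal C"
  shows "weyl_ext C = normal_ops C"
proof
  have "diff_op c \<in> normal_ops C" if "c \<in> C" for c
  proof -
    have "diff_op c = normal_op (Poly_Mapping.single 0 c)" by (auto simp: normal_op_single)
    then show ?thesis
      unfolding normal_ops_def using that subgroup_setD(1)[OF poly_idealD(1)[OF assms]]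
      by (auto simp: lookup_single when_def intro!: exI[of _ "Poly_Mapping.single 0 c"])
  qed
  then show "weyl_ext C \<subseteq> normal_ops C"
    by (intro weyl_ext_least left_stable_normal_ops assms) auto
  show "normal_ops C \<subseteq> weyl_ext C"
  proof
    fix x assume "x \<in> normal_ops C"
    then obtain c where c: "x = normal_op c" "\<And>u. Poly_Mapping.lookup c u \<in> C" unfolding normal_ops_def by blast
    have "x = (\<Sum>u\<in>Poly_Mapping.keys c. (\<lambda>f. monomial u 1 * f) \<circ> diff_op (Poly_Mapping.lookup c u))"
      by (auto simp: c(1) normal_op_def sum_fun_apply)
    then show "x \<in> weyl_ext C"
      by (simp only:) (intro subgroup_set_sum[OF weyl_extD(1)] weyl_extD(3) weyl_ops_monomial diff_op_in_weyl_ext c(2))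
  qed
qed

text \<open>
  Flatness of \<open>D\<close> over \<open>\<complex>[\<partial>]\<close>, in the form of compatibility with intersections: the normal form of \<open>P\<close>
  is unique, so each of its coefficients lies in all \<open>C Q\<close> simultaneously.
\<close>

lemma weyl_ext_INT:
  fixes C :: "'q \<Rightarrow> 'n::finite cpoly set"
  assumes "\<And>Q. Q \<in> S \<Longrightarrow> poly_ideal (C Q)" "P \<in> weyl_ops" "\<And>Q. Q \<in> S \<Longrightarrow> P \<in> weyl_ext (C Q)"
  shows "P \<in> weyl_ext (\<Inter>Q\<in>S. C Q)"
proof -
  have U: "poly_ideal (UNIV :: 'n cpoly set)" by (auto simp: poly_ideal_def additive_subgroup_set_def)
  have "id \<in> weyl_ext (UNIV :: 'n cpoly set)" using diff_op_in_weyl_ext[of 1] by (auto simp: diff_op_1)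
  then have "P \<in> weyl_ext UNIV" using weyl_extD(3)[OF _ assms(2)] by fastforce
  then obtain c where c: "P = normal_op c" using weyl_ext_normal_ops[OF U] by (auto simp: normal_ops_def)
  have "Poly_Mapping.lookup c u \<in> C Q" if "Q \<in> S" for Q u
    using assms(3)[OF that] unfolding weyl_ext_normal_ops[OF assms(1)[OF that]] normal_ops_def c
    using normal_op_inj by blast
  then have "P \<in> normal_ops (\<Inter>Q\<in>S. C Q)" unfolding normal_ops_def c by blast
  moreover have "poly_ideal (\<Inter>Q\<in>S. C Q)"
    using assms(1) by (auto simp: poly_ideal_def additive_subgroup_set_def)
  ultimately show ?thesis by (simp add: weyl_ext_normal_ops)
qed

section \<open>Separating a point from quasidegrees\<close>

lemma poly_eval_line:
  fixes p :: "'d::finite cpoly"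
  shows "\<exists>q. \<forall>t. poly_eval p (z + t *s w) = poly q t"
proof -
  let ?q = "\<Sum>m\<in>Poly_Mapping.keys p. [:Poly_Mapping.lookup p m:] * (\<Prod>i\<in>UNIV. [:z $ i, w $ i:] ^ Poly_Mapping.lookup m i)"
  have "poly_eval p (z + t *s w) = poly ?q t" for t
    by (simp add: poly_eval_def poly_sum poly_prod)
  then show ?thesis by blast
qed

text \<open>
  The Zariski closure of \<open>z - \<nat> A\<^sub>J\<close> contains \<open>z - \<complex> A\<^sub>J\<close>.  The columns are treated one by one: along
  the line in the direction of a column the polynomial restricts to a polynomial in one variable, and
  this one vanishes at all natural numbers, hence everywhere.
\<close>

lemma poly_eval_vanishes_on_complex_span:
  fixes p :: "'d::finite cpoly" and A :: "int^'n::finite^'d"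
  assumes "finite J"
    and "\<And>u :: 'n \<Rightarrow>\<^sub>0 nat. Poly_Mapping.keys u \<subseteq> J \<Longrightarrow> poly_eval p (z - of_int_vec (A *v exp_vec u)) = 0"
  shows "poly_eval p (z - (\<Sum>j\<in>J. c j *s of_int_vec (column j A))) = 0"
  using assms
proof (induction arbitrary: z rule: finite_induct)
  case empty
  have "of_int_vec (A *v exp_vec 0) = (0 :: complex^'d)"
    by (simp add: of_int_vec_def exp_vec_def matrix_vector_mult_def vec_eq_iff)
  then show ?case using empty[of 0] by simp
next
  case (insert j J)
  let ?a = "\<lambda>j. of_int_vec (column j A) :: complex^'d"
  let ?y = "z - (\<Sum>j\<in>J. c j *s ?a j)"
  obtain q where q: "\<And>t. poly_eval p (?y + t *s (- ?a j)) = poly q t" using poly_eval_line by blast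
  \<comment> \<open>The induction hypothesis for \<open>J\<close> is applied at the shifted base points \<open>z - k a\<^sub>j\<close>.\<close>
  have "poly q (of_nat k) = 0" for k
  proof -
    have "poly_eval p (z - of_nat k *s ?a j - (\<Sum>j\<in>J. c j *s ?a j)) = 0"
    proof (rule insert.IH)
      fix u :: "'n \<Rightarrow>\<^sub>0 nat" assume u: "Poly_Mapping.keys u \<subseteq> J"
      have "Poly_Mapping.keys (u + Poly_Mapping.single j k) \<subseteq> insert j J"
        using u keys_add[of u "Poly_Mapping.single j k"] by (auto split: if_splits)
      then have "poly_eval p (z - of_int_vec (A *v exp_vec (u + Poly_Mapping.single j k))) = 0"
        by (rule insert.prems)
      moreover have "of_int_vec (A *v exp_vec (u + Poly_Mapping.single j k))
          = of_int_vec (A *v exp_vec u) + of_nat k *s ?a j"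
      proof -
        have "A *v exp_vec (Poly_Mapping.single j k) = int k *s column j A"
        proof (rule vec_eq_iff[THEN iffD2], rule allI)
          fix i
          have "(A *v exp_vec (Poly_Mapping.single j k)) $ i = (\<Sum>l\<in>UNIV. if l = j then A $ i $ j * int k else 0)"
            unfolding matrix_vector_mult_def exp_vec_def vec_lambda_beta
            by (rule sum.cong) (auto simp: lookup_single when_def)
          then show "(A *v exp_vec (Poly_Mapping.single j k)) $ i = (int k *s column j A) $ i"
            by (simp add: column_def mult.commute)
        qed
        then show ?thesis
          by (simp add: exp_vec_add matrix_vector_right_distrib of_int_vec_def vec_eq_iff)
      qed
      ultimately show "poly_eval p (z - of_nat k *s ?a j - of_int_vec (A *v exp_vec u)) = 0"
        by (simp add: algebra_simps)
    qed
    then show ?thesis unfolding q[symmetric] by (simp add: algebra_simps)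
  qed
  then have "range (of_nat :: nat \<Rightarrow> complex) \<subseteq> {t. poly q t = 0}" by auto
  moreover have "infinite (range (of_nat :: nat \<Rightarrow> complex))" by (simp add: finite_image_iff inj_of_nat)
  ultimately have "q = 0" using poly_roots_finite finite_subset by blast
  then have "poly_eval p (?y + c j *s (- ?a j)) = 0" unfolding q by simp
  moreover have "z - (\<Sum>j\<in>insert j J. c j *s ?a j) = ?y + c j *s (- ?a j)"
    by (simp add: insert.hyps diff_diff_eq add.commute)
  ultimately show ?case by (simp only:)
qed

text \<open>
  If \<open>p\<close> vanishes on \<open>\<alpha> - \<nat> A\<^sub>J\<close> but not at \<open>-\<beta>\<close>, then \<open>-\<beta>\<close> is not in \<open>\<alpha> + \<complex> A\<^sub>J\<close>.  So \<open>\<beta> + \<alpha>\<close> lies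
  outside of the span of the columns from \<open>J\<close>, and some linear form separates it from that span.
\<close>

lemma separating_functional:
  fixes p :: "'d::finite cpoly" and A :: "int^'n::finite^'d" and \<beta> :: "complex^'d"
  assumes vanish: "\<And>u :: 'n \<Rightarrow>\<^sub>0 nat. Poly_Mapping.keys u \<subseteq> J \<Longrightarrow> poly_eval p (of_int_vec (\<alpha> - A *v exp_vec u)) = 0"
    and nz: "poly_eval p (- \<beta>) \<noteq> 0"
  shows "\<exists>l :: complex^'d. (\<forall>j\<in>J. (\<Sum>i\<in>UNIV. l $ i * of_int (A $ i $ j)) = 0) \<and>
     (\<Sum>i\<in>UNIV. l $ i * (\<beta> + of_int_vec \<alpha>) $ i) = - 1"
proof -
  let ?a = "\<lambda>j. of_int_vec (column j A) :: complex^'d"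
  define Y where "Y = {\<Sum>j\<in>J. c j *s ?a j | c. True}"
  define y where "y = \<beta> + of_int_vec \<alpha>"
  have YI: "(\<Sum>j\<in>J. c j *s ?a j) \<in> Y" for c unfolding Y_def by blast
  have Y: "vec.span (?a ` J) \<subseteq> Y"
  proof (rule vec.span_minimal)
    show "?a ` J \<subseteq> Y"
    proof
      fix x assume "x \<in> ?a ` J"
      then obtain j where "j \<in> J" "x = ?a j" by blast
      then have "x = (\<Sum>k\<in>J. (if k = j then 1 else 0) *s ?a k)"
        by (simp add: if_distrib[of "\<lambda>c. c *s _"] cong: if_cong)
      then show "x \<in> Y" using YI by metis
    qed
    show "vec.subspace Y"
    proof (rule vec.subspaceI)
      show "0 \<in> Y" using YI[of "\<lambda>_. 0"] by simp
    next
      fix x w assume "x \<in> Y" "w \<in> Y"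
      then obtain c d where "x = (\<Sum>j\<in>J. c j *s ?a j)" "w = (\<Sum>j\<in>J. d j *s ?a j)" unfolding Y_def by blast
      then have "x + w = (\<Sum>j\<in>J. (c j + d j) *s ?a j)" by (simp add: sum.distrib vec.scale_left_distrib)
      then show "x + w \<in> Y" using YI[of "\<lambda>j. c j + d j"] by simp
    next
      fix t x assume "x \<in> Y"
      then obtain c where "x = (\<Sum>j\<in>J. c j *s ?a j)" unfolding Y_def by blast
      then have "t *s x = (\<Sum>j\<in>J. (t * c j) *s ?a j)" by (simp add: vec.scale_sum_right)
      then show "t *s x \<in> Y" using YI[of "\<lambda>j. t * c j"] by simp
    qed
  qed
  have "y \<notin> Y"
  proof
    assume "y \<in> Y"
    then obtain c where "y = (\<Sum>j\<in>J. c j *s ?a j)" unfolding Y_def by blast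
    moreover have "of_int_vec \<alpha> - y = - \<beta>" by (simp add: y_def)
    moreover have "poly_eval p (of_int_vec \<alpha> - (\<Sum>j\<in>J. c j *s ?a j)) = 0"
      using vanish by (intro poly_eval_vanishes_on_complex_span) (auto simp: of_int_vec_def vec_eq_iff minus_vec_def)
    ultimately show False using nz by simp
  qed
  then have y_span: "y \<notin> vec.span (?a ` J)" using Y by blast
  obtain B where B: "B \<subseteq> ?a ` J" "vec.independent B" "?a ` J \<subseteq> vec.span B"
    by (rule vec.maximal_independent_subset)
  have yB: "y \<notin> vec.span B" using vec.span_mono[OF B(1)] y_span by blast
  then have ind: "vec.independent (insert y B)" using B(2) by (rule vec.independent_insertI)
  \<comment> \<open>The map sends \<open>y\<close> to \<open>(-1, \<dots>, -1)\<close> and the span of \<open>B\<close> to zero; each of its coordinates is a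
    linear form as required.\<close>
  obtain g :: "complex^'d \<Rightarrow> complex^'d" where g: "Vector_Spaces.linear (*s) (*s) g"
    "\<And>x. x \<in> insert y B \<Longrightarrow> g x = (if x = y then - 1 else 0)"
    using vec.linear_independent_extend[OF ind, of "\<lambda>x. if x = y then - 1 else 0"] by blast
  have "g x = 0" if "x \<in> B" for x using g(2)[of x] that yB vec.span_base[of x B] by auto
  then have g0: "g x = 0" if "x \<in> vec.span B" for x
    using vec.linear_eq_0_on_span[OF g(1) _ that] \<open>\<And>x. x \<in> B \<Longrightarrow> g x = 0\<close> by blast
  obtain k :: 'd where True by blast
  define l where "l = matrix g $ k"
  have gl: "g x $ k = (\<Sum>i\<in>UNIV. l $ i * x $ i)" for x
    using arg_cong[OF matrix_works[OF g(1), of x], of "\<lambda>v. v $ k"]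
    by (simp add: l_def matrix_vector_mult_def)
  have "(\<Sum>i\<in>UNIV. l $ i * of_int (A $ i $ j)) = 0" if "j \<in> J" for j
    using gl[of "?a j"] g0[of "?a j"] B(3) that by (auto simp: of_int_vec_def column_def)
  moreover have "(\<Sum>i\<in>UNIV. l $ i * y $ i) = - 1"
    using gl[of y] g(2)[of y] by simp
  ultimately show ?thesis unfolding y_def by blast
qed

section \<open>Vanishing of Koszul homology outside the quasidegrees\<close>

text \<open>
  Elements of the free module \<open>D\<^sup>S\<close> are families of operators indexed by a whole type, of which only
  the members with index in \<open>S\<close> matter.  Euler operators act on them from the right.
\<close>

definition family_euler :: "int^'n::finite^'d::finite \<Rightarrow> complex^'d \<Rightarrow> 'd \<Rightarrow> ('q \<Rightarrow> 'n cpoly \<Rightarrow> 'n cpoly) \<Rightarrow> 'q \<Rightarrow> 'n cpoly \<Rightarrow> 'n cpoly" where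
  "family_euler A \<beta> i F = (\<lambda>q. F q \<circ> euler_op A \<beta> i)"

text \<open>
  A bistable set is a \<open>D\<close>-submodule to which the right multiplications by Euler operators restrict, so
  that quotients of bistable sets carry a Koszul complex of \<open>D\<close>-modules.
\<close>

definition bistable :: "int^'n::finite^'d::finite \<Rightarrow> complex^'d \<Rightarrow> ('q \<Rightarrow> 'n cpoly \<Rightarrow> 'n cpoly) set \<Rightarrow> bool" where
  "bistable A \<beta> X \<longleftrightarrow> additive_subgroup_set X \<and> (\<forall>P\<in>weyl_ops. \<forall>F\<in>X. (\<lambda>q. P \<circ> F q) \<in> X) \<and>
     (\<forall>i. \<forall>F\<in>X. family_euler A \<beta> i F \<in> X)"

lemma bistableD:
  assumes "bistable A \<beta> X"
  shows "additive_subgroup_set X" "P \<in> weyl_ops \<Longrightarrow> F \<in> X \<Longrightarrow> (\<lambda>q. P \<circ> F q) \<in> X"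
    "F \<in> X \<Longrightarrow> family_euler A \<beta> i F \<in> X"
  using assms unfolding bistable_def by simp_all

lemma family_euler_endos: "commuting_endos (family_euler A \<beta>)"
proof
  show "family_euler A \<beta> i (F + G) = family_euler A \<beta> i F + family_euler A \<beta> i G" for i F G
    by (rule ext) (auto simp: family_euler_def)
  show "family_euler A \<beta> i (family_euler A \<beta> k F) = family_euler A \<beta> k (family_euler A \<beta> i F)" for i k F
    using euler_op_commute[of A \<beta> k i] by (simp add: family_euler_def comp_assoc)
qed

text \<open>
  The image in \<open>D\<^sup>S\<close> of a vector of polynomials in \<open>\<complex>[\<partial>]\<^sup>S\<close>.
\<close>

definition op_family :: "('q \<Rightarrow> 'n::finite cpoly) \<Rightarrow> 'q \<Rightarrow> 'n cpoly \<Rightarrow> 'n cpoly" where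
  "op_family v = (\<lambda>q. diff_op (v q))"

definition adjoin :: "('q \<Rightarrow> 'n::finite cpoly \<Rightarrow> 'n cpoly) set \<Rightarrow> ('q \<Rightarrow> 'n cpoly) \<Rightarrow> ('q \<Rightarrow> 'n cpoly \<Rightarrow> 'n cpoly) set" where
  "adjoin X v = {F + (\<lambda>q. P \<circ> op_family v q) |F P. F \<in> X \<and> P \<in> weyl_ops}"

lemma subset_adjoin: "X \<subseteq> adjoin X v"
proof
  fix F assume "F \<in> X"
  moreover have "F = F + (\<lambda>q. 0 \<circ> op_family v q)" by (auto simp: fun_eq_iff)
  ultimately show "F \<in> adjoin X v" unfolding adjoin_def using weyl_ops_zero by blast
qed

lemma op_family_in_adjoin: "additive_subgroup_set X \<Longrightarrow> P \<in> weyl_ops \<Longrightarrow> (\<lambda>q. P \<circ> op_family v q) \<in> adjoin X v"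
  using subgroup_setD(1)[of X] unfolding adjoin_def mem_Collect_eq
  by (intro exI[of _ 0] exI[of _ P]) simp

text \<open>
  For stability under the Euler operators the vector \<open>v\<close> has to be homogeneous: then
  \<open>v (E\<^sub>i - \<beta>\<^sub>i) = (E\<^sub>i - \<beta>\<^sub>i - \<alpha>\<^sub>i) v\<close> lies in \<open>D v\<close>.
\<close>

lemma bistable_adjoin:
  fixes v :: "'q \<Rightarrow> 'n::finite cpoly" and A :: "int^'n^'d::finite"
  assumes X: "bistable A \<beta> X" and v: "\<And>q. v q \<in> poly_degree_part A \<alpha>"
  shows "bistable A \<beta> (adjoin X v)"
  unfolding bistable_def additive_subgroup_set_def
proof (intro conjI ballI allI)
  note sub = subgroup_setD[OF bistableD(1)[OF X]]
  show "0 \<in> adjoin X v" using subset_adjoin[of X v] sub(1) by blast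
  fix F assume "F \<in> adjoin X v"
  then obtain F' P where F: "F = F' + (\<lambda>q. P \<circ> op_family v q)" "F' \<in> X" "P \<in> weyl_ops"
    unfolding adjoin_def by blast
  {
    fix G assume "G \<in> adjoin X v"
    then obtain G' Q where G: "G = G' + (\<lambda>q. Q \<circ> op_family v q)" "G' \<in> X" "Q \<in> weyl_ops"
      unfolding adjoin_def by blast
    have "F - G = (F' - G') + (\<lambda>q. (P - Q) \<circ> op_family v q)" by (auto simp: F G fun_eq_iff)
    then show "F - G \<in> adjoin X v"
      unfolding adjoin_def using F G sub(2) subgroup_setD(2)[OF weyl_ops_subgroup] by blast
  next
    fix Q :: "'n cpoly \<Rightarrow> 'n cpoly" assume Q: "Q \<in> weyl_ops"
    have "(\<lambda>q. Q \<circ> F q) = (\<lambda>q. Q \<circ> F' q) + (\<lambda>q. (Q \<circ> P) \<circ> op_family v q)"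
      using Q by (auto simp: F fun_eq_iff weyl_ops_add)
    then show "(\<lambda>q. Q \<circ> F q) \<in> adjoin X v"
      unfolding adjoin_def using F Q bistableD(2)[OF X] weyl_ops.comp by blast
  next
    fix i
    have "family_euler A \<beta> i F = family_euler A \<beta> i F' + (\<lambda>q. (P \<circ> euler_op A (\<beta> + of_int_vec \<alpha>) i) \<circ> op_family v q)"
    proof
      fix q
      have "diff_op (v q) \<circ> euler_op A \<beta> i = euler_op A (\<beta> + of_int_vec \<alpha>) i \<circ> diff_op (v q)"
        by (rule diff_op_euler[OF v])
      then show "family_euler A \<beta> i F q = (family_euler A \<beta> i F' + (\<lambda>q. (P \<circ> euler_op A (\<beta> + of_int_vec \<alpha>) i) \<circ> op_family v q)) q"
        unfolding family_euler_def F op_family_def by (auto simp: fun_eq_iff)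
    qed
    then show "family_euler A \<beta> i F \<in> adjoin X v"
      unfolding adjoin_def using F bistableD(3)[OF X] weyl_ops.comp euler_op_in_weyl by blast
  }
qed

lemma euler_combination:
  "(\<Sum>i\<in>UNIV. monomial 0 (l $ i) * euler_op A \<gamma> i g) =
     (\<Sum>j\<in>UNIV. monomial 0 (\<Sum>i\<in>UNIV. l $ i * of_int (A $ i $ j)) * (pvar j * partial_deriv j g))
       - monomial 0 (\<Sum>i\<in>UNIV. l $ i * \<gamma> $ i) * g"
proof -
  have "monomial 0 (l $ i) * euler_op A \<gamma> i g =
     (\<Sum>j\<in>UNIV. monomial 0 (l $ i * of_int (A $ i $ j)) * (pvar j * partial_deriv j g)) - monomial 0 (l $ i * \<gamma> $ i) * g" for i
    by (simp add: euler_op_def right_diff_distrib sum_distrib_left mult_single mult.assoc[symmetric] del: single_of_int)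
  then show ?thesis
    by (simp add: sum_subtractf single_sum sum_distrib_right del: single_of_int) (rule sum.swap)
qed

text \<open>
  Modulo \<open>X\<close> one has \<open>P v \<Sum>\<^sub>i l\<^sub>i (E\<^sub>i - \<beta>\<^sub>i) = P (\<Sum>\<^sub>j (l \<bullet> a\<^sub>j) x\<^sub>j \<partial>\<^sub>j - l \<bullet> (\<beta> + \<alpha>)) v\<close>, and every term
  with an index \<open>j\<close> drops out: for \<open>j \<in> J\<close> because of \<open>l \<bullet> a\<^sub>j = 0\<close>, and otherwise because \<open>\<partial>\<^sub>j v\<close> lies
  in \<open>X\<close>.  So the combination acts on \<open>(X + D v)/X\<close> as \<open>- l \<bullet> (\<beta> + \<alpha>) = 1\<close>.
\<close>

lemma acyclic_adjoin_if_functional: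
  fixes v :: "'q \<Rightarrow> 'n::finite cpoly" and A :: "int^'n^'d::{finite,linorder}"
  assumes X: "bistable A \<beta> X" and v: "\<And>q. v q \<in> poly_degree_part A \<alpha>"
    and kill: "\<And>j. j \<notin> J \<Longrightarrow> op_family (\<lambda>q. pvar j * v q) \<in> X"
    and l: "\<And>j. j \<in> J \<Longrightarrow> (\<Sum>i\<in>UNIV. l $ i * of_int (A $ i $ j)) = 0"
    and lc: "(\<Sum>i\<in>UNIV. l $ i * (\<beta> + of_int_vec \<alpha>) $ i) = - 1"
  shows "acyclic_over (family_euler A \<beta>) (adjoin X v) X"
proof -
  interpret commuting_endos "family_euler A \<beta> :: 'd \<Rightarrow> ('q \<Rightarrow> 'n cpoly \<Rightarrow> 'n cpoly) \<Rightarrow> _" by (rule family_euler_endos)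
  let ?Y = "adjoin X v"
  have Y: "bistable A \<beta> ?Y" using X v by (rule bistable_adjoin)
  define \<mu> :: "'d \<Rightarrow> ('q \<Rightarrow> 'n cpoly \<Rightarrow> 'n cpoly) \<Rightarrow> 'q \<Rightarrow> 'n cpoly \<Rightarrow> 'n cpoly" where
    "\<mu> = (\<lambda>i F q. (\<lambda>f. monomial 0 (l $ i) * f) \<circ> F q)"
  note sX = bistableD(1)[OF X] and sY = bistableD(1)[OF Y]
  have \<mu>X: "F \<in> X \<Longrightarrow> \<mu> i F \<in> X" and \<mu>Y: "F \<in> ?Y \<Longrightarrow> \<mu> i F \<in> ?Y" for F i
    unfolding \<mu>_def using bistableD(2)[OF X weyl_ops.scalar] bistableD(2)[OF Y weyl_ops.scalar] by blast+
  show ?thesis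
  proof (rule acyclic_over_if_combination_identity[where \<mu> = \<mu>, OF sX sY])
    show "\<mu> i (x + y) = \<mu> i x + \<mu> i y" for i x y
      by (auto simp: \<mu>_def fun_eq_iff distrib_left)
    show "\<mu> i (family_euler A \<beta> k x) = family_euler A \<beta> k (\<mu> i x)" for i k x
      by (simp add: \<mu>_def family_euler_def comp_assoc)
    fix y assume "y \<in> ?Y"
    then obtain F P where y: "y = F + (\<lambda>q. P \<circ> op_family v q)" "F \<in> X" "P \<in> weyl_ops"
      unfolding adjoin_def by blast
    define a where "a = (\<lambda>j. \<Sum>i\<in>UNIV. l $ i * of_int (A $ i $ j))"
    \<comment> \<open>The \<open>j\<close>-th term of the combination of Euler operators, applied to \<open>P v\<close>.\<close>
    define G where "G = (\<lambda>j q. (P \<circ> (\<lambda>f. monomial 0 (a j) * (pvar j * f))) \<circ> op_family (\<lambda>q. pvar j * v q) q)"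
    have GX: "G j \<in> X" for j
    proof (cases "j \<in> J")
      case True
      then have "G j = 0" using l[OF True] by (auto simp: G_def a_def fun_eq_iff weyl_ops_zero_apply[OF y(3)])
      then show ?thesis using subgroup_setD(1)[OF sX] by simp
    next
      case False
      have "P \<circ> (\<lambda>f. monomial 0 (a j) * (pvar j * f)) \<in> weyl_ops"
        using y(3) weyl_ops_scalar[OF weyl_ops.var] by (rule weyl_ops.comp)
      then show ?thesis unfolding G_def by (rule bistableD(2)[OF X _ kill[OF False]])
    qed
    have id: "(\<lambda>q. P \<circ> op_family v q) - (\<Sum>i\<in>UNIV. \<mu> i (family_euler A \<beta> i (\<lambda>q. P \<circ> op_family v q)))
        = - (\<Sum>j\<in>UNIV. G j)"
    proof (intro ext)
      fix q f
      let ?g = "diff_op (v q) f"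
      have "(\<Sum>i\<in>UNIV. \<mu> i (family_euler A \<beta> i (\<lambda>q. P \<circ> op_family v q))) q f
          = (\<Sum>i\<in>UNIV. monomial 0 (l $ i) * P (diff_op (v q) (euler_op A \<beta> i f)))"
        by (simp add: sum_fun_apply \<mu>_def family_euler_def op_family_def)
      also have "\<dots> = (\<Sum>i\<in>UNIV. monomial 0 (l $ i) * P (euler_op A (\<beta> + of_int_vec \<alpha>) i ?g))"
        using fun_cong[OF diff_op_euler[OF v]] by simp
      also have "\<dots> = P (\<Sum>i\<in>UNIV. monomial 0 (l $ i) * euler_op A (\<beta> + of_int_vec \<alpha>) i ?g)"
        by (simp add: weyl_ops_sum_apply[OF y(3)] weyl_ops_scale[OF y(3)])
      also have "\<dots> = P ((\<Sum>j\<in>UNIV. monomial 0 (a j) * (pvar j * partial_deriv j ?g)) + ?g)"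
        unfolding euler_combination lc a_def by (simp add: single_uminus)
      also have "\<dots> = (\<Sum>j\<in>UNIV. G j q f) + P ?g"
        by (simp add: weyl_ops_add[OF y(3)] weyl_ops_sum_apply[OF y(3)] G_def op_family_def diff_op_mult diff_op_single)
      finally show "((\<lambda>q. P \<circ> op_family v q) - (\<Sum>i\<in>UNIV. \<mu> i (family_euler A \<beta> i (\<lambda>q. P \<circ> op_family v q)))) q f
        = (- (\<Sum>j\<in>UNIV. G j)) q f"
        by (simp add: sum_fun_apply op_family_def)
    qed
    have "\<mu> i (family_euler A \<beta> i y) = \<mu> i (family_euler A \<beta> i F) + \<mu> i (family_euler A \<beta> i (\<lambda>q. P \<circ> op_family v q))" for i
      by (auto simp: y(1) \<mu>_def fun_eq_iff distrib_left family_euler_def)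
    then have "y - (\<Sum>i\<in>UNIV. \<mu> i (family_euler A \<beta> i y)) = (F - (\<Sum>i\<in>UNIV. \<mu> i (family_euler A \<beta> i F)))
        + ((\<lambda>q. P \<circ> op_family v q) - (\<Sum>i\<in>UNIV. \<mu> i (family_euler A \<beta> i (\<lambda>q. P \<circ> op_family v q))))"
      by (simp add: sum.distrib y(1) algebra_simps)
    also have "\<dots> = (F - (\<Sum>i\<in>UNIV. \<mu> i (family_euler A \<beta> i F))) - (\<Sum>j\<in>UNIV. G j)"
      unfolding id by simp
    also have "\<dots> \<in> X"
      by (intro subgroup_setD(2)[OF sX] subgroup_set_sum[OF sX] GX y \<mu>X bistableD(3)[OF X])
    finally show "y - (\<Sum>i\<in>UNIV. \<mu> i (family_euler A \<beta> i y)) \<in> X" .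
  qed (use \<mu>X \<mu>Y in auto)
qed

lemma poly_degree_part_mult_monomial:
  assumes "p \<in> poly_degree_part A \<alpha>"
  shows "monomial u 1 * p \<in> poly_degree_part A (\<alpha> - A *v exp_vec u)"
  unfolding poly_degree_part_def
proof (rule CollectI, rule ballI)
  fix w assume "w \<in> Poly_Mapping.keys (monomial u 1 * p)"
  then obtain v where "w = u + v" "v \<in> Poly_Mapping.keys p"
    using keys_mult[of "monomial u 1" p] by auto
  then show "- (A *v exp_vec w) = \<alpha> - A *v exp_vec u"
    using assms by (auto simp: poly_degree_part_def exp_vec_add matrix_vector_right_distrib)
qed

lemma op_family_mult: "op_family (\<lambda>q. r * v q) = (\<lambda>q. diff_op r \<circ> op_family v q)"
  by (auto simp: op_family_def diff_op_mult)

lemma op_family_mult_in: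
  assumes "bistable A \<beta> X" "op_family v \<in> X"
  shows "op_family (\<lambda>q. r * v q) \<in> X"
  unfolding op_family_mult using bistableD(2)[OF assms(1) diff_op_in_weyl assms(2)] .

lemma op_family_in_adjoin_self: "bistable A \<beta> X \<Longrightarrow> op_family v \<in> adjoin X v"
  using op_family_in_adjoin[OF bistableD(1) weyl_ops_id, of A \<beta> X v] by simp

lemma adjoin_least:
  assumes "bistable A \<beta> Y" "X \<subseteq> Y" "op_family v \<in> Y"
  shows "adjoin X v \<subseteq> Y"
  using assms bistableD(2)[OF assms(1) _ assms(3)] subgroup_setD(4)[OF bistableD(1)[OF assms(1)]]
  unfolding adjoin_def by blast

lemma adjoin_absorb: "bistable A \<beta> X \<Longrightarrow> op_family v \<in> X \<Longrightarrow> adjoin X v = X"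
  using adjoin_least[of A \<beta> X X v] subset_adjoin[of X v] by blast

text \<open>
  The degrees of \<open>\<complex>[\<partial>] v\<close> modulo \<open>X\<close> are zeros of \<open>p\<close>, in a form that evidently passes to larger \<open>X\<close> and
  to monomial multiples of \<open>v\<close>.
\<close>

definition degrees_vanish ::
  "int^'n::finite^'d::finite \<Rightarrow> 'd cpoly \<Rightarrow> ('q \<Rightarrow> 'n cpoly \<Rightarrow> 'n cpoly) set \<Rightarrow> ('q \<Rightarrow> 'n cpoly) \<Rightarrow> int^'d \<Rightarrow> bool" where
  "degrees_vanish A p X v \<alpha> \<longleftrightarrow>
     (\<forall>u. op_family (\<lambda>q. monomial u 1 * v q) \<notin> X \<longrightarrow> poly_eval p (of_int_vec (\<alpha> - A *v exp_vec u)) = 0)"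

text \<open>
  The set \<open>J\<close> of the vanishing argument.  It shrinks when \<open>X\<close> grows and when \<open>v\<close> is replaced by a
  multiple, and adjoining \<open>\<partial>\<^sub>j v\<close> to \<open>X\<close> removes \<open>j\<close> from it.
\<close>

definition active :: "('q \<Rightarrow> 'n::finite cpoly \<Rightarrow> 'n cpoly) set \<Rightarrow> ('q \<Rightarrow> 'n cpoly) \<Rightarrow> 'n set" where
  "active X v = {j. op_family (\<lambda>q. pvar j * v q) \<notin> X}"

text \<open>
  Induction on the number of active variables.  If no monomial in the active variables annihilates
  \<open>v\<close> modulo \<open>X\<close>, the linear form from \<open>separating_functional\<close> is available.  Otherwise, induction on
  the degree of such a monomial \<open>u\<close>: for a variable \<open>j\<close> of \<open>u\<close> consider
  \<open>X \<subseteq> X + D \<partial>\<^sub>j v \<subseteq> X + D v\<close>.  The lower step is generated by \<open>\<partial>\<^sub>j v\<close>, which is annihilated by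
  \<open>u - e\<^sub>j\<close>; in the upper step \<open>j\<close> is no longer active.
\<close>

lemma acyclic_adjoin:
  fixes v :: "'q \<Rightarrow> 'n::finite cpoly" and A :: "int^'n^'d::{finite,linorder}"
  assumes nz: "poly_eval p (- \<beta>) \<noteq> 0"
    and "bistable A \<beta> X" "\<And>q. v q \<in> poly_degree_part A \<alpha>" "degrees_vanish A p X v \<alpha>"
  shows "acyclic_over (family_euler A \<beta>) (adjoin X v) X"
  using assms(2-4)
proof (induction "card (active X v)" arbitrary: X v \<alpha> rule: less_induct)
  case less
  note X = less.prems(1)
  interpret commuting_endos "family_euler A \<beta> :: 'd \<Rightarrow> ('q \<Rightarrow> 'n cpoly \<Rightarrow> 'n cpoly) \<Rightarrow> _" by (rule family_euler_endos)
  show ?case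
  proof (cases "\<exists>u. Poly_Mapping.keys u \<subseteq> active X v \<and> op_family (\<lambda>q. monomial u 1 * v q) \<in> X")
    case False
    have "poly_eval p (of_int_vec (\<alpha> - A *v exp_vec u)) = 0" if "Poly_Mapping.keys u \<subseteq> active X v" for u
      using False that less.prems(3) unfolding degrees_vanish_def by simp
    from separating_functional[OF this nz] obtain l where l: "\<And>j. j \<in> active X v \<Longrightarrow> (\<Sum>i\<in>UNIV. l $ i * of_int (A $ i $ j)) = 0"
      "(\<Sum>i\<in>UNIV. l $ i * (\<beta> + of_int_vec \<alpha>) $ i) = - 1"
      by blast
    show ?thesis
      by (rule acyclic_adjoin_if_functional[OF X less.prems(2), where J = "active X v" and l = l])
        (use l in \<open>auto simp: active_def\<close>)
  next
    case True
    then obtain u where u: "Poly_Mapping.keys u \<subseteq> active X v" "op_family (\<lambda>q. monomial u 1 * v q) \<in> X" by blast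
    \<comment> \<open>The inner induction has to allow all vectors \<open>w\<close> with no more active variables than \<open>v\<close>, because it
      passes from \<open>w\<close> to \<open>\<partial>\<^sub>j w\<close>.\<close>
    have "acyclic_over (family_euler A \<beta>) (adjoin X w) X"
      if "active X w \<subseteq> active X v" "\<And>q. w q \<in> poly_degree_part A \<gamma>" "degrees_vanish A p X w \<gamma>"
        "Poly_Mapping.keys u \<subseteq> active X v" "op_family (\<lambda>q. monomial u 1 * w q) \<in> X" for w \<gamma> u
      using that
    proof (induction "\<Sum>j\<in>UNIV. Poly_Mapping.lookup u j" arbitrary: u w \<gamma>)
      case 0
      then have "Poly_Mapping.lookup u j = 0" for j by simp
      then have "u = 0" by (intro poly_mapping_eqI) simp
      then have "op_family w \<in> X" using 0 by simp
      then show ?case by (simp add: adjoin_absorb[OF X] acyclic_refl[OF bistableD(1)[OF X]])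
    next
      case (Suc n)
      obtain j where j: "Poly_Mapping.lookup u j \<noteq> 0" using Suc.hyps(2) by force
      define u' where "u' = u - Poly_Mapping.single j 1"
      have u: "u = u' + Poly_Mapping.single j 1"
        unfolding u'_def using j by (intro poly_mapping_eqI) (auto simp: lookup_add lookup_minus lookup_single when_def)
      have "(\<Sum>i\<in>UNIV. Poly_Mapping.lookup u i) = (\<Sum>i\<in>UNIV. Poly_Mapping.lookup u' i) + (\<Sum>i\<in>UNIV. if i = j then 1 else 0)"
        unfolding u lookup_add sum.distrib by (simp add: lookup_single when_def eq_commute)
      then have n: "n = (\<Sum>i\<in>UNIV. Poly_Mapping.lookup u' i)" using Suc.hyps(2) by simp
      have jact: "j \<in> active X v" using Suc.prems(4) j by (auto simp: in_keys_iff)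
      let ?w = "\<lambda>q. pvar j * w q"
      have w_deg: "?w q \<in> poly_degree_part A (\<gamma> - A *v exp_vec (Poly_Mapping.single j 1))" for q
        by (rule poly_degree_part_mult_monomial[OF Suc.prems(2)])
      have mono: "active X ?w \<subseteq> active X w"
      proof -
        have "op_family (\<lambda>q. pvar i * ?w q) \<in> X" if "op_family (\<lambda>q. pvar i * w q) \<in> X" for i
          using op_family_mult_in[OF X that, of "pvar j"] by (simp only: mult.left_commute)
        then show ?thesis unfolding active_def by auto
      qed
      let ?X = "adjoin X ?w"
      have X': "bistable A \<beta> ?X" using X w_deg by (rule bistable_adjoin)
      have 1: "acyclic_over (family_euler A \<beta>) ?X X"
      proof (rule Suc.hyps(1)[OF n _ w_deg])
        show "active X ?w \<subseteq> active X v" using mono Suc.prems(1) by blast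
        show "degrees_vanish A p X ?w (\<gamma> - A *v exp_vec (Poly_Mapping.single j 1))"
          unfolding degrees_vanish_def
        proof (intro allI impI)
          fix u :: "'n \<Rightarrow>\<^sub>0 nat" assume "op_family (\<lambda>q. monomial u 1 * ?w q) \<notin> X"
          then have "op_family (\<lambda>q. monomial (u + Poly_Mapping.single j 1) 1 * w q) \<notin> X"
            by (simp add: mult_single mult.assoc[symmetric])
          then have "poly_eval p (of_int_vec (\<gamma> - A *v exp_vec (u + Poly_Mapping.single j 1))) = 0"
            using Suc.prems(3) unfolding degrees_vanish_def by blast
          then show "poly_eval p (of_int_vec (\<gamma> - A *v exp_vec (Poly_Mapping.single j 1) - A *v exp_vec u)) = 0"
            by (simp add: exp_vec_add matrix_vector_right_distrib algebra_simps)
        qed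
        show "Poly_Mapping.keys u' \<subseteq> active X v"
          using Suc.prems(4) unfolding u by (auto simp: in_keys_iff lookup_add)
        show "op_family (\<lambda>q. monomial u' 1 * ?w q) \<in> X"
          using Suc.prems(5) unfolding u by (simp add: mult_single mult.assoc[symmetric])
      qed
      have "active ?X w \<subseteq> active X w - {j}"
        using subset_adjoin[of X ?w] op_family_in_adjoin_self[OF X, of ?w] unfolding active_def by auto
      then have "active ?X w \<subset> active X v" using Suc.prems(1) jact by blast
      then have "card (active ?X w) < card (active X v)" by (simp add: psubset_card_mono)
      moreover have "degrees_vanish A p ?X w \<gamma>"
        using Suc.prems(3) subset_adjoin[of X ?w] unfolding degrees_vanish_def by blast
      ultimately have 2: "acyclic_over (family_euler A \<beta>) (adjoin ?X w) ?X"
        by (intro less.hyps[OF _ X' Suc.prems(2)])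
      have W: "bistable A \<beta> (adjoin X w)" using X Suc.prems(2) by (rule bistable_adjoin)
      have sub: "?X \<subseteq> adjoin X w"
        using op_family_mult_in[OF W op_family_in_adjoin_self[OF X]] by (intro adjoin_least[OF W] subset_adjoin)
      have "adjoin ?X w = adjoin X w"
      proof
        show "adjoin ?X w \<subseteq> adjoin X w"
          by (intro adjoin_least[OF W] sub op_family_in_adjoin_self[OF X])
        have "bistable A \<beta> (adjoin ?X w)" using X' Suc.prems(2) by (rule bistable_adjoin)
        then show "adjoin X w \<subseteq> adjoin ?X w"
          using subset_adjoin[of X ?w] subset_adjoin[of ?X w] by (intro adjoin_least op_family_in_adjoin_self[OF X']) auto
      qed
      with 2 have 2: "acyclic_over (family_euler A \<beta>) (adjoin X w) ?X" by simp
      show ?case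
        by (rule acyclic_trans[OF 2 1 subset_adjoin sub bistableD(1)[OF W]])
    qed
    from this[OF subset_refl less.prems(2,3) u] show ?thesis .
  qed
qed

text \<open>
  The free module is reached from \<open>X\<close> by adjoining the unit vectors one after the other.  The degrees of
  the intermediate quotients are among those of the whole quotient, because the submodules only
  grow.  The condition \<open>zero_outside\<close> says that members with an index outside of \<open>S\<close> are ignored.
\<close>

lemma acyclic_families:
  fixes A :: "int^'n::finite^'d::{finite,linorder}" and X :: "('q \<Rightarrow> 'n cpoly \<Rightarrow> 'n cpoly) set"
  assumes nz: "poly_eval p (- \<beta>) \<noteq> 0" and X: "bistable A \<beta> X" and "finite S"
    and in_weyl: "X \<subseteq> {F. \<forall>Q\<in>S. F Q \<in> weyl_ops}"
    and zero_outside: "\<And>F. (\<forall>Q\<in>S. F Q = 0) \<Longrightarrow> F \<in> X"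
    and vanish: "\<And>\<alpha> v. \<lbrakk>\<And>Q. v Q \<in> poly_degree_part A \<alpha>; op_family v \<notin> X\<rbrakk> \<Longrightarrow> poly_eval p (of_int_vec \<alpha>) = 0"
  shows "acyclic_over (family_euler A \<beta>) {F. \<forall>Q\<in>S. F Q \<in> weyl_ops} X"
proof -
  interpret commuting_endos "family_euler A \<beta> :: 'd \<Rightarrow> ('q \<Rightarrow> 'n cpoly \<Rightarrow> 'n cpoly) \<Rightarrow> _" by (rule family_euler_endos)
  define e :: "'q \<Rightarrow> 'q \<Rightarrow> 'n cpoly" where "e = (\<lambda>Q Q'. if Q' = Q then 1 else 0)"
  let ?Fam = "{F :: 'q \<Rightarrow> 'n cpoly \<Rightarrow> 'n cpoly. \<forall>Q\<in>S. F Q \<in> weyl_ops}"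
  have Fam: "bistable A \<beta> ?Fam"
    unfolding bistable_def additive_subgroup_set_def family_euler_def
    using weyl_ops_zero subgroup_setD(2)[OF weyl_ops_subgroup]
    by (auto intro: weyl_ops.comp euler_op_in_weyl)
  have "\<exists>Y. bistable A \<beta> Y \<and> X \<subseteq> Y \<and> (\<forall>Q\<in>S'. op_family (e Q) \<in> Y) \<and> acyclic_over (family_euler A \<beta>) Y X
      \<and> Y \<subseteq> ?Fam" if "finite S'" for S'
    using that
  proof induction
    case empty
    show ?case using X acyclic_refl[OF bistableD(1)[OF X]] in_weyl by (intro exI[of _ X]) blast
  next
    case (insert Q S')
    then obtain Y where Y: "bistable A \<beta> Y" "X \<subseteq> Y" "\<forall>Q\<in>S'. op_family (e Q) \<in> Y" "acyclic_over (family_euler A \<beta>) Y X"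
      "Y \<subseteq> ?Fam"
      by blast
    have eQ: "e Q Q' \<in> poly_degree_part A 0" for Q'
      by (auto simp: e_def poly_degree_part_def exp_vec_def matrix_vector_mult_def vec_eq_iff)
    have "degrees_vanish A p Y (e Q) 0"
      unfolding degrees_vanish_def
    proof (intro allI impI)
      fix u :: "'n \<Rightarrow>\<^sub>0 nat" assume "op_family (\<lambda>q. monomial u 1 * e Q q) \<notin> Y"
      then have "op_family (\<lambda>q. monomial u 1 * e Q q) \<notin> X" using Y(2) by auto
      then show "poly_eval p (of_int_vec (0 - A *v exp_vec u)) = 0"
        by (rule vanish[OF poly_degree_part_mult_monomial[OF eQ]])
    qed
    then have a: "acyclic_over (family_euler A \<beta>) (adjoin Y (e Q)) Y"
      by (rule acyclic_adjoin[OF nz Y(1) eQ])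
    have b: "bistable A \<beta> (adjoin Y (e Q))" using Y(1) eQ by (rule bistable_adjoin)
    have "adjoin Y (e Q) \<subseteq> ?Fam"
      using Y(5) by (intro adjoin_least[OF Fam]) (auto simp: op_family_def diff_op_in_weyl)
    moreover have "op_family (e q) \<in> adjoin Y (e Q)" if "q \<in> insert Q S'" for q
      using that Y(3) subset_adjoin[of Y "e Q"] op_family_in_adjoin_self[OF Y(1), of "e Q"] by auto
    ultimately show ?case
      using b Y(2) subset_adjoin[of Y "e Q"] acyclic_trans[OF a Y(4) Y(2) subset_adjoin bistableD(1)[OF b]]
      by (intro exI[of _ "adjoin Y (e Q)"] conjI ballI) blast+
  qed
  from this[OF \<open>finite S\<close>] obtain Y where Y: "bistable A \<beta> Y" "X \<subseteq> Y" "\<forall>Q\<in>S. op_family (e Q) \<in> Y" "acyclic_over (family_euler A \<beta>) Y X"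
    "Y \<subseteq> ?Fam"
     by blast
  have "{F. \<forall>Q\<in>S. F Q \<in> weyl_ops} \<subseteq> Y"
  proof
    fix F :: "'q \<Rightarrow> 'n cpoly \<Rightarrow> 'n cpoly" assume F: "F \<in> {F. \<forall>Q\<in>S. F Q \<in> weyl_ops}"
    have "(\<lambda>Q'. if Q' \<in> S then 0 else F Q') + (\<Sum>Q\<in>S. (\<lambda>Q'. F Q \<circ> op_family (e Q) Q')) \<in> Y"
    proof (intro subgroup_setD(4)[OF bistableD(1)[OF Y(1)]] subgroup_set_sum[OF bistableD(1)[OF Y(1)]])
      show "(\<lambda>Q'. if Q' \<in> S then 0 else F Q') \<in> Y"
        by (intro subsetD[OF Y(2)] zero_outside) simp
      show "(\<lambda>Q'. F Q \<circ> op_family (e Q) Q') \<in> Y" if "Q \<in> S" for Q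
        using F Y(3) that by (intro bistableD(2)[OF Y(1)]) auto
    qed
    also have "(\<lambda>Q'. if Q' \<in> S then 0 else F Q') + (\<Sum>Q\<in>S. (\<lambda>Q'. F Q \<circ> op_family (e Q) Q')) = F"
    proof
      fix Q'
      have "(F Q \<circ> op_family (e Q) Q') = (if Q = Q' then F Q else 0)" if "Q \<in> S" for Q
        using F that by (auto simp: op_family_def e_def diff_op_1 diff_op_0 weyl_ops_comp_0)
      then have "(\<Sum>Q\<in>S. F Q \<circ> op_family (e Q) Q') = (\<Sum>Q\<in>S. if Q = Q' then F Q else 0)"
        by (intro sum.cong) auto
      then show "((\<lambda>Q'. if Q' \<in> S then 0 else F Q') + (\<Sum>Q\<in>S. (\<lambda>Q'. F Q \<circ> op_family (e Q) Q'))) Q' = F Q'"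
        using \<open>finite S\<close> by (simp add: sum_fun_apply)
    qed
    finally show "F \<in> Y" .
  qed
  then have "Y = ?Fam" using Y(5) by blast
  then show ?thesis using Y(4) by simp
qed

section \<open>Splitting off the components with vanishing homology\<close>

definition right_euler :: "int^'n::finite^'d::finite \<Rightarrow> complex^'d \<Rightarrow> 'd \<Rightarrow> ('n cpoly \<Rightarrow> 'n cpoly) \<Rightarrow> 'n cpoly \<Rightarrow> 'n cpoly" where
  "right_euler A \<beta> i P = P \<circ> euler_op A \<beta> i"

lemma right_euler_endos: "commuting_endos (right_euler A \<beta>)"
proof
  show "right_euler A \<beta> i (F + G) = right_euler A \<beta> i F + right_euler A \<beta> i G" for i F G
    by (rule ext) (simp add: right_euler_def)
  show "right_euler A \<beta> i (right_euler A \<beta> k F) = right_euler A \<beta> k (right_euler A \<beta> i F)" for i k F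
    using euler_op_commute[of A \<beta> k i] by (simp add: right_euler_def comp_assoc)
qed

lemma kdiff_family: "kdiff (family_euler A \<beta>) w T Q = kdiff (right_euler A \<beta>) (\<lambda>T. w T Q) T"
  by (auto simp: kdiff_def sum_fun_apply koszul_sign_def family_euler_def right_euler_def intro!: sum.cong)

text \<open>
  The families that are congruent to one single operator modulo all \<open>D C\<^sub>Q\<close>: this is the preimage in
  \<open>D\<^sup>S\<close> of the image of \<open>D/DI\<close> in \<open>\<Oplus>\<^sub>Q D/DC\<^sub>Q\<close>, so \<open>D\<^sup>S\<close> modulo these families is \<open>D \<otimes> P\<^sub>I\<close>.
\<close>

definition common_families :: "'q set \<Rightarrow> ('q \<Rightarrow> 'n::finite cpoly set) \<Rightarrow> ('q \<Rightarrow> 'n cpoly \<Rightarrow> 'n cpoly) set" where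
  "common_families S C = {F. (\<forall>Q\<in>S. F Q \<in> weyl_ops) \<and> (\<exists>y\<in>weyl_ops. \<forall>Q\<in>S. F Q - y \<in> weyl_ext (C Q))}"

lemma bistable_common_families:
  fixes A :: "int^'n::finite^'d::finite" and C :: "'q \<Rightarrow> 'n cpoly set"
  assumes C: "\<And>Q. Q \<in> S \<Longrightarrow> A_graded_ideal A (C Q)"
  shows "bistable A \<beta> (common_families S C)"
  unfolding bistable_def additive_subgroup_set_def
proof (intro conjI ballI allI)
  note sub = subgroup_setD[OF weyl_extD(1)]
  note wsub = subgroup_setD[OF weyl_ops_subgroup]
  show "0 \<in> common_families S C"
    unfolding common_families_def using sub(1) weyl_ops_zero by (auto intro!: bexI[of _ 0])
  fix F assume "F \<in> common_families S C"
  then obtain y where F: "\<And>Q. Q \<in> S \<Longrightarrow> F Q \<in> weyl_ops" "y \<in> weyl_ops" "\<And>Q. Q \<in> S \<Longrightarrow> F Q - y \<in> weyl_ext (C Q)"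
    unfolding common_families_def by blast
  {
    fix G assume "G \<in> common_families S C"
    then obtain z where G: "\<And>Q. Q \<in> S \<Longrightarrow> G Q \<in> weyl_ops" "z \<in> weyl_ops" "\<And>Q. Q \<in> S \<Longrightarrow> G Q - z \<in> weyl_ext (C Q)"
      unfolding common_families_def by blast
    have "(F - G) Q - (y - z) \<in> weyl_ext (C Q)" if "Q \<in> S" for Q
      using sub(2)[OF F(3)[OF that] G(3)[OF that]] by (simp add: algebra_simps)
    then show "F - G \<in> common_families S C"
      unfolding common_families_def using F G by (auto intro!: bexI[of _ "y - z"] wsub(2))
  next
    fix P :: "'n cpoly \<Rightarrow> 'n cpoly" assume P: "P \<in> weyl_ops"
    have "(P \<circ> F Q) - (P \<circ> y) \<in> weyl_ext (C Q)" if "Q \<in> S" for Q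
      using weyl_extD(3)[OF F(3)[OF that] P] P by (simp add: weyl_ops_comp_diff)
    then show "(\<lambda>Q. P \<circ> F Q) \<in> common_families S C"
      unfolding common_families_def using F P by (auto intro!: bexI[of _ "P \<circ> y"] weyl_ops.comp)
  next
    fix i
    have "(F Q \<circ> euler_op A \<beta> i) - (y \<circ> euler_op A \<beta> i) \<in> weyl_ext (C Q)" if "Q \<in> S" for Q
      using weyl_ext_euler_stable[OF C[OF that] F(3)[OF that], of \<beta> i] by (simp add: comp_diff_left)
    then show "family_euler A \<beta> i F \<in> common_families S C"
      unfolding common_families_def family_euler_def using F
      by (auto intro!: bexI[of _ "y \<circ> euler_op A \<beta> i"] weyl_ops.comp euler_op_in_weyl)
  }
qed

text \<open>
  An ideal \<open>I\<close> is the intersection of graded ideals \<open>C Q\<close>, of which those with \<open>Q \<in> T\<close> are to be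
  kept.  The Koszul homology is assumed to vanish for the cokernel of
  \<open>\<complex>[\<partial>]/I \<rightarrow> \<Oplus>\<^sub>Q \<complex>[\<partial>]/C\<^sub>Q\<close> and for the other components.
\<close>

locale split_components =
  fixes A :: "int^'n::finite^'d::{finite,linorder}" and \<beta> :: "complex^'d::{finite,linorder}"
    and I :: "'n cpoly set" and C :: "'q \<Rightarrow> 'n cpoly set" and S T :: "'q set"
  assumes finite_S: "finite S" and T_sub: "T \<subseteq> S"
    and graded: "\<And>Q. Q \<in> S \<Longrightarrow> A_graded_ideal A (C Q)"
    and I_eq: "I = (\<Inter>Q\<in>S. C Q)"
    and acyclic_cokernel: "acyclic_over (family_euler A \<beta>) {F. \<forall>Q\<in>S. F Q \<in> weyl_ops} (common_families S C)"
    and acyclic_component: "\<And>Q. Q \<in> S - T \<Longrightarrow> acyclic_over (right_euler A \<beta>) weyl_ops (weyl_ext (C Q))"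
begin

abbreviation "\<theta> \<equiv> right_euler A \<beta>"

sublocale E: commuting_endos "right_euler A \<beta>" by (rule right_euler_endos)

sublocale F: commuting_endos "family_euler A \<beta> :: 'd \<Rightarrow> ('q \<Rightarrow> 'n cpoly \<Rightarrow> 'n cpoly) \<Rightarrow> _"
  by (rule family_euler_endos)

lemma ideal_C: "Q \<in> S \<Longrightarrow> poly_ideal (C Q)"
  using graded A_graded_idealD by blast

lemma weyl_ext_I: "P \<in> weyl_ops \<Longrightarrow> (\<And>Q. Q \<in> S \<Longrightarrow> P \<in> weyl_ext (C Q)) \<Longrightarrow> P \<in> weyl_ext I"
  unfolding I_eq by (rule weyl_ext_INT) (auto intro: ideal_C)

lemma weyl_ext_I_subset: "Q \<in> S \<Longrightarrow> weyl_ext I \<subseteq> weyl_ext (C Q)"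
  unfolding I_eq by (rule weyl_ext_mono) blast

lemma kdiff_in_weyl: "(\<And>T. w T \<in> weyl_ops) \<Longrightarrow> kdiff \<theta> w T' \<in> weyl_ops"
  by (intro E.kdiff_in weyl_ops_subgroup) (auto simp: right_euler_def intro: weyl_ops.comp euler_op_in_weyl)

lemma kdiff_in_ext:
  assumes "Q \<in> S" "\<And>i. i \<notin> T' \<Longrightarrow> w (insert i T') \<in> weyl_ext (C Q)"
  shows "kdiff \<theta> w T' \<in> weyl_ext (C Q)"
  using assms by (intro E.kdiff_in weyl_extD(1)) (auto simp: right_euler_def intro: weyl_ext_euler_stable graded)

text \<open>
  A family of chains whose boundaries are common to all components, up to the \<open>D C\<^sub>Q\<close>, is a cycle of
  the cokernel.  Hence it differs by boundaries from a chain \<open>y\<close> that is common to all components.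
\<close>

lemma acyclic_cokernel_at:
  assumes "\<And>T' Q. card T' = p \<Longrightarrow> Q \<in> S \<Longrightarrow> z Q T' \<in> weyl_ops"
    and "\<And>T' Q. Suc (card T') = p \<Longrightarrow> Q \<in> S \<Longrightarrow> kdiff \<theta> (z Q) T' \<in> weyl_ops"
    and "\<And>T'. Suc (card T') = p \<Longrightarrow> \<exists>y\<in>weyl_ops. \<forall>Q\<in>S. kdiff \<theta> (z Q) T' - y \<in> weyl_ext (C Q)"
  obtains w y where "\<And>T' Q. Q \<in> S \<Longrightarrow> w Q T' \<in> weyl_ops" "\<And>T'. y T' \<in> weyl_ops"
    "\<And>T' Q. card T' = p \<Longrightarrow> Q \<in> S \<Longrightarrow> z Q T' - kdiff \<theta> (w Q) T' - y T' \<in> weyl_ext (C Q)"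
proof -
  let ?z = "\<lambda>T' Q. z Q T'"
  have "\<exists>w. (\<forall>T'. w T' \<in> {F. \<forall>Q\<in>S. F Q \<in> weyl_ops}) \<and>
      (\<forall>T'. card T' = p \<longrightarrow> ?z T' - kdiff (family_euler A \<beta>) w T' \<in> common_families S C)"
  proof (rule F.acyclic_over_at[OF acyclic_cokernel bistableD(1)[OF bistable_common_families]])
    show "\<And>Q. Q \<in> S \<Longrightarrow> A_graded_ideal A (C Q)" by (rule graded)
    show "0 \<in> {F. \<forall>Q\<in>S. F Q \<in> weyl_ops}" by (simp add: weyl_ops_zero)
    show "?z T' \<in> {F. \<forall>Q\<in>S. F Q \<in> weyl_ops}" if "card T' = p" for T' using assms(1)[OF that] by blast
    show "kdiff (family_euler A \<beta>) ?z T' \<in> common_families S C" if "Suc (card T') = p" for T'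
      unfolding common_families_def kdiff_family using assms(2,3)[OF that] by (simp add: kdiff_family)
  qed
  then obtain w where w: "\<And>T' Q. Q \<in> S \<Longrightarrow> w T' Q \<in> weyl_ops"
    "\<And>T'. card T' = p \<Longrightarrow> ?z T' - kdiff (family_euler A \<beta>) w T' \<in> common_families S C" by blast
  have "\<exists>y\<in>weyl_ops. card T' = p \<longrightarrow> (\<forall>Q\<in>S. z Q T' - kdiff \<theta> (\<lambda>T. w T Q) T' - y \<in> weyl_ext (C Q))" for T'
    using w(2)[of T'] weyl_ops_zero by (cases "card T' = p") (auto simp: common_families_def kdiff_family)
  then obtain y where y: "\<And>T'. y T' \<in> weyl_ops"
    "\<And>T' Q. card T' = p \<Longrightarrow> Q \<in> S \<Longrightarrow> z Q T' - kdiff \<theta> (\<lambda>T. w T Q) T' - y T' \<in> weyl_ext (C Q)" by metis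
  show ?thesis by (rule that[of "\<lambda>Q T. w T Q" y]) (use w y in auto)
qed

text \<open>
  Injectivity.  The chains \<open>w Q\<close> bounding \<open>z\<close> in the components, including the acyclic ones, form a
  cycle of the cokernel since their boundaries all are \<open>z\<close>.  Up to boundaries they can thus be replaced
  by one common chain \<open>y\<close>, and \<open>z\<close> minus the boundary of \<open>y\<close> lies in all \<open>D C\<^sub>Q\<close>, hence in \<open>D I\<close>.
\<close>

lemma boundary_if_component_boundaries:
  assumes z: "\<And>T'. card T' = p \<Longrightarrow> z T' \<in> weyl_ops"
    and dz: "\<And>T'. Suc (card T') = p \<Longrightarrow> kdiff \<theta> z T' \<in> weyl_ext I"
    and bd: "\<And>Q. Q \<in> T \<Longrightarrow> \<exists>w. (\<forall>T'. w T' \<in> weyl_ops) \<and> (\<forall>T'. card T' = p \<longrightarrow> z T' - kdiff \<theta> w T' \<in> weyl_ext (C Q))"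
  shows "\<exists>w. (\<forall>T'. w T' \<in> weyl_ops) \<and> (\<forall>T'. card T' = p \<longrightarrow> z T' - kdiff \<theta> w T' \<in> weyl_ext I)"
proof -
  have "\<exists>w. (\<forall>T'. w T' \<in> weyl_ops) \<and> (\<forall>T'. card T' = p \<longrightarrow> z T' - kdiff \<theta> w T' \<in> weyl_ext (C Q))" if Q: "Q \<in> S" for Q
  proof (cases "Q \<in> T")
    case False
    show ?thesis
      by (rule E.acyclic_over_at[OF acyclic_component weyl_extD(1) weyl_ops_zero])
        (use False Q z dz weyl_ext_I_subset[OF Q] in auto)
  qed (rule bd)
  then obtain w where w: "\<And>Q T'. Q \<in> S \<Longrightarrow> w Q T' \<in> weyl_ops"
    "\<And>Q T'. Q \<in> S \<Longrightarrow> card T' = p \<Longrightarrow> z T' - kdiff \<theta> (w Q) T' \<in> weyl_ext (C Q)" by metis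
  obtain v y where v: "\<And>T' Q. Q \<in> S \<Longrightarrow> v Q T' \<in> weyl_ops" and y: "\<And>T'. y T' \<in> weyl_ops"
    and vy: "\<And>T' Q. card T' = Suc p \<Longrightarrow> Q \<in> S \<Longrightarrow> w Q T' - kdiff \<theta> (v Q) T' - y T' \<in> weyl_ext (C Q)"
  proof (rule acyclic_cokernel_at[of "Suc p" w])
    show "\<exists>y\<in>weyl_ops. \<forall>Q\<in>S. kdiff \<theta> (w Q) T' - y \<in> weyl_ext (C Q)" if "Suc (card T') = Suc p" for T'
      using w(2)[of _ T'] that z[of T'] subgroup_setD(3)[OF weyl_extD(1)] by (intro bexI[of _ "z T'"]) force+
  qed (use w(1) kdiff_in_weyl in auto)
  have "z T' - kdiff \<theta> y T' \<in> weyl_ext I" if T': "card T' = p" for T'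
  proof (rule weyl_ext_I)
    show "z T' - kdiff \<theta> y T' \<in> weyl_ops" using z[OF T'] kdiff_in_weyl[OF y] by (rule subgroup_setD(2)[OF weyl_ops_subgroup])
    fix Q assume Q: "Q \<in> S"
    have "kdiff \<theta> (\<lambda>T. w Q T - kdiff \<theta> (v Q) T - y T) T' \<in> weyl_ext (C Q)"
      using T' by (intro kdiff_in_ext[OF Q] vy Q) simp
    moreover have "kdiff \<theta> (\<lambda>T. w Q T - kdiff \<theta> (v Q) T - y T) T' = kdiff \<theta> (w Q) T' - kdiff \<theta> y T'"
      by (simp add: E.kdiff_diff E.kdiff_kdiff)
    ultimately show "z T' - kdiff \<theta> y T' \<in> weyl_ext (C Q)"
      using subgroup_setD(4)[OF weyl_extD(1) w(2)[OF Q T']] by fastforce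
  qed
  then show ?thesis using y by blast
qed

text \<open>
  Surjectivity.  Extended by zero, the cycles of the components in \<open>T\<close> form a cycle of the cokernel, so
  up to boundaries they come from a common chain \<open>y\<close>.  Its boundary lies in all \<open>D C\<^sub>Q\<close>, hence in
  \<open>D I\<close>.
\<close>

lemma cycle_lifts:
  assumes z: "\<And>Q T'. Q \<in> T \<Longrightarrow> card T' = p \<Longrightarrow> z Q T' \<in> weyl_ops"
    and dz: "\<And>Q T'. Q \<in> T \<Longrightarrow> Suc (card T') = p \<Longrightarrow> kdiff \<theta> (z Q) T' \<in> weyl_ext (C Q)"
  shows "\<exists>y. (\<forall>T'. y T' \<in> weyl_ops) \<and> (\<forall>T'. Suc (card T') = p \<longrightarrow> kdiff \<theta> y T' \<in> weyl_ext I) \<and>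
     (\<forall>Q\<in>T. \<exists>w. (\<forall>T'. w T' \<in> weyl_ops) \<and> (\<forall>T'. card T' = p \<longrightarrow> z Q T' - y T' - kdiff \<theta> w T' \<in> weyl_ext (C Q)))"
proof -
  define x where "x = (\<lambda>Q T'. if Q \<in> T then z Q T' else 0)"
  have dx: "kdiff \<theta> (x Q) T' \<in> weyl_ext (C Q)" if "Q \<in> S" "Suc (card T') = p" for Q T'
  proof (cases "Q \<in> T")
    case True
    then show ?thesis using dz[OF True that(2)] by (simp add: x_def)
  next
    case False
    then show ?thesis by (simp add: x_def kdiff_def subgroup_setD(1)[OF weyl_extD(1)])
  qed
  obtain w y where w: "\<And>T' Q. Q \<in> S \<Longrightarrow> w Q T' \<in> weyl_ops" and y: "\<And>T'. y T' \<in> weyl_ops"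
    and wy: "\<And>T' Q. card T' = p \<Longrightarrow> Q \<in> S \<Longrightarrow> x Q T' - kdiff \<theta> (w Q) T' - y T' \<in> weyl_ext (C Q)"
  proof (rule acyclic_cokernel_at[of p x])
    show "x Q T' \<in> weyl_ops" if "card T' = p" "Q \<in> S" for T' Q
      using z[of Q T'] that by (simp add: x_def weyl_ops_zero)
    show "kdiff \<theta> (x Q) T' \<in> weyl_ops" if "Suc (card T') = p" "Q \<in> S" for T' Q
      using dx[OF that(2,1)] by (rule weyl_extD(2))
    show "\<exists>y\<in>weyl_ops. \<forall>Q\<in>S. kdiff \<theta> (x Q) T' - y \<in> weyl_ext (C Q)" if "Suc (card T') = p" for T'
      using dx that weyl_ops_zero by (intro bexI[of _ 0]) auto
  qed auto
  have "kdiff \<theta> y T' \<in> weyl_ext I" if "Suc (card T') = p" for T'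
  proof (rule weyl_ext_I)
    show "kdiff \<theta> y T' \<in> weyl_ops" using y by (rule kdiff_in_weyl)
    fix Q assume Q: "Q \<in> S"
    have "kdiff \<theta> (\<lambda>T. x Q T - kdiff \<theta> (w Q) T - y T) T' \<in> weyl_ext (C Q)"
      using that by (intro kdiff_in_ext[OF Q] wy Q) simp
    moreover have "kdiff \<theta> (\<lambda>T. x Q T - kdiff \<theta> (w Q) T - y T) T' = kdiff \<theta> (x Q) T' - kdiff \<theta> y T'"
      by (simp add: E.kdiff_diff E.kdiff_kdiff)
    ultimately show "kdiff \<theta> y T' \<in> weyl_ext (C Q)"
      using subgroup_setD(2)[OF weyl_extD(1) dx[OF Q that]] by fastforce
  qed
  moreover have "z Q T' - y T' - kdiff \<theta> (w Q) T' \<in> weyl_ext (C Q)" if "Q \<in> T" "card T' = p" for Q T'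
    using wy[OF that(2), of Q] that(1) T_sub by (auto simp: x_def algebra_simps)
  ultimately show ?thesis using w y T_sub by blast
qed

end

section \<open>Modules presented as quotients of additive groups\<close>

text \<open>
  The module \<open>M\<close> is the quotient of \<open>Z\<close> by \<open>B \<inter> Z\<close> via \<open>q\<close>, where \<open>Z\<close> is a subgroup of an additive type
  on which \<open>R\<close> acts by \<open>act\<close>.  The modules in question are iterated quotients, whose elements are nested cosets; presentations
  reduce all computations in them to operators and chains of operators.
\<close>

locale presentation =
  fixes R :: "'r ring" and act :: "'r \<Rightarrow> 'a::ab_group_add \<Rightarrow> 'a" and Z B :: "'a set"
    and M :: "('r, 'm) module" and q :: "'a \<Rightarrow> 'm"
  assumes Z_subgroup: "additive_subgroup_set Z"
    and act_closed: "r \<in> carrier R \<Longrightarrow> z \<in> Z \<Longrightarrow> act r z \<in> Z"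
    and act_add: "r \<in> carrier R \<Longrightarrow> z \<in> Z \<Longrightarrow> w \<in> Z \<Longrightarrow> act r (z + w) = act r z + act r w"
    and q_surj: "q ` Z = carrier M"
    and q_0: "q 0 = \<zero>\<^bsub>M\<^esub>"
    and q_add: "z \<in> Z \<Longrightarrow> w \<in> Z \<Longrightarrow> q (z + w) = q z \<oplus>\<^bsub>M\<^esub> q w"
    and q_act: "r \<in> carrier R \<Longrightarrow> z \<in> Z \<Longrightarrow> q (act r z) = r \<odot>\<^bsub>M\<^esub> q z"
    and q_eq_iff: "z \<in> Z \<Longrightarrow> w \<in> Z \<Longrightarrow> q z = q w \<longleftrightarrow> z - w \<in> B"
begin

lemmas Z_closed = subgroup_setD[OF Z_subgroup]

lemma q_closed: "z \<in> Z \<Longrightarrow> q z \<in> carrier M"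
  using q_surj by blast

lemma carrier_obtain:
  assumes "x \<in> carrier M" obtains z where "z \<in> Z" "x = q z"
  using assms q_surj by blast

lemma abelian_group_quotient: "abelian_group M"
proof (rule abelian_groupI)
  fix x assume "x \<in> carrier M"
  then obtain z where z: "z \<in> Z" "x = q z" by (rule carrier_obtain)
  then show "\<zero>\<^bsub>M\<^esub> \<oplus>\<^bsub>M\<^esub> x = x" using q_add[of 0 z] Z_closed(1) by (simp add: q_0)
  show "\<exists>y\<in>carrier M. y \<oplus>\<^bsub>M\<^esub> x = \<zero>\<^bsub>M\<^esub>"
    using z q_add[of "- z" z] Z_closed(3) q_closed by (intro bexI[of _ "q (- z)"]) (auto simp: q_0)
  fix y assume "y \<in> carrier M"
  then obtain w where w: "w \<in> Z" "y = q w" by (rule carrier_obtain)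
  show "x \<oplus>\<^bsub>M\<^esub> y \<in> carrier M" using z w q_closed[OF Z_closed(4)] q_add by metis
  show "x \<oplus>\<^bsub>M\<^esub> y = y \<oplus>\<^bsub>M\<^esub> x" using z w q_add by (metis add.commute)
  fix t assume "t \<in> carrier M"
  then obtain v where v: "v \<in> Z" "t = q v" by (rule carrier_obtain)
  show "x \<oplus>\<^bsub>M\<^esub> y \<oplus>\<^bsub>M\<^esub> t = x \<oplus>\<^bsub>M\<^esub> (y \<oplus>\<^bsub>M\<^esub> t)"
    using z w v Z_closed(4) by (simp add: q_add[symmetric] add.assoc)
next
  show "\<zero>\<^bsub>M\<^esub> \<in> carrier M" using q_closed[OF Z_closed(1)] q_0 by simp
qed

lemma q_minus: "z \<in> Z \<Longrightarrow> q (- z) = \<ominus>\<^bsub>M\<^esub> q z"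
  using abelian_group.minus_equality[OF abelian_group_quotient, of "q (- z)" "q z"]
    q_add[of "- z" z] q_closed Z_closed(3) by (simp add: q_0)

lemma q_sum: "(\<And>i. i \<in> S \<Longrightarrow> f i \<in> Z) \<Longrightarrow> finite S \<Longrightarrow> q (sum f S) = finsum M (\<lambda>i. q (f i)) S"
proof (induction S rule: infinite_finite_induct)
  case empty
  show ?case
    by (simp add: q_0 abelian_monoid.finsum_empty[OF abelian_group.axioms(1)[OF abelian_group_quotient]])
next
  case (insert i S)
  have "q (sum f (insert i S)) = q (f i) \<oplus>\<^bsub>M\<^esub> q (sum f S)"
    using insert.hyps insert.prems(1) by (simp add: q_add subgroup_set_sum[OF Z_subgroup])
  also have "\<dots> = q (f i) \<oplus>\<^bsub>M\<^esub> finsum M (\<lambda>i. q (f i)) S"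
    using insert by simp
  also have "\<dots> = finsum M (\<lambda>i. q (f i)) (insert i S)"
    using insert.hyps insert.prems(1) q_closed
    by (subst abelian_monoid.finsum_insert[OF abelian_group.axioms(1)[OF abelian_group_quotient]]) auto
  finally show ?case .
qed simp

lemma act_0: "r \<in> carrier R \<Longrightarrow> act r 0 = 0"
  using act_add[of r 0 0] Z_closed(1) by simp

lemma coset_eq: "z \<in> Z \<Longrightarrow> B' \<subseteq> Z \<Longrightarrow> q ` B' +>\<^bsub>M\<^esub> q z = q ` (\<lambda>b. b + z) ` B'"
  unfolding a_r_coset_def' by (auto simp: q_add subset_iff image_iff)

text \<open>
  Quotients of presented modules are presented by the same group.  The point is that the coset of
  \<open>q z\<close> is the image under \<open>q\<close> of the coset of \<open>z\<close>, which turns the set operations defining the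
  quotient module into computations with representatives.
\<close>

lemma quotient:
  assumes B': "B' \<subseteq> Z" "additive_subgroup_set B'" "B \<inter> Z \<subseteq> B'"
    and stable: "\<And>r b. r \<in> carrier R \<Longrightarrow> b \<in> B' \<Longrightarrow> act r b \<in> B'"
    and N: "N = q ` B'"
  shows "presentation R act Z B' (quot_module M N) (\<lambda>z. N +>\<^bsub>M\<^esub> q z)"
proof
  note sub = subgroup_setD[OF B'(2)]
  have coset: "N +>\<^bsub>M\<^esub> q z = q ` {x \<in> Z. x - z \<in> B'}" if "z \<in> Z" for z
  proof -
    have "(\<lambda>b. b + z) ` B' = {x \<in> Z. x - z \<in> B'}"
      using B'(1) that Z_closed(4) by (auto simp: image_iff intro!: bexI[of _ "_ - z"])
    then show ?thesis using coset_eq[OF that B'(1)] by (simp add: N)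
  qed
  show "additive_subgroup_set Z" by (rule Z_subgroup)
  show "(\<lambda>z. N +>\<^bsub>M\<^esub> q z) ` Z = carrier (quot_module M N)"
    by (auto simp: quot_module_def A_RCOSETS_def' q_surj[symmetric])
  show "N +>\<^bsub>M\<^esub> q 0 = \<zero>\<^bsub>quot_module M N\<^esub>"
    unfolding coset[OF Z_closed(1)] using B'(1) by (auto simp: quot_module_def N)
  show "N +>\<^bsub>M\<^esub> q z = N +>\<^bsub>M\<^esub> q w \<longleftrightarrow> z - w \<in> B'" if z: "z \<in> Z" and w: "w \<in> Z" for z w
  proof
    assume eq: "N +>\<^bsub>M\<^esub> q z = N +>\<^bsub>M\<^esub> q w"
    have "q z \<in> N +>\<^bsub>M\<^esub> q z" unfolding coset[OF z] using z sub(1) by (intro imageI) simp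
    then obtain x where x: "x \<in> Z" "x - w \<in> B'" "q z = q x" unfolding eq coset[OF w] by blast
    then have "z - x \<in> B'" using q_eq_iff[OF z x(1)] B'(3) Z_closed(2)[OF z x(1)] by blast
    then show "z - w \<in> B'" using sub(4)[OF _ x(2)] by fastforce
  next
    assume zw: "z - w \<in> B'"
    have "x - z \<in> B' \<longleftrightarrow> x - w \<in> B'" for x
      using sub(4)[OF _ zw, of "x - z"] sub(2)[OF _ zw, of "x - w"] by auto
    then show "N +>\<^bsub>M\<^esub> q z = N +>\<^bsub>M\<^esub> q w" unfolding coset[OF z] coset[OF w] by simp
  qed
  show "N +>\<^bsub>M\<^esub> q (z + w) = (N +>\<^bsub>M\<^esub> q z) \<oplus>\<^bsub>quot_module M N\<^esub> (N +>\<^bsub>M\<^esub> q w)" if z: "z \<in> Z" and w: "w \<in> Z" for z w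
  proof -
    have "q ` {x \<in> Z. x - (z + w) \<in> B'} = (q ` {x \<in> Z. x - z \<in> B'}) <+>\<^bsub>M\<^esub> (q ` {x \<in> Z. x - w \<in> B'})" (is "?l = ?r")
    proof
      show "?l \<subseteq> ?r"
      proof
        fix y assume "y \<in> ?l"
        then obtain x where x: "x \<in> Z" "x - (z + w) \<in> B'" "y = q x" by blast
        have "q x = q (x - w) \<oplus>\<^bsub>M\<^esub> q w" using q_add[of "x - w" w] x w Z_closed(2) by simp
        moreover have "x - w - z \<in> B'" using x(2) by (simp add: algebra_simps)
        ultimately show "y \<in> ?r"
          unfolding set_add_def' using x w Z_closed(2) sub(1) by (force simp: x(3))
      qed
      show "?r \<subseteq> ?l"
      proof
        fix y assume "y \<in> ?r"
        then obtain a b where ab: "a \<in> Z" "a - z \<in> B'" "b \<in> Z" "b - w \<in> B'" "y = q a \<oplus>\<^bsub>M\<^esub> q b"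
          unfolding set_add_def' by blast
        then have "y = q (a + b)" "a + b \<in> Z" by (auto simp: q_add Z_closed(4))
        moreover have "a + b - (z + w) \<in> B'" using sub(4)[OF ab(2,4)] by (simp add: algebra_simps)
        ultimately show "y \<in> ?l" by blast
      qed
    qed
    then show ?thesis unfolding coset[OF z] coset[OF w] coset[OF Z_closed(4)[OF z w]] by (simp add: quot_module_def)
  qed
  show "N +>\<^bsub>M\<^esub> q (act r z) = r \<odot>\<^bsub>quot_module M N\<^esub> (N +>\<^bsub>M\<^esub> q z)" if r: "r \<in> carrier R" and z: "z \<in> Z" for r z
  proof -
    note rz = act_closed[OF r z]
    have "q ` {x \<in> Z. x - act r z \<in> B'} = N <+>\<^bsub>M\<^esub> ((\<lambda>x. r \<odot>\<^bsub>M\<^esub> x) ` q ` {x \<in> Z. x - z \<in> B'})" (is "?l = ?r")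
    proof
      show "?l \<subseteq> ?r"
      proof
        fix y assume "y \<in> ?l"
        then obtain x where x: "x \<in> Z" "x - act r z \<in> B'" "y = q x" by blast
        have "q x = q (x - act r z) \<oplus>\<^bsub>M\<^esub> (r \<odot>\<^bsub>M\<^esub> q z)"
          using q_add[of "x - act r z" "act r z"] x rz Z_closed(2) by (simp add: q_act[OF r z])
        then show "y \<in> ?r"
          unfolding set_add_def' N using x z sub(1) by (force simp: x(3))
      qed
      show "?r \<subseteq> ?l"
      proof
        fix y assume "y \<in> ?r"
        then obtain a b where ab: "a \<in> B'" "b \<in> Z" "b - z \<in> B'" "y = q a \<oplus>\<^bsub>M\<^esub> (r \<odot>\<^bsub>M\<^esub> q b)"
          unfolding set_add_def' N by blast
        have a: "a \<in> Z" using ab(1) B'(1) by blast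
        have "y = q (a + act r b)" "a + act r b \<in> Z"
          using ab a act_closed[OF r ab(2)] by (auto simp: q_add q_act[OF r ab(2)] Z_closed(4))
        moreover have "act r b = act r (b - z) + act r z"
          using act_add[OF r, of "b - z" z] ab z Z_closed(2) by simp
        then have "a + act r b - act r z \<in> B'"
          using sub(4)[OF ab(1) stable[OF r ab(3)]] by (simp add: algebra_simps)
        ultimately show "y \<in> ?l" by blast
      qed
    qed
    then show ?thesis unfolding coset[OF z] coset[OF rz] by (simp add: quot_module_def)
  qed
qed (rule act_closed act_add; assumption)+

end

text \<open>
  The map induced by the identity on representatives.  The hypotheses state that it is well defined,
  injective and surjective.
\<close>

lemma lmodule_iso_direct_sum:
  assumes M: "presentation R act Z B M q" and N: "\<And>i. i \<in> T \<Longrightarrow> presentation R act (Z' i) (B' i) (N i) (q' i)"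
    and "finite T"
    and ZZ': "\<And>i. i \<in> T \<Longrightarrow> Z \<subseteq> Z' i"
    and BB': "\<And>z i. i \<in> T \<Longrightarrow> z \<in> Z \<Longrightarrow> z \<in> B \<Longrightarrow> z \<in> B' i"
    and inj: "\<And>z. z \<in> Z \<Longrightarrow> (\<And>i. i \<in> T \<Longrightarrow> z \<in> B' i) \<Longrightarrow> z \<in> B"
    and surj: "\<And>f. (\<And>i. i \<in> T \<Longrightarrow> f i \<in> Z' i) \<Longrightarrow> \<exists>y\<in>Z. \<forall>i\<in>T. f i - y \<in> B' i"
  shows "lmodule_iso R M (direct_sum T N)"
proof -
  interpret M: presentation R act Z B M q by (rule M)
  define h where "h = (\<lambda>X. \<lambda>i\<in>T. q' i (SOME z. z \<in> Z \<and> q z = X))"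
  have h: "h (q z) = (\<lambda>i\<in>T. q' i z)" if z: "z \<in> Z" for z
    unfolding h_def
  proof (rule restrict_ext)
    fix i assume i: "i \<in> T"
    let ?w = "SOME w. w \<in> Z \<and> q w = q z"
    have w: "?w \<in> Z \<and> q ?w = q z" by (rule someI[of _ z]) (simp add: z)
    then have "?w - z \<in> B" using M.q_eq_iff z by blast
    then have "?w - z \<in> B' i" using BB'[OF i] w z M.Z_closed(2) by blast
    then show "q' i ?w = q' i z" using presentation.q_eq_iff[OF N[OF i]] ZZ'[OF i] w z by blast
  qed
  have closed: "q' i z \<in> carrier (N i)" if "i \<in> T" "z \<in> Z" for i z
    using presentation.q_closed[OF N[OF that(1)]] ZZ'[OF that(1)] that(2) by blast
  have "h \<in> lmodule_hom R M (direct_sum T N)"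
    unfolding lmodule_hom_def
  proof (intro CollectI conjI ballI Pi_I)
    fix X assume "X \<in> carrier M"
    then obtain x where x: "x \<in> Z" "X = q x" by (rule M.carrier_obtain)
    show "h X \<in> carrier (direct_sum T N)"
      using x closed \<open>finite T\<close> by (auto simp: direct_sum_def h)
    show "h (r \<odot>\<^bsub>M\<^esub> X) = r \<odot>\<^bsub>direct_sum T N\<^esub> h X" if r: "r \<in> carrier R" for r
    proof -
      have "q' i (act r x) = r \<odot>\<^bsub>N i\<^esub> q' i x" if "i \<in> T" for i
        using presentation.q_act[OF N[OF that] r] ZZ'[OF that] x(1) by blast
      then show ?thesis
        using h[OF M.act_closed[OF r x(1)]] x(1) by (auto simp: direct_sum_def x(2) h M.q_act[OF r])
    qed
    fix Y assume "Y \<in> carrier M"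
    then obtain y where y: "y \<in> Z" "Y = q y" by (rule M.carrier_obtain)
    have "q' i (x + y) = q' i x \<oplus>\<^bsub>N i\<^esub> q' i y" if "i \<in> T" for i
      using presentation.q_add[OF N[OF that]] ZZ'[OF that] x(1) y(1) by blast
    then show "h (X \<oplus>\<^bsub>M\<^esub> Y) = h X \<oplus>\<^bsub>direct_sum T N\<^esub> h Y"
      using h[OF M.Z_closed(4)[OF x(1) y(1)]] x(1) y(1) by (auto simp: direct_sum_def x(2) y(2) h M.q_add)
  qed
  moreover have "bij_betw h (carrier M) (carrier (direct_sum T N))"
    unfolding bij_betw_def
  proof
    show "inj_on h (carrier M)"
    proof (rule inj_onI)
      fix X Y assume "X \<in> carrier M" "Y \<in> carrier M" and eq: "h X = h Y"
      then obtain x y where x: "x \<in> Z" "X = q x" and y: "y \<in> Z" "Y = q y" by (metis M.carrier_obtain)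
      have "x - y \<in> B' i" if "i \<in> T" for i
      proof -
        have "q' i x = q' i y" using fun_cong[OF eq, of i] that x y by (simp add: h)
        then show ?thesis using presentation.q_eq_iff[OF N[OF that]] ZZ'[OF that] x(1) y(1) by blast
      qed
      then have "x - y \<in> B" using inj M.Z_closed(2) x(1) y(1) by blast
      then show "X = Y" using M.q_eq_iff x y by blast
    qed
    show "h ` carrier M = carrier (direct_sum T N)"
    proof
      show "h ` carrier M \<subseteq> carrier (direct_sum T N)" using \<open>h \<in> _\<close> by (auto simp: lmodule_hom_def)
      show "carrier (direct_sum T N) \<subseteq> h ` carrier M"
      proof
        fix F assume F: "F \<in> carrier (direct_sum T N)"
        then have "\<exists>z. z \<in> Z' i \<and> F i = q' i z" if "i \<in> T" for i
          using that presentation.q_surj[OF N[OF that]] by (force simp: direct_sum_def PiE_iff)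
        then obtain f where f: "\<And>i. i \<in> T \<Longrightarrow> f i \<in> Z' i" "\<And>i. i \<in> T \<Longrightarrow> F i = q' i (f i)" by metis
        obtain y where y: "y \<in> Z" "\<And>i. i \<in> T \<Longrightarrow> f i - y \<in> B' i" using surj[OF f(1)] by blast
        have "h (q y) i = F i" for i
        proof (cases "i \<in> T")
          case True
          then show ?thesis
            using presentation.q_eq_iff[OF N[OF True] f(1)[OF True], of y] ZZ'[OF True] y f(2) by (auto simp: h)
        next
          case False
          then show ?thesis using F h[OF y(1)] by (auto simp: direct_sum_def PiE_iff extensional_def)
        qed
        then have "F = h (q y)" by auto
        then show "F \<in> h ` carrier M" using M.q_closed[OF y(1)] by blast
      qed
    qed
  qed
  ultimately show ?thesis unfolding lmodule_iso_def by blast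
qed

section \<open>Koszul homology of a presented module\<close>

text \<open>
  The endomorphisms \<open>\<phi> i\<close> of the presented module are induced by commuting additive maps \<open>\<theta> i\<close>, which
  are only required to be linear with respect to \<open>R\<close> on the elements of \<open>Z\<close>.
\<close>

locale koszul_presentation = presentation R act Z B M q + commuting_endos \<theta>
  for R :: "'r ring" and act :: "'r \<Rightarrow> 'a::ab_group_add \<Rightarrow> 'a" and Z B M and q :: "'a \<Rightarrow> 'm"
    and \<theta> :: "'d::{finite,linorder} \<Rightarrow> 'a \<Rightarrow> 'a" +
  fixes \<phi> :: "'d \<Rightarrow> 'm \<Rightarrow> 'm"
  assumes B_sub: "B \<subseteq> Z" and B_subgroup: "additive_subgroup_set B"
    and B_act: "r \<in> carrier R \<Longrightarrow> b \<in> B \<Longrightarrow> act r b \<in> B"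
    and \<theta>_Z: "z \<in> Z \<Longrightarrow> \<theta> i z \<in> Z" and \<theta>_B: "b \<in> B \<Longrightarrow> \<theta> i b \<in> B"
    and act_\<theta>: "r \<in> carrier R \<Longrightarrow> z \<in> Z \<Longrightarrow> act r (\<theta> i z) = \<theta> i (act r z)"
    and \<phi>_q: "z \<in> Z \<Longrightarrow> \<phi> i (q z) = q (\<theta> i z)"
begin

definition chain_q :: "nat \<Rightarrow> ('d set \<Rightarrow> 'a) \<Rightarrow> 'd set \<Rightarrow> 'm" where
  "chain_q p z = (\<lambda>T\<in>{T. card T = p}. q (z T))"

text \<open>
  Only the coefficients in degree \<open>p\<close> are meaningful.  The others are arbitrary elements of \<open>Z\<close>, for
  cycles as for boundaries, and disappear in the quotient.
\<close>

definition cycles :: "nat \<Rightarrow> ('d set \<Rightarrow> 'a) set" where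
  "cycles p = {z. (\<forall>T. z T \<in> Z) \<and> (\<forall>T. Suc (card T) = p \<longrightarrow> kdiff \<theta> z T \<in> B)}"

definition boundaries :: "nat \<Rightarrow> ('d set \<Rightarrow> 'a) set" where
  "boundaries p = {z. (\<forall>T. z T \<in> Z) \<and> (\<exists>w. (\<forall>T. w T \<in> Z) \<and> (\<forall>T. card T = p \<longrightarrow> z T - kdiff \<theta> w T \<in> B))}"

lemma kdiff_Z: "(\<And>T. w T \<in> Z) \<Longrightarrow> kdiff \<theta> w T' \<in> Z"
  by (intro kdiff_in Z_subgroup \<theta>_Z)

text \<open>
  The action is additive only on \<open>Z\<close>, so it has to be moved through the sum and the signs by hand.
\<close>

lemma act_kdiff:
  assumes r: "r \<in> carrier R" and z: "\<And>T. z T \<in> Z"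
  shows "kdiff \<theta> (\<lambda>T. act r (z T)) T = act r (kdiff \<theta> z T)"
proof -
  have neg: "act r (- w) = - act r w" if "w \<in> Z" for w
    using act_add[OF r that, of "- w"] Z_closed(3)[OF that] by (simp add: act_0[OF r] eq_neg_iff_add_eq_0 add.commute)
  have sum: "act r (sum f S) = (\<Sum>s\<in>S. act r (f s))" if "\<And>s. f s \<in> Z" for f :: "'d \<Rightarrow> 'a" and S
    by (induction S rule: infinite_finite_induct) (auto simp: act_0[OF r] act_add[OF r] that subgroup_set_sum[OF Z_subgroup])
  have "act r (koszul_sign i T (\<theta> i (z (insert i T)))) = koszul_sign i T (\<theta> i (act r (z (insert i T))))" for i
    using neg[OF \<theta>_Z[OF z]] act_\<theta>[OF r z] by (simp add: koszul_sign_def)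
  then show ?thesis
    unfolding kdiff_def by (subst sum) (auto intro: koszul_sign_in Z_subgroup \<theta>_Z z)
qed

lemma chain_presentation:
  "presentation R (\<lambda>r z T. act r (z T)) {z. \<forall>T. z T \<in> Z} {z. \<forall>T. card T = p \<longrightarrow> z T \<in> B}
     (koszul_module M p) (chain_q p)"
proof
  show "chain_q p ` {z. \<forall>T. z T \<in> Z} = carrier (koszul_module M p)"
  proof
    show "chain_q p ` {z. \<forall>T. z T \<in> Z} \<subseteq> carrier (koszul_module M p)"
      using q_closed by (auto simp: chain_q_def koszul_module_def direct_sum_def split: if_splits)
    show "carrier (koszul_module M p) \<subseteq> chain_q p ` {z. \<forall>T. z T \<in> Z}"
    proof
      fix F :: "'d set \<Rightarrow> 'm" assume F: "F \<in> carrier (koszul_module M p)"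
      have "\<exists>z\<in>Z. card T = p \<longrightarrow> F T = q z" for T :: "'d set"
      proof (cases "card T = p")
        case True
        then have "F T \<in> carrier M" using F by (auto simp: koszul_module_def direct_sum_def)
        then show ?thesis using carrier_obtain by metis
      qed (use Z_closed(1) in auto)
      then obtain z where z: "\<And>T. z T \<in> Z" "\<And>T. card T = p \<Longrightarrow> F T = q (z T)" by metis
      have "F = chain_q p z"
        using F z(2) by (auto simp: chain_q_def koszul_module_def direct_sum_def PiE_iff extensional_def fun_eq_iff)
      then show "F \<in> chain_q p ` {z. \<forall>T. z T \<in> Z}" using z(1) by blast
    qed
  qed
  show "chain_q p z = chain_q p w \<longleftrightarrow> z - w \<in> {z. \<forall>T. card T = p \<longrightarrow> z T \<in> B}"
    if "z \<in> {z. \<forall>T. z T \<in> Z}" "w \<in> {z. \<forall>T. z T \<in> Z}" for z w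
    using that q_eq_iff by (auto simp: chain_q_def fun_eq_iff restrict_def)
  show "chain_q p 0 = \<zero>\<^bsub>koszul_module M p\<^esub>"
    by (simp add: chain_q_def koszul_module_def direct_sum_def q_0)
qed (auto simp: additive_subgroup_set_def Z_closed act_closed act_add q_add q_act chain_q_def koszul_module_def
   direct_sum_def fun_eq_iff)

lemma koszul_d_chain_q:
  assumes z: "\<And>T. z T \<in> Z"
  shows "koszul_d M \<phi> p (chain_q p z) = (\<lambda>T\<in>{T. Suc (card T) = p}. q (kdiff \<theta> z T))"
  unfolding koszul_d_def
proof (rule restrict_ext)
  fix T :: "'d set" assume T: "T \<in> {T. Suc (card T) = p}"
  have Z: "koszul_sign i T (\<theta> i (z (insert i T))) \<in> Z" for i
    by (intro koszul_sign_in Z_subgroup \<theta>_Z z)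
  have "q (kdiff \<theta> z T) = finsum M (\<lambda>i. q (koszul_sign i T (\<theta> i (z (insert i T))))) (- T)"
    unfolding kdiff_def by (rule q_sum) (auto intro: Z)
  also have "\<dots> = finsum M (\<lambda>i. if even (card {k\<in>T. k < i}) then \<phi> i (chain_q p z (insert i T))
                   else \<ominus>\<^bsub>M\<^esub> \<phi> i (chain_q p z (insert i T))) (- T)"
  proof (rule abelian_monoid.finsum_cong'[OF abelian_group.axioms(1)[OF abelian_group_quotient]])
    have eq: "q (koszul_sign i T (\<theta> i (z (insert i T)))) = (if even (card {k\<in>T. k < i}) then \<phi> i (chain_q p z (insert i T))
                   else \<ominus>\<^bsub>M\<^esub> \<phi> i (chain_q p z (insert i T)))" if "i \<in> - T" for i
    proof -
      have "chain_q p z (insert i T) = q (z (insert i T))" using T that by (simp add: chain_q_def)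
      then show ?thesis by (simp add: koszul_sign_def \<phi>_q z q_minus \<theta>_Z)
    qed
    then show "(\<lambda>i. if even (card {k\<in>T. k < i}) then \<phi> i (chain_q p z (insert i T))
                   else \<ominus>\<^bsub>M\<^esub> \<phi> i (chain_q p z (insert i T))) \<in> - T \<rightarrow> carrier M"
      using q_closed[OF Z] by (intro Pi_I) (simp only: eq[symmetric])
    fix i assume "i \<in> - T"
    then show "q (koszul_sign i T (\<theta> i (z (insert i T)))) = (if even (card {k\<in>T. k < i}) then \<phi> i (chain_q p z (insert i T))
                   else \<ominus>\<^bsub>M\<^esub> \<phi> i (chain_q p z (insert i T)))" by (rule eq)
  qed simp
  finally show "finsum M (\<lambda>i. if even (card {k\<in>T. k < i}) then \<phi> i (chain_q p z (insert i T))
                   else \<ominus>\<^bsub>M\<^esub> \<phi> i (chain_q p z (insert i T))) (- T) = q (kdiff \<theta> z T)" by simp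
qed

lemma q_eq_0_iff: "z \<in> Z \<Longrightarrow> q z = \<zero>\<^bsub>M\<^esub> \<longleftrightarrow> z \<in> B"
  using q_eq_iff[of z 0] Z_closed(1) by (simp add: q_0)

lemma koszul_cycles_eq: "koszul_cycles M \<phi> p = chain_q p ` cycles p"
proof -
  interpret K: presentation R "\<lambda>r z T. act r (z T)" "{z. \<forall>T. z T \<in> Z}" "{z. \<forall>T. card T = p \<longrightarrow> z T \<in> B}"
     "koszul_module M p" "chain_q p" by (rule chain_presentation)
  have "chain_q p z \<in> koszul_cycles M \<phi> p \<longleftrightarrow> z \<in> cycles p" if z: "\<And>T. z T \<in> Z" for z
    using z K.q_closed[of z] q_eq_0_iff[OF kdiff_Z[OF z]]
    by (auto simp: koszul_cycles_def koszul_d_chain_q[OF z] cycles_def fun_eq_iff restrict_def)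
  moreover have "koszul_cycles M \<phi> p \<subseteq> chain_q p ` {z. \<forall>T. z T \<in> Z}"
    using K.q_surj by (auto simp: koszul_cycles_def)
  moreover have "cycles p \<subseteq> {z. \<forall>T. z T \<in> Z}" by (auto simp: cycles_def)
  ultimately show ?thesis by blast
qed

text \<open>
  Cycles and boundaries of the Koszul complex of \<open>M\<close> are the images of those of \<open>Z\<close> modulo \<open>B\<close>, so the
  presentation of the chain module restricts to cycles and then passes to the quotient.
\<close>

lemma homology_presentation:
  "\<exists>h. presentation R (\<lambda>r z T. act r (z T)) (cycles p) (boundaries p) (koszul_homology M \<phi> p) h"
proof -
  let ?act = "\<lambda>r z T. act r (z T)"
  let ?K = "(koszul_module M p)\<lparr>carrier := koszul_cycles M \<phi> p\<rparr>"
  interpret K: presentation R ?act "{z. \<forall>T. z T \<in> Z}" "{z. \<forall>T. card T = p \<longrightarrow> z T \<in> B}"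
     "koszul_module M p" "chain_q p" by (rule chain_presentation)
  note Bs = subgroup_setD[OF B_subgroup]
  have sub: "cycles p \<subseteq> {z. \<forall>T. z T \<in> Z}" by (auto simp: cycles_def)
  have "presentation R ?act (cycles p) {z. \<forall>T. card T = p \<longrightarrow> z T \<in> B} ?K (chain_q p)"
  proof
    show "additive_subgroup_set (cycles p)"
      unfolding additive_subgroup_set_def
    proof (intro conjI ballI)
      show "0 \<in> cycles p" by (simp add: cycles_def kdiff_def Z_closed Bs)
      show "x - y \<in> cycles p" if "x \<in> cycles p" "y \<in> cycles p" for x y
        using that kdiff_diff[of x y] by (auto simp: cycles_def Z_closed Bs fun_diff_def)
    qed
    show "?act r z \<in> cycles p" if "r \<in> carrier R" "z \<in> cycles p" for r z
      using that by (auto simp: cycles_def act_closed act_kdiff B_act)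
    show "chain_q p ` cycles p = carrier ?K" by (simp add: koszul_cycles_eq)
    show "chain_q p z = chain_q p w \<longleftrightarrow> z - w \<in> {z. \<forall>T. card T = p \<longrightarrow> z T \<in> B}"
      if "z \<in> cycles p" "w \<in> cycles p" for z w
      using K.q_eq_iff[of z w] that sub by blast
  qed (use sub K.act_add K.q_0 K.q_add K.q_act in \<open>auto simp: subset_iff\<close>)
  then interpret L: presentation R ?act "cycles p" "{z. \<forall>T. card T = p \<longrightarrow> z T \<in> B}" ?K "chain_q p" .
  have bc: "boundaries p \<subseteq> cycles p"
  proof
    fix z assume "z \<in> boundaries p"
    then obtain w where z: "\<And>T. z T \<in> Z" and w: "\<And>T. w T \<in> Z" "\<And>T. card T = p \<Longrightarrow> z T - kdiff \<theta> w T \<in> B"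
      unfolding boundaries_def by blast
    have "kdiff \<theta> z T \<in> B" if "Suc (card T) = p" for T
    proof -
      have "kdiff \<theta> (\<lambda>T. z T - kdiff \<theta> w T) T \<in> B"
        using that by (intro kdiff_in B_subgroup \<theta>_B w(2)) auto
      then show ?thesis using kdiff_diff[of z "kdiff \<theta> w" T] by (simp add: kdiff_kdiff)
    qed
    then show "z \<in> cycles p" using z by (simp add: cycles_def)
  qed
  have im: "koszul_d M \<phi> (Suc p) ` carrier (koszul_module M (Suc p)) = chain_q p ` boundaries p"
  proof -
    interpret K': presentation R ?act "{z. \<forall>T. z T \<in> Z}" "{z. \<forall>T. card T = Suc p \<longrightarrow> z T \<in> B}"
      "koszul_module M (Suc p)" "chain_q (Suc p)" by (rule chain_presentation)
    have d: "koszul_d M \<phi> (Suc p) (chain_q (Suc p) w) = chain_q p (kdiff \<theta> w)" if "\<And>T. w T \<in> Z" for w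
      using koszul_d_chain_q[of w "Suc p", OF that] by (simp add: chain_q_def)
    have "chain_q p (kdiff \<theta> w) \<in> chain_q p ` boundaries p" if w: "\<And>T. w T \<in> Z" for w
      using w kdiff_Z[of w] Bs(1) by (intro imageI) (auto simp: boundaries_def intro!: exI[of _ w])
    moreover have "chain_q p z \<in> koszul_d M \<phi> (Suc p) ` carrier (koszul_module M (Suc p))" if zb: "z \<in> boundaries p" for z
    proof -
      obtain w where z: "\<And>T. z T \<in> Z" and w: "\<And>T. w T \<in> Z" "\<And>T. card T = p \<Longrightarrow> z T - kdiff \<theta> w T \<in> B"
        using zb unfolding boundaries_def by blast
      then have "chain_q p z = chain_q p (kdiff \<theta> w)"
        using K.q_eq_iff[of z "kdiff \<theta> w"] kdiff_Z[of w] by simp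
      also have "\<dots> = koszul_d M \<phi> (Suc p) (chain_q (Suc p) w)" using d w(1) by simp
      finally show ?thesis using K'.q_closed[of w] w(1) by simp
    qed
    ultimately show ?thesis using d by (auto simp: K'.q_surj[symmetric])
  qed
  have "presentation R ?act (cycles p) (boundaries p) (quot_module ?K (chain_q p ` boundaries p))
     (\<lambda>z. (chain_q p ` boundaries p) +>\<^bsub>?K\<^esub> chain_q p z)"
  proof (rule L.quotient[OF bc])
    show "additive_subgroup_set (boundaries p)"
      unfolding additive_subgroup_set_def
    proof (intro conjI ballI)
      show "0 \<in> boundaries p"
        unfolding boundaries_def using Z_closed Bs by (auto intro!: exI[of _ "\<lambda>_. 0"] simp: kdiff_def)
      fix x y assume "x \<in> boundaries p" "y \<in> boundaries p"
      then obtain v w where "\<And>T. x T \<in> Z" "\<And>T. y T \<in> Z" "\<And>T. v T \<in> Z" "\<And>T. w T \<in> Z"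
        and vw: "\<And>T. card T = p \<Longrightarrow> x T - kdiff \<theta> v T \<in> B" "\<And>T. card T = p \<Longrightarrow> y T - kdiff \<theta> w T \<in> B"
        unfolding boundaries_def by blast
      moreover have "(x - y) T - kdiff \<theta> (\<lambda>T. v T - w T) T \<in> B" if "card T = p" for T
        using Bs(2)[OF vw(1)[OF that] vw(2)[OF that]] by (simp add: kdiff_diff algebra_simps)
      ultimately show "x - y \<in> boundaries p"
        unfolding boundaries_def using Z_closed by (auto intro!: exI[of _ "\<lambda>T. v T - w T"])
    qed
    show "{z. \<forall>T. card T = p \<longrightarrow> z T \<in> B} \<inter> cycles p \<subseteq> boundaries p"
      using Z_closed(1) by (auto simp: boundaries_def cycles_def kdiff_def intro!: exI[of _ "\<lambda>_. 0"])
    show "?act r b \<in> boundaries p" if r: "r \<in> carrier R" and b: "b \<in> boundaries p" for r b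
    proof -
      obtain w where z: "\<And>T. b T \<in> Z" and w: "\<And>T. w T \<in> Z" "\<And>T. card T = p \<Longrightarrow> b T - kdiff \<theta> w T \<in> B"
        using b unfolding boundaries_def by blast
      have "act r (b T) - kdiff \<theta> (\<lambda>T. act r (w T)) T \<in> B" if "card T = p" for T
      proof -
        have "act r (b T - kdiff \<theta> w T + kdiff \<theta> w T) = act r (b T - kdiff \<theta> w T) + act r (kdiff \<theta> w T)"
          using z w(1) kdiff_Z[of w] Z_closed(2) by (intro act_add r) auto
        then have "act r (b T) - act r (kdiff \<theta> w T) = act r (b T - kdiff \<theta> w T)" by simp
        then show ?thesis using B_act[OF r w(2)[OF that]] act_kdiff[OF r w(1)] by simp
      qed
      then show ?thesis unfolding boundaries_def using act_closed[OF r] z w(1) by (auto intro!: exI[of _ "\<lambda>T. act r (w T)"])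
    qed
  qed simp
  then show ?thesis unfolding koszul_homology_def im by blast
qed

end

section \<open>Dickson's lemma\<close>

text \<open>
  There always is a monotone subsequence, and a decreasing one is constant from some index on.
\<close>

lemma nat_sequence_incseq_subseq:
  fixes f :: "nat \<Rightarrow> nat"
  shows "\<exists>r. strict_mono r \<and> incseq (f \<circ> r)"
proof -
  obtain r where r: "strict_mono r" "monoseq (f \<circ> r)"
    using seq_monosub[of f] by (auto simp: o_def)
  show ?thesis
  proof (cases "incseq (f \<circ> r)")
    case False
    then have dec: "decseq (f \<circ> r)" using r(2) by (auto simp: monoseq_iff)
    obtain m where m: "\<And>k. (f \<circ> r) m \<le> (f \<circ> r) k"
      using ex_has_least_nat[of "\<lambda>_. True" 0 "f \<circ> r"] by auto
    have "f (r (m + k)) = f (r m)" for k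
      using m[of "m + k"] decseqD[OF dec, of m "m + k"] by simp
    then have "incseq (f \<circ> (\<lambda>k. r (m + k)))" by (simp add: incseq_def)
    moreover have "strict_mono (\<lambda>k. r (m + k))" using r(1) by (auto simp: strict_mono_def)
    ultimately show ?thesis by (intro exI[of _ "\<lambda>k. r (m + k)"] conjI)
  qed (use r in blast)
qed

text \<open>
  Passing to subsequences for one variable after the other makes all exponents increasing.
\<close>

lemma dickson:
  fixes u :: "nat \<Rightarrow> ('n::finite \<Rightarrow>\<^sub>0 nat)"
  shows "\<exists>i k. i < k \<and> (\<forall>j. Poly_Mapping.lookup (u i) j \<le> Poly_Mapping.lookup (u k) j)"
proof -
  have "\<exists>r. strict_mono r \<and> (\<forall>j\<in>J. incseq (\<lambda>k. Poly_Mapping.lookup (u (r k)) j))" if "finite J" for J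
    using that
  proof induction
    case empty
    show ?case by (intro exI[of _ id]) (auto simp: strict_mono_def)
  next
    case (insert j J)
    then obtain r where r: "strict_mono r" "\<forall>j\<in>J. incseq (\<lambda>k. Poly_Mapping.lookup (u (r k)) j)" by blast
    obtain s where s: "strict_mono s" "incseq (\<lambda>k. Poly_Mapping.lookup (u (r (s k))) j)"
      using nat_sequence_incseq_subseq[of "\<lambda>k. Poly_Mapping.lookup (u (r k)) j"] by (auto simp: o_def)
    have "incseq (\<lambda>k. Poly_Mapping.lookup (u (r (s k))) i)" if "i \<in> J" for i
      using r(2) that s(1) by (auto simp: incseq_def strict_mono_less_eq)
    then show ?case using s(2) by (intro exI[of _ "r \<circ> s"] conjI strict_mono_o r(1) s(1)) auto
  qed
  from this[OF finite[of UNIV]] obtain r where r: "strict_mono r" "\<And>j. incseq (\<lambda>k. Poly_Mapping.lookup (u (r k)) j)" by blast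
  have "r 0 < r 1" using r(1) by (simp add: strict_mono_def)
  moreover have "Poly_Mapping.lookup (u (r 0)) j \<le> Poly_Mapping.lookup (u (r 1)) j" for j
    using incseqD[OF r(2), of 0 1 j] by simp
  ultimately show ?thesis by blast
qed

section \<open>A monomial order\<close>

text \<open>
  An arbitrary enumeration of the variables, whose index type carries no order.  Repetitions would do no
  harm.
\<close>

definition var_list :: "'n::finite list" where
  "var_list = (SOME xs. set xs = UNIV)"

lemma set_var_list: "set (var_list :: 'n::finite list) = UNIV"
  unfolding var_list_def by (rule someI_ex) (simp add: finite_list)

definition exponents :: "('n::finite \<Rightarrow>\<^sub>0 nat) \<Rightarrow> nat list" where
  "exponents u = map (Poly_Mapping.lookup u) var_list"

text \<open>
  The lexicographic order.  The relation \<open>lex\<close> compares lists of equal length, on which it is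
  well-founded.
\<close>

definition mono_less :: "('n::finite \<Rightarrow>\<^sub>0 nat) \<Rightarrow> ('n \<Rightarrow>\<^sub>0 nat) \<Rightarrow> bool" where
  "mono_less u v \<longleftrightarrow> (exponents u, exponents v) \<in> lex less_than"

lemma exponents_inj: "exponents u = exponents v \<Longrightarrow> u = v"
  using set_var_list by (intro poly_mapping_eqI) (auto simp: exponents_def)

lemma mono_less_wf: "wf {(u, v). mono_less u v}"
  using wf_inv_image[OF wf_lex[OF wf_less_than], of exponents] by (simp add: mono_less_def inv_image_def)

lemma mono_less_total: "u \<noteq> v \<Longrightarrow> mono_less u v \<or> mono_less v u"
proof -
  have "xs = ys \<or> (xs, ys) \<in> lex less_than \<or> (ys, xs) \<in> lex less_than" if "length xs = length ys" for xs ys :: "nat list"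
    using that by (induction xs ys rule: list_induct2) (auto simp: Cons_in_lex)
  then show "u \<noteq> v \<Longrightarrow> ?thesis"
    unfolding mono_less_def using exponents_inj[of u v] by (metis exponents_def length_map)
qed

lemma mono_less_add:
  assumes "mono_less u v" shows "mono_less (w + u) (w + v)"
proof -
  have "(xs, ys) \<in> lex less_than \<Longrightarrow> (map2 (+) zs xs, map2 (+) zs ys) \<in> lex less_than"
    if "length zs = length xs" "length xs = length ys" for zs xs ys :: "nat list"
    using that by (induction zs xs ys rule: list_induct3) (auto simp: Cons_in_lex)
  moreover have "exponents (w + u) = map2 (+) (exponents w) (exponents u)" for u :: "'a \<Rightarrow>\<^sub>0 nat"
    by (simp add: exponents_def lookup_add map2_map_map)
  ultimately show ?thesis using assms unfolding mono_less_def by (simp add: exponents_def)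
qed

lemma mono_less_trans: "mono_less u v \<Longrightarrow> mono_less v w \<Longrightarrow> mono_less u w"
  unfolding mono_less_def by (rule transD[OF lex_transI[OF trans_less_than]])

definition leading :: "'n::finite cpoly \<Rightarrow> ('n \<Rightarrow>\<^sub>0 nat) \<Rightarrow> bool" where
  "leading f u \<longleftrightarrow> u \<in> Poly_Mapping.keys f \<and> (\<forall>v\<in>Poly_Mapping.keys f. v = u \<or> mono_less v u)"

lemma leading_exists:
  assumes "f \<noteq> 0" shows "\<exists>u. leading f u"
proof -
  have "\<exists>u\<in>K. \<forall>v\<in>K. v = u \<or> mono_less v u" if "finite K" "K \<noteq> {}" for K :: "('a \<Rightarrow>\<^sub>0 nat) set"
    using that
  proof (induction rule: finite_ne_induct)
    case (insert x K)
    then obtain u where u: "u \<in> K" "\<forall>v\<in>K. v = u \<or> mono_less v u" by blast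
    show ?case
    proof (cases "mono_less u x")
      case True
      have "v = x \<or> mono_less v x" if "v \<in> insert x K" for v
        using that u(2) mono_less_trans[OF _ True] True by auto
      then show ?thesis by blast
    next
      case False
      then have "x = u \<or> mono_less x u" using mono_less_total[of u x] by blast
      then show ?thesis using u by blast
    qed
  qed simp
  from this[of "Poly_Mapping.keys f"] show ?thesis unfolding leading_def using assms by auto
qed

lemma leading_monomial_mult:
  assumes "leading f u" "c \<noteq> 0"
  shows "leading (monomial w c * f) (w + u)" "Poly_Mapping.lookup (monomial w c * f) (w + u) = c * Poly_Mapping.lookup f u"
proof -
  have l: "Poly_Mapping.lookup (monomial w c * f) (w + v) = c * Poly_Mapping.lookup f v" for v
  proof -
    have "monomial w c * f = (\<Sum>k\<in>Poly_Mapping.keys f. monomial (w + k) (c * Poly_Mapping.lookup f k))"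
    proof -
      have "monomial w c * f = monomial w c * (\<Sum>k\<in>Poly_Mapping.keys f. monomial k (Poly_Mapping.lookup f k))"
        by (simp only: poly_mapping_sum_single)
      then show ?thesis by (simp only: sum_distrib_left mult_single)
    qed
    then show ?thesis
      by (auto simp: lookup_sum lookup_single when_def in_keys_iff sum.delta[OF finite_keys] cong: if_cong)
  qed
  show "Poly_Mapping.lookup (monomial w c * f) (w + u) = c * Poly_Mapping.lookup f u" by (rule l)
  show "leading (monomial w c * f) (w + u)"
    unfolding leading_def
  proof (intro conjI ballI)
    show "w + u \<in> Poly_Mapping.keys (monomial w c * f)"
      using assms by (simp add: in_keys_iff l leading_def)
    fix v assume "v \<in> Poly_Mapping.keys (monomial w c * f)"
    then obtain v' where "v = w + v'" "v' \<in> Poly_Mapping.keys f" using keys_mult[of "monomial w c" f] assms(2) by auto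
    then show "v = w + u \<or> mono_less v (w + u)" using assms(1) mono_less_add[of v' u w] unfolding leading_def by auto
  qed
qed

lemma leading_cancel:
  assumes f: "leading f u" and g: "leading g u" and c: "Poly_Mapping.lookup f u = Poly_Mapping.lookup g u"
    and h: "leading (f - g) v"
  shows "mono_less v u"
proof -
  have "v \<in> Poly_Mapping.keys (f - g)" using h by (simp add: leading_def)
  then have "v \<noteq> u" "v \<in> Poly_Mapping.keys f \<union> Poly_Mapping.keys g"
    using c by (auto simp: in_keys_iff lookup_minus)
  then show ?thesis using f g unfolding leading_def by blast
qed

section \<open>Ascending chains of ideals and finiteness of associated primes\<close>

text \<open>
  Hilbert's basis theorem.  If all inclusions were strict, choose for each \<open>m\<close> an element \<open>f m\<close> of
  \<open>K (Suc m)\<close> outside of \<open>K m\<close> with the smallest possible leading exponent \<open>u m\<close>.  By Dickson's lemma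
  \<open>u i \<le> u k\<close> for some \<open>i < k\<close>.  Cancelling the leading term of \<open>f k\<close> by a multiple of \<open>f i\<close>, which lies
  in \<open>K k\<close>, gives an element with a smaller leading exponent.
\<close>

lemma ideal_chain_stabilizes:
  fixes K :: "nat \<Rightarrow> 'n::finite cpoly set"
  assumes K: "\<And>m. poly_ideal (K m)" and mono: "\<And>m. K m \<subseteq> K (Suc m)"
  shows "\<exists>m. K (Suc m) = K m"
proof (rule ccontr)
  assume "\<nexists>m. K (Suc m) = K m"
  then have proper: "K (Suc m) - K m \<noteq> {}" for m using mono[of m] by blast
  have K_mono: "K i \<subseteq> K k" if "i \<le> k" for i k using mono that by (rule lift_Suc_mono_le)
  define minimal where "minimal m f u \<longleftrightarrow> f \<in> K (Suc m) - K m \<and> leading f u \<and>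
      (\<forall>g v. g \<in> K (Suc m) - K m \<and> leading g v \<longrightarrow> \<not> mono_less v u)" for m f u
  have "\<exists>f u. minimal m f u" for m
  proof -
    let ?U = "{u. \<exists>f \<in> K (Suc m) - K m. leading f u}"
    obtain f where f: "f \<in> K (Suc m) - K m" using proper by blast
    then have "f \<noteq> 0" using subgroup_setD(1)[OF poly_idealD(1)[OF K]] by auto
    then obtain u0 where "u0 \<in> ?U" using leading_exists f by blast
    have "\<exists>u\<in>?U. \<forall>v. (v, u) \<in> {(u, v). mono_less u v} \<longrightarrow> v \<notin> ?U"
      by (rule mono_less_wf[unfolded wf_eq_minimal, rule_format, OF \<open>u0 \<in> ?U\<close>])
    then obtain u where u: "u \<in> ?U" "\<And>v. mono_less v u \<Longrightarrow> v \<notin> ?U" by auto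
    from u(1) obtain h where h: "h \<in> K (Suc m) - K m" "leading h u" by blast
    moreover have "\<not> mono_less v u" if "g \<in> K (Suc m) - K m" "leading g v" for g v
      using u(2)[of v] that by blast
    ultimately show ?thesis unfolding minimal_def by blast
  qed
  then obtain f u where "\<And>m. minimal m (f m) (u m)" by metis
  then have fu: "\<And>m. f m \<in> K (Suc m) - K m" "\<And>m. leading (f m) (u m)"
    "\<And>m g v. g \<in> K (Suc m) - K m \<Longrightarrow> leading g v \<Longrightarrow> \<not> mono_less v (u m)"
    unfolding minimal_def by blast+
  obtain i k where ik: "i < k" "\<And>j. Poly_Mapping.lookup (u i) j \<le> Poly_Mapping.lookup (u k) j" using dickson[of u] by blast
  define w where "w = u k - u i"
  have w: "w + u i = u k" unfolding w_def using ik(2) by (intro poly_mapping_eqI) (simp add: lookup_add lookup_minus)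
  define c where "c = Poly_Mapping.lookup (f k) (u k) / Poly_Mapping.lookup (f i) (u i)"
  have nz: "Poly_Mapping.lookup (f m) (u m) \<noteq> 0" for m using fu(2)[of m] by (simp add: leading_def in_keys_iff)
  \<comment> \<open>The leading terms cancel; and \<open>g\<close> is new in step \<open>k\<close>, like \<open>f k\<close>.\<close>
  define g where "g = f k - monomial w c * f i"
  have "monomial w c * f i \<in> K k"
    using fu(1)[of i] K_mono[of "Suc i" k] ik(1) poly_idealD(2)[OF K] by auto
  then have g: "g \<in> K (Suc k) - K k"
    using fu(1)[of k] mono[of k] subgroup_setD(2)[OF poly_idealD(1)[OF K]] subgroup_setD(4)[OF poly_idealD(1)[OF K[of k]], of g "monomial w c * f i"]
    by (auto simp: g_def)
  then have "g \<noteq> 0" using subgroup_setD(1)[OF poly_idealD(1)[OF K]] by auto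
  then obtain v where v: "leading g v" using leading_exists by blast
  have "leading (monomial w c * f i) (u k)" "Poly_Mapping.lookup (monomial w c * f i) (u k) = Poly_Mapping.lookup (f k) (u k)"
    using leading_monomial_mult[OF fu(2)[of i], of c w] nz[of i] nz[of k] by (auto simp: w c_def)
  then have "mono_less v (u k)" using leading_cancel[OF fu(2) _ _ v[unfolded g_def]] by simp
  then show False using fu(3)[OF g v] by blast
qed

lemma ideal_set_has_maximal:
  assumes "\<And>Q. Q \<in> S \<Longrightarrow> poly_ideal (Q :: 'n::finite cpoly set)" "S \<noteq> {}"
  shows "\<exists>Q\<in>S. \<forall>Q'\<in>S. Q \<subseteq> Q' \<longrightarrow> Q' = Q"
proof (rule ccontr)
  assume "\<not> ?thesis"
  then have step: "\<forall>Q\<in>S. \<exists>Q'\<in>S. Q \<subset> Q'" by blast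
  obtain Q0 where "Q0 \<in> S" using assms(2) by blast
  obtain K where K: "\<And>m. K m \<in> S \<and> K m \<subset> K (Suc m)"
    using dependent_nat_choice[of "\<lambda>_ Q. Q \<in> S" "\<lambda>_ Q Q'. Q \<subset> Q'"] \<open>Q0 \<in> S\<close> step by metis
  then show False using ideal_chain_stabilizes[of K] assms(1) by blast
qed

text \<open>
  Let \<open>Q = (I : f\<^sub>Q)\<close> for each associated prime \<open>Q\<close>.  If there were infinitely many, one could pick
  successively a maximal one among those not yet picked; then no prime is contained in one that is
  picked later.  The ideals generated by \<open>I\<close> and the first \<open>m\<close> of the elements \<open>f\<^sub>Q\<close> become stationary,
  say \<open>f\<^sub>P\<close> is congruent modulo \<open>I\<close> to a combination of earlier \<open>f\<^sub>Q\<close>.  A product of elements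
  \<open>g\<^sub>Q \<in> Q - P\<close> over the earlier \<open>Q\<close> kills all these, so it lies in \<open>(I : f\<^sub>P) = P\<close>, contradicting
  primality.
\<close>

lemma finite_assoc_primes:
  fixes I :: "'n::finite cpoly set"
  assumes I: "poly_ideal I"
  shows "finite (assoc_primes I)"
proof (rule ccontr)
  assume inf: "infinite (assoc_primes I)"
  have primeideal: "primeideal Q poly_ring" if "Q \<in> assoc_primes I" for Q
    using that unfolding assoc_primes_def by blast
  have ideal: "poly_ideal Q" if "Q \<in> assoc_primes I" for Q
    using primeideal.axioms(1)[OF primeideal[OF that]] by (simp only: ideal_poly_ring_iff)
  have prime: "g \<in> Q \<or> h \<in> Q" if "Q \<in> assoc_primes I" "g * h \<in> Q" for Q g h
    using primeideal.I_prime[OF primeideal[OF that(1)], of g h] that(2) by (simp add: poly_ring_def)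
  have proper: "1 \<notin> Q" if "Q \<in> assoc_primes I" for Q
  proof
    assume "1 \<in> Q"
    then have "Q = UNIV" using poly_idealD(2)[OF ideal[OF that], of 1] by auto
    then show False using primeideal.I_notcarr[OF primeideal[OF that]] by (simp add: poly_ring_def)
  qed
  define f where "f Q = (SOME f. Q = {g. g * f \<in> I})" for Q
  have f: "g \<in> Q \<longleftrightarrow> g * f Q \<in> I" if "Q \<in> assoc_primes I" for Q g
  proof -
    have "\<exists>f. Q = {g. g * f \<in> I}" using that unfolding assoc_primes_def by blast
    from someI_ex[OF this] have "Q = {g. g * f Q \<in> I}" unfolding f_def .
    then show ?thesis by blast
  qed
  define rest where "rest = (\<lambda>F. assoc_primes I - F)"
  have "\<exists>Q. Q \<in> rest F \<and> (\<forall>Q'\<in>rest F. Q \<subseteq> Q' \<longrightarrow> Q' = Q)" if "finite F" for F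
  proof -
    have "infinite (rest F)" unfolding rest_def using that inf by (rule Diff_infinite_finite)
    then have "rest F \<noteq> {}" by auto
    moreover have "poly_ideal Q" if "Q \<in> rest F" for Q using that ideal unfolding rest_def by blast
    ultimately show ?thesis using ideal_set_has_maximal[of "rest F"] by blast
  qed
  then obtain pick where pick: "\<And>F. finite F \<Longrightarrow> pick F \<in> rest F"
    "\<And>F Q'. finite F \<Longrightarrow> Q' \<in> rest F \<Longrightarrow> pick F \<subseteq> Q' \<Longrightarrow> Q' = pick F" by metis
  define F where "F = rec_nat {} (\<lambda>_ F. insert (pick F) F)"
  have F_Suc: "F (Suc m) = insert (pick (F m)) (F m)" and F_0: "F 0 = {}" for m by (simp_all add: F_def)
  have finF: "finite (F m)" for m by (induction m) (auto simp: F_Suc F_0)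
  have subF: "F m \<subseteq> assoc_primes I" for m
    using pick(1)[OF finF] by (induction m) (auto simp: F_Suc F_0 rest_def)
  have F_mono: "F i \<subseteq> F k" if "i \<le> k" for i k
  proof (rule lift_Suc_mono_le[OF _ that])
    show "F m \<subseteq> F (Suc m)" for m unfolding F_Suc by blast
  qed
  have pick_in: "pick (F i) \<in> F (Suc i)" for i unfolding F_Suc by blast
  have in_F: "\<exists>i<m. Q = pick (F i)" if "Q \<in> F m" for Q m
    using that
  proof (induction m)
    case (Suc m)
    then show ?case unfolding F_Suc using less_Suc_eq by blast
  qed (simp add: F_0)
  have notsub: "\<not> Q \<subseteq> pick (F m)" if QF: "Q \<in> F m" for Q m
  proof
    assume sub: "Q \<subseteq> pick (F m)"
    obtain i where i: "i < m" "Q = pick (F i)" using in_F[OF QF] by blast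
    have new: "pick (F m) \<in> rest (F m)" by (rule pick(1)[OF finF])
    then have "pick (F m) \<in> rest (F i)" using F_mono[of i m] i(1) unfolding rest_def by auto
    then have "pick (F m) = Q" using pick(2)[OF finF, of "pick (F m)" i] sub i(2) by auto
    then show False using new QF unfolding rest_def by simp
  qed
  \<comment> \<open>The ideal generated by \<open>I\<close> and the elements \<open>f Q\<close> of the primes picked so far.\<close>
  define K where "K = (\<lambda>m. {g. \<exists>a. g - (\<Sum>Q\<in>F m. a Q * f Q) \<in> I})"
  note sI = subgroup_setD[OF poly_idealD(1)[OF I]] and mI = poly_idealD(2)[OF I]
  have Kid: "poly_ideal (K m)" for m
    unfolding poly_ideal_def additive_subgroup_set_def
  proof (intro conjI ballI allI)
    show "0 \<in> K m" unfolding K_def using sI(1) by (auto intro!: exI[of _ "\<lambda>_. 0"])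
    fix x assume "x \<in> K m"
    then obtain a where a: "x - (\<Sum>Q\<in>F m. a Q * f Q) \<in> I" unfolding K_def by blast
    show "r * x \<in> K m" for r
      unfolding K_def using mI[OF a, of r]
      by (auto intro!: exI[of _ "\<lambda>Q. r * a Q"] simp: right_diff_distrib sum_distrib_left mult.assoc)
    fix y assume "y \<in> K m"
    then obtain b where b: "y - (\<Sum>Q\<in>F m. b Q * f Q) \<in> I" unfolding K_def by blast
    have "x - y - (\<Sum>Q\<in>F m. (a Q - b Q) * f Q) \<in> I"
      using sI(2)[OF a b] by (simp add: left_diff_distrib sum_subtractf algebra_simps)
    then show "x - y \<in> K m" unfolding K_def by (auto intro!: exI[of _ "\<lambda>Q. a Q - b Q"])
  qed
  have Kmono: "K m \<subseteq> K (Suc m)" for m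
  proof
    fix x assume "x \<in> K m"
    then obtain a where a: "x - (\<Sum>Q\<in>F m. a Q * f Q) \<in> I" unfolding K_def by blast
    have "pick (F m) \<notin> F m" using pick(1)[OF finF] by (auto simp: rest_def)
    then have "(\<Sum>Q\<in>F (Suc m). (if Q = pick (F m) then 0 else a Q) * f Q) = (\<Sum>Q\<in>F m. a Q * f Q)"
      using finF by (auto simp: F_Suc intro!: sum.cong)
    then show "x \<in> K (Suc m)" unfolding K_def using a by (auto intro!: exI[of _ "\<lambda>Q. if Q = pick (F m) then 0 else a Q"])
  qed
  obtain m where m: "K (Suc m) = K m" using ideal_chain_stabilizes[of K] Kid Kmono by blast
  let ?P = "pick (F m)"
  have P: "?P \<in> assoc_primes I" "?P \<notin> F m" using pick(1)[OF finF] by (auto simp: rest_def)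
  have "f ?P \<in> K (Suc m)"
  proof -
    have "(\<Sum>Q\<in>F (Suc m). (if Q = ?P then 1 else 0) * f Q) = f ?P + (\<Sum>Q\<in>F m. (if Q = ?P then 1 else 0) * f Q)"
      using finF P(2) by (simp add: F_Suc)
    also have "(\<Sum>Q\<in>F m. (if Q = ?P then 1 else 0) * f Q) = 0" using P(2) by (intro sum.neutral) auto
    finally show ?thesis unfolding K_def using sI(1) by (auto intro!: exI[of _ "\<lambda>Q. if Q = ?P then 1 else 0"])
  qed
  then have "f ?P \<in> K m" by (simp only: m)
  then obtain a where a: "f ?P - (\<Sum>Q\<in>F m. a Q * f Q) \<in> I" unfolding K_def by blast
  have "\<exists>g. g \<in> Q \<and> g \<notin> ?P" if "Q \<in> F m" for Q using notsub[OF that] by blast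
  then obtain g where g: "\<And>Q. Q \<in> F m \<Longrightarrow> g Q \<in> Q" "\<And>Q. Q \<in> F m \<Longrightarrow> g Q \<notin> ?P" by metis
  let ?G = "\<Prod>Q\<in>F m. g Q"
  have "?G * (a Q * f Q) \<in> I" if "Q \<in> F m" for Q
  proof -
    have "g Q * f Q \<in> I" using g(1)[OF that] f[of Q "g Q"] subF that by blast
    then have "(a Q * (\<Prod>Q'\<in>F m - {Q}. g Q')) * (g Q * f Q) \<in> I" by (rule mI)
    then show ?thesis using prod.remove[OF finF that, of g] by (simp add: mult_ac)
  qed
  then have G1: "?G * (\<Sum>Q\<in>F m. a Q * f Q) \<in> I"
    unfolding sum_distrib_left by (intro subgroup_set_sum[OF poly_idealD(1)[OF I]])
  then have "?G * f ?P \<in> I"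
    using sI(4)[OF mI[OF a, of ?G] G1] by (simp add: right_diff_distrib)
  then have "?G \<in> ?P" using f[OF P(1)] by blast
  moreover have "(\<Prod>Q\<in>F'. g Q) \<notin> ?P" if "finite F'" "F' \<subseteq> F m" for F'
    using that
  proof induction
    case empty then show ?case using proper[OF P(1)] by simp
  next
    case (insert Q F')
    then show ?case using prime[OF P(1), of "g Q" "prod g F'"] g(2)[of Q] by auto
  qed
  ultimately show False using finF by blast
qed

section \<open>Presentations of the cyclic modules\<close>

lemma presentation_regular_poly: "presentation poly_ring (*) UNIV {0} (regular_module poly_ring) id"
  by standard (auto simp: regular_module_def poly_ring_def additive_subgroup_set_def algebra_simps)

lemma presentation_poly_quot:
  fixes C :: "'n cpoly set"
  assumes "poly_ideal C"
  shows "presentation poly_ring (*) UNIV C (poly_quot C) (\<lambda>f. C +>\<^bsub>regular_module poly_ring\<^esub> f)"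
proof -
  interpret presentation "poly_ring :: 'n cpoly ring" "(*)" UNIV "{0}" "regular_module poly_ring" id
    by (rule presentation_regular_poly)
  show ?thesis
    using quotient[of C C] poly_idealD[OF assms] subgroup_setD(1)[OF poly_idealD(1)[OF assms]]
    unfolding poly_quot_def by simp
qed

lemma presentation_regular_weyl: "presentation weyl (\<circ>) weyl_ops {0} (regular_module weyl) id"
  by standard
    (auto simp: regular_module_def weyl_ops_subgroup weyl_ops.comp weyl_ops_comp_add)

lemma
  fixes A :: "int^'n::finite^'d::{finite,linorder}"
  shows left_stable_H_ideal: "left_stable (H_ideal A C \<beta>)"
  and H_ideal_iff: "P \<in> H_ideal A C \<beta> \<longleftrightarrow> (\<exists>w. (\<forall>T. w T \<in> weyl_ops) \<and> P - kdiff (right_euler A \<beta>) w {} \<in> weyl_ext C)"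
proof -
  let ?E = "left_ideal_generated weyl (range (euler_op A \<beta>))"
  have rE: "range (euler_op A \<beta>) \<subseteq> weyl_ops" using euler_op_in_weyl by blast
  have E: "left_stable ?E" by (rule left_ideal_generated_props(1)[OF rE])
  have H: "H_ideal A C \<beta> = {x + y |x y. x \<in> weyl_ext C \<and> y \<in> ?E}"
    unfolding H_ideal_def weyl_ext_def set_add_def' by auto
  note sC = subgroup_setD[OF weyl_extD(1)[of C]] and sE = subgroup_setD[OF left_stable_def[THEN iffD1, OF E, THEN conjunct2, THEN conjunct1]]
  have Ew: "y \<in> weyl_ops" and Ec: "P \<in> weyl_ops \<Longrightarrow> P \<circ> y \<in> ?E" if "y \<in> ?E" for y P
    using E that unfolding left_stable_def by blast+
  show "left_stable (H_ideal A C \<beta>)"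
    unfolding left_stable_def additive_subgroup_set_def
  proof (intro conjI ballI)
    show "H_ideal A C \<beta> \<subseteq> weyl_ops" unfolding H using weyl_extD(2) Ew weyl_ops_plus by blast
    show "0 \<in> H_ideal A C \<beta>" unfolding H mem_Collect_eq using sC(1) sE(1) by (intro exI[of _ 0]) simp
    fix a assume "a \<in> H_ideal A C \<beta>"
    then obtain x y where a: "a = x + y" "x \<in> weyl_ext C" "y \<in> ?E" unfolding H by blast
    {
      fix b assume "b \<in> H_ideal A C \<beta>"
      then obtain x' y' where b: "b = x' + y'" "x' \<in> weyl_ext C" "y' \<in> ?E" unfolding H by blast
      have "a - b = (x - x') + (y - y')" by (simp add: a b)
      then show "a - b \<in> H_ideal A C \<beta>" unfolding H using sC(2)[OF a(2) b(2)] sE(2)[OF a(3) b(3)] by blast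
    next
      fix P :: "'n cpoly \<Rightarrow> 'n cpoly" assume P: "P \<in> weyl_ops"
      have "P \<circ> a = (P \<circ> x) + (P \<circ> y)" unfolding a by (rule weyl_ops_comp_add[OF P])
      then show "P \<circ> a \<in> H_ideal A C \<beta>" unfolding H using weyl_extD(3)[OF a(2) P] Ec[OF a(3) P] by blast
    }
  qed
  let ?K = "{kdiff (right_euler A \<beta>) w {} |w. \<forall>T. w T \<in> weyl_ops}"
  have kd: "kdiff (right_euler A \<beta>) w {} = (\<Sum>i\<in>UNIV. w {i} \<circ> euler_op A \<beta> i)" for w
    by (simp add: kdiff_def koszul_sign_def right_euler_def)
  have EK: "?E = ?K"
  proof
    show "?E \<subseteq> ?K"
    proof (rule left_ideal_generated_least[OF rE])
      interpret commuting_endos "right_euler A \<beta>" by (rule right_euler_endos)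
      show "left_stable ?K"
        unfolding left_stable_def additive_subgroup_set_def
      proof (intro conjI ballI subsetI)
        fix x assume "x \<in> ?K"
        then obtain w where w: "x = kdiff (right_euler A \<beta>) w {}" "\<And>T. w T \<in> weyl_ops" by blast
        show "x \<in> weyl_ops" unfolding w(1) kd
          by (intro subgroup_set_sum[OF weyl_ops_subgroup] weyl_ops.comp w(2) euler_op_in_weyl)
        {
          fix y assume "y \<in> ?K"
          then obtain v where v: "y = kdiff (right_euler A \<beta>) v {}" "\<And>T. v T \<in> weyl_ops" by blast
          have "x - y = kdiff (right_euler A \<beta>) (\<lambda>T. w T - v T) {}" by (simp add: w v kdiff_diff)
          then show "x - y \<in> ?K" using w(2) v(2) subgroup_setD(2)[OF weyl_ops_subgroup] by blast
        next
          fix P :: "'n cpoly \<Rightarrow> 'n cpoly" assume P: "P \<in> weyl_ops"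
          have "P \<circ> x = kdiff (right_euler A \<beta>) (\<lambda>T. P \<circ> w T) {}"
            unfolding w kd by (auto simp: sum_fun_apply weyl_ops_sum_apply[OF P])
          then show "P \<circ> x \<in> ?K" using weyl_ops.comp[OF P w(2)] by blast
        }
      next
        have "0 = kdiff (right_euler A \<beta>) (\<lambda>_. 0) {}" unfolding kdiff_def by simp
        then show "0 \<in> ?K" using weyl_ops_zero by blast
      qed
      show "range (euler_op A \<beta>) \<subseteq> ?K"
      proof
        fix x assume "x \<in> range (euler_op A \<beta>)"
        then obtain i where x: "x = euler_op A \<beta> i" by blast
        have "(\<Sum>k\<in>UNIV. (if {k} = {i} then id else 0) \<circ> euler_op A \<beta> k) = (\<Sum>k\<in>UNIV. if k = i then euler_op A \<beta> i else 0)"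
          by (rule sum.cong) auto
        then have "x = kdiff (right_euler A \<beta>) (\<lambda>T. if T = {i} then id else 0) {}" unfolding kd x by simp
        moreover have "(if T = {i} then id else 0) \<in> weyl_ops" for T :: "'d set" by (simp add: weyl_ops_id weyl_ops_zero)
        ultimately show "x \<in> ?K" by blast
      qed
    qed
    show "?K \<subseteq> ?E"
    proof
      fix x assume "x \<in> ?K"
      then obtain w where w: "x = kdiff (right_euler A \<beta>) w {}" "\<And>T. w T \<in> weyl_ops" by blast
      have "euler_op A \<beta> i \<in> ?E" for i using left_ideal_generated_props(2)[OF rE] by blast
      then show "x \<in> ?E" unfolding w(1) kd
        using E Ec w(2) unfolding left_stable_def by (intro subgroup_set_sum[of ?E]) auto
    qed
  qed
  show "P \<in> H_ideal A C \<beta> \<longleftrightarrow> (\<exists>w. (\<forall>T. w T \<in> weyl_ops) \<and> P - kdiff (right_euler A \<beta>) w {} \<in> weyl_ext C)"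
  proof
    assume "P \<in> H_ideal A C \<beta>"
    then obtain x w where "P = x + kdiff (right_euler A \<beta>) w {}" "x \<in> weyl_ext C" "\<forall>T. w T \<in> weyl_ops"
      unfolding H EK by blast
    then show "\<exists>w. (\<forall>T. w T \<in> weyl_ops) \<and> P - kdiff (right_euler A \<beta>) w {} \<in> weyl_ext C"
      by (intro exI[of _ w]) simp
  next
    assume "\<exists>w. (\<forall>T. w T \<in> weyl_ops) \<and> P - kdiff (right_euler A \<beta>) w {} \<in> weyl_ext C"
    then obtain w where w: "\<forall>T. w T \<in> weyl_ops" "P - kdiff (right_euler A \<beta>) w {} \<in> weyl_ext C" by blast
    have "P = (P - kdiff (right_euler A \<beta>) w {}) + kdiff (right_euler A \<beta>) w {}" by simp
    then show "P \<in> H_ideal A C \<beta>" unfolding H EK using w by blast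
  qed
qed

text \<open>
  With \<open>H_ideal_iff\<close> this identifies \<open>D/H\<^sub>A\<close> with the Koszul homology in degree zero, because every
  operator is a cycle there.
\<close>

lemma presentation_D_mod_H:
  fixes A :: "int^'n::finite^'d::{finite,linorder}"
  shows
  "presentation weyl (\<circ>) weyl_ops (H_ideal A C \<beta>) (D_mod_H A C \<beta>) (\<lambda>P. H_ideal A C \<beta> +>\<^bsub>regular_module weyl\<^esub> P)"
proof -
  interpret presentation weyl "(\<circ>)" weyl_ops "{0}" "regular_module weyl" id by (rule presentation_regular_weyl)
  show ?thesis
    using quotient[of "H_ideal A C \<beta>" "H_ideal A C \<beta>"] left_stable_H_ideal[of A C \<beta>]
      subgroup_setD(1)[of "H_ideal A C \<beta>"]
    unfolding D_mod_H_def left_stable_def by auto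
qed

section \<open>Extension of scalars to the Weyl algebra\<close>

abbreviation poly_class :: "'n cpoly set \<Rightarrow> 'n cpoly \<Rightarrow> 'n cpoly set" where
  "poly_class C f \<equiv> C +>\<^bsub>regular_module poly_ring\<^esub> f"

text \<open>
  The action of \<open>D\<close> on the first factor, on formal integer combinations of pairs.
\<close>

definition pair_action :: "('n::finite cpoly \<Rightarrow> 'n cpoly) \<Rightarrow> ((('n cpoly \<Rightarrow> 'n cpoly) \<times> 'v) \<Rightarrow>\<^sub>0 int) \<Rightarrow> ((('n cpoly \<Rightarrow> 'n cpoly) \<times> 'v) \<Rightarrow>\<^sub>0 int)" where
  "pair_action P = frag_extend (\<lambda>(Q, v). frag_of (P \<circ> Q, v))"

lemma pair_action_simps [simp]: "pair_action P (frag_of (Q, v)) = frag_of (P \<circ> Q, v)"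
  "pair_action P (c + d) = pair_action P c + pair_action P d"
  "pair_action P (c - d) = pair_action P c - pair_action P d"
  "pair_action P 0 = 0"
  by (simp_all add: pair_action_def frag_extend_add frag_extend_diff)

definition pair_chains :: "('n::finite cpoly, 'v) module \<Rightarrow> ((('n cpoly \<Rightarrow> 'n cpoly) \<times> 'v) \<Rightarrow>\<^sub>0 int) set" where
  "pair_chains V = {c. Poly_Mapping.keys c \<subseteq> weyl_ops \<times> carrier V}"

lemma pair_chains_subgroup: "additive_subgroup_set (pair_chains V)"
  unfolding additive_subgroup_set_def pair_chains_def using keys_diff by fastforce

lemma presentation_free_pairs:
  "presentation weyl pair_action (pair_chains V) {0} (free_pairs weyl V) id"
proof
  show "pair_action r z \<in> pair_chains V" if "r \<in> carrier weyl" "z \<in> pair_chains V" for r z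
    using that keys_frag_extend[of "\<lambda>(Q, v). frag_of (r \<circ> Q, v)" z] weyl_ops.comp[of r]
    unfolding pair_chains_def pair_action_def by (fastforce split: prod.splits)
  show "additive_subgroup_set (pair_chains V)" by (rule pair_chains_subgroup)
qed (auto simp: free_pairs_def pair_chains_def pair_action_def frag_extend_add)

text \<open>
  The aim is a presentation of \<open>D \<otimes> \<complex>[\<partial>]/C\<close> by \<open>D\<close> itself with kernel \<open>D C\<close>, where \<open>P\<close> is mapped to
  \<open>P \<otimes> 1\<close>.
\<close>

locale tensor_quotient =
  fixes C :: "'n::finite cpoly set"
  assumes ideal: "poly_ideal C"
begin

abbreviation "V \<equiv> poly_quot C"
abbreviation "cls \<equiv> poly_class C"
abbreviation "rels \<equiv> tensor_relations poly_ring weyl diff_op V"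
abbreviation "frags \<equiv> pair_chains V"

sublocale V: presentation poly_ring "(*)" UNIV C V cls
  using ideal by (rule presentation_poly_quot)

lemma poly_ring_simps: "carrier poly_ring = UNIV"
  by (simp add: poly_ring_def)

definition relators where
  "relators = {frag_of (P + Q, v) - frag_of (P, v) - frag_of (Q, v) | P Q v.
         P \<in> weyl_ops \<and> Q \<in> weyl_ops \<and> v \<in> carrier V} \<union>
      {frag_of (P, v \<oplus>\<^bsub>V\<^esub> w) - frag_of (P, v) - frag_of (P, w) | P v w.
         P \<in> weyl_ops \<and> v \<in> carrier V \<and> w \<in> carrier V} \<union>
      {frag_of (P \<circ> diff_op r, v) - frag_of (P, r \<odot>\<^bsub>V\<^esub> v) | P r v.
         P \<in> weyl_ops \<and> v \<in> carrier V}"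

lemma rels_eq: "rels = generate (free_Abelian_group (weyl_ops \<times> carrier V)) relators"
  unfolding tensor_relations_def relators_def by (simp add: poly_ring_def)

lemma V_closed: "v \<in> carrier V \<Longrightarrow> w \<in> carrier V \<Longrightarrow> v \<oplus>\<^bsub>V\<^esub> w \<in> carrier V" "v \<in> carrier V \<Longrightarrow> r \<odot>\<^bsub>V\<^esub> v \<in> carrier V"
proof -
  show "v \<in> carrier V \<Longrightarrow> w \<in> carrier V \<Longrightarrow> v \<oplus>\<^bsub>V\<^esub> w \<in> carrier V"
    by (rule abelian_monoid.a_closed[OF abelian_group.axioms(1)[OF V.abelian_group_quotient]])
  assume "v \<in> carrier V"
  then obtain f where "v = cls f" by (rule V.carrier_obtain)
  then have "r \<odot>\<^bsub>V\<^esub> v = cls (r * f)" using V.q_act[of r f] by (simp add: poly_ring_simps)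
  then show "r \<odot>\<^bsub>V\<^esub> v \<in> carrier V" using V.q_closed by simp
qed

lemma frag_in_chains: "P \<in> weyl_ops \<Longrightarrow> v \<in> carrier V \<Longrightarrow> frag_of (P, v) \<in> frags"
  by (simp add: pair_chains_def)

lemma subgroup_free_iff:
  "subgroup X (free_Abelian_group (weyl_ops \<times> carrier V)) \<longleftrightarrow> X \<subseteq> frags \<and> additive_subgroup_set X"
proof -
  have "carrier (free_Abelian_group (weyl_ops \<times> carrier V)) = frags"
    by (auto simp: free_Abelian_group_def pair_chains_def)
  then show ?thesis
    by (subst subgroup_if_additive[OF group_free_Abelian_group]) (simp_all add: free_Abelian_group_def)
qed

lemma relators_in_chains: "relators \<subseteq> frags"
proof
  fix x assume "x \<in> relators"
  then show "x \<in> frags"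
    unfolding relators_def
    by (elim UnE CollectE exE conjE; simp only:)
      (intro subgroup_setD(2)[OF pair_chains_subgroup] frag_in_chains V_closed weyl_ops_plus weyl_ops.comp diff_op_in_weyl; assumption)+
qed

lemma rels_subgroup: "rels \<subseteq> frags" "additive_subgroup_set rels"
proof -
  have "relators \<subseteq> carrier (free_Abelian_group (weyl_ops \<times> carrier V))"
    using relators_in_chains by (auto simp: pair_chains_def)
  then have "subgroup rels (free_Abelian_group (weyl_ops \<times> carrier V))"
    unfolding rels_eq by (rule group.generate_is_subgroup[OF group_free_Abelian_group])
  then show "rels \<subseteq> frags" "additive_subgroup_set rels" unfolding subgroup_free_iff by blast+
qed

lemmas rels = subgroup_setD[OF rels_subgroup(2)]

lemma rels_least: "relators \<subseteq> X \<Longrightarrow> X \<subseteq> frags \<Longrightarrow> additive_subgroup_set X \<Longrightarrow> rels \<subseteq> X"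
  unfolding rels_eq
  by (rule group.generate_subgroup_incl[OF group_free_Abelian_group]) (simp_all add: subgroup_free_iff)

lemma relator_add_left: "P \<in> weyl_ops \<Longrightarrow> Q \<in> weyl_ops \<Longrightarrow> v \<in> carrier V \<Longrightarrow> frag_of (P + Q, v) - frag_of (P, v) - frag_of (Q, v) \<in> rels"
  unfolding rels_eq by (rule generate.incl) (auto simp: relators_def)

lemma relator_add_right: "P \<in> weyl_ops \<Longrightarrow> v \<in> carrier V \<Longrightarrow> w \<in> carrier V \<Longrightarrow> frag_of (P, v \<oplus>\<^bsub>V\<^esub> w) - frag_of (P, v) - frag_of (P, w) \<in> rels"
  unfolding rels_eq by (rule generate.incl) (auto simp: relators_def)

lemma relator_balanced: "P \<in> weyl_ops \<Longrightarrow> v \<in> carrier V \<Longrightarrow> frag_of (P \<circ> diff_op r, v) - frag_of (P, r \<odot>\<^bsub>V\<^esub> v) \<in> rels"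
  unfolding rels_eq by (rule generate.incl) (auto simp: relators_def)

text \<open>
  Composition with \<open>P\<close> maps each of the three kinds of relators to one of the same kind.
\<close>

lemma rels_action:
  assumes P: "P \<in> weyl_ops" and c: "c \<in> rels"
  shows "pair_action P c \<in> rels"
proof -
  have "rels \<subseteq> {c \<in> rels. pair_action P c \<in> rels}"
  proof (rule rels_least)
    show "relators \<subseteq> {c \<in> rels. pair_action P c \<in> rels}"
    proof
      fix x assume x: "x \<in> relators"
      then have "x \<in> rels" unfolding rels_eq by (rule generate.incl)
      moreover from x have "pair_action P x \<in> rels"
      proof (unfold relators_def, elim UnE CollectE exE conjE)
        fix Q Q' v assume "x = frag_of (Q + Q', v) - frag_of (Q, v) - frag_of (Q', v)" "Q \<in> weyl_ops" "Q' \<in> weyl_ops" "v \<in> carrier V"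
        then show ?thesis
          using relator_add_left[of "P \<circ> Q" "P \<circ> Q'" v] P by (simp add: weyl_ops_comp_add weyl_ops.comp)
      next
        fix Q v w assume "x = frag_of (Q, v \<oplus>\<^bsub>V\<^esub> w) - frag_of (Q, v) - frag_of (Q, w)" "Q \<in> weyl_ops" "v \<in> carrier V" "w \<in> carrier V"
        then show ?thesis
          using relator_add_right[of "P \<circ> Q" v w] P by (simp add: weyl_ops.comp)
      next
        fix Q r v assume "x = frag_of (Q \<circ> diff_op r, v) - frag_of (Q, r \<odot>\<^bsub>V\<^esub> v)" "Q \<in> weyl_ops" "v \<in> carrier V"
        then show ?thesis
          using relator_balanced[of "P \<circ> Q" v r] P by (simp add: weyl_ops.comp comp_assoc)
      qed
      ultimately show "x \<in> {c \<in> rels. pair_action P c \<in> rels}" by blast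
    qed
    show "additive_subgroup_set {c \<in> rels. pair_action P c \<in> rels}"
      using rels(1,2) by (simp add: additive_subgroup_set_def)
  qed (use rels_subgroup(1) in blast)
  then show ?thesis using c by blast
qed

definition tq where "tq c = rels +>\<^bsub>free_pairs weyl V\<^esub> c"

sublocale W: presentation weyl pair_action frags rels "weyl_tensor V" tq
proof -
  interpret F: presentation weyl pair_action frags "{0}" "free_pairs weyl V" id by (rule presentation_free_pairs)
  have "presentation weyl pair_action frags rels (quot_module (free_pairs weyl V) rels)
      (\<lambda>z. rels +>\<^bsub>free_pairs weyl V\<^esub> id z)"
    by (rule F.quotient) (use rels_subgroup rels(1) rels_action in auto)
  then show "presentation weyl pair_action frags rels (weyl_tensor V) tq"
    unfolding weyl_tensor_def tensor_module_def tq_def[abs_def] id_apply .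
qed

lemma pure_tensor_eq: "pure_tensor poly_ring weyl diff_op V P v = tq (frag_of (P, v))"
  by (simp add: pure_tensor_def tq_def)

definition pt where "pt P = tq (frag_of (P, cls 1))"

lemma cls_closed: "cls f \<in> carrier V"
  by (rule V.q_closed) simp

lemma cls_mult: "r \<odot>\<^bsub>V\<^esub> cls f = cls (r * f)"
  using V.q_act[of r f] by (simp add: poly_ring_simps)

lemma pure_tensor_pt:
  assumes "P \<in> weyl_ops"
  shows "pure_tensor poly_ring weyl diff_op V P (cls f) = pt (P \<circ> diff_op f)"
proof -
  have "frag_of (P \<circ> diff_op f, cls 1) - frag_of (P, cls f) \<in> rels"
    using relator_balanced[OF assms cls_closed, of f 1] by (simp add: cls_mult)
  then show ?thesis
    unfolding pure_tensor_eq pt_def using assms weyl_ops.comp[OF assms diff_op_in_weyl]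
    by (subst eq_commute, subst W.q_eq_iff) (auto intro: frag_in_chains cls_closed)
qed

text \<open>
  A representative of a residue class.  It is neither additive nor multiplicative, but the errors lie in
  \<open>C\<close>.
\<close>

definition rep where "rep X = (SOME f. cls f = X)"

lemma cls_rep: "X \<in> carrier V \<Longrightarrow> cls (rep X) = X"
  unfolding rep_def by (rule someI_ex) (metis V.carrier_obtain)

lemma cls_eq_iff: "cls f = cls g \<longleftrightarrow> f - g \<in> C"
  by (rule V.q_eq_iff) auto

text \<open>
  The map \<open>P \<otimes> v \<mapsto> P f\<close> for \<open>v = f + C\<close>, which is well defined only modulo \<open>D C\<close> and provides the inverse
  of \<open>P \<mapsto> P \<otimes> 1\<close>.
\<close>

definition eval_pairs where
  "eval_pairs c = (\<lambda>f. \<Sum>k\<in>Poly_Mapping.keys c. of_int (Poly_Mapping.lookup c k) * (fst k \<circ> diff_op (rep (snd k))) f)"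

lemma eval_pairs_add: "eval_pairs (c + d) = eval_pairs c + eval_pairs d"
proof
  show "eval_pairs (c + d) f = (eval_pairs c + eval_pairs d) f" for f
    unfolding eval_pairs_def plus_fun_apply
    by (rule setsum_keys_plus_distrib) (simp_all add: distrib_right)
qed

lemma eval_pairs_0: "eval_pairs 0 = 0"
  by (auto simp: eval_pairs_def)

lemma eval_pairs_diff: "eval_pairs (c - d) = eval_pairs c - eval_pairs d"
  using eval_pairs_add[of "c - d" d] by simp

lemma eval_pairs_frag: "eval_pairs (frag_of (P, X)) = P \<circ> diff_op (rep X)"
  by (auto simp: eval_pairs_def)

lemma comp_diff_op_cong:
  assumes "P \<in> weyl_ops" "f - g \<in> C"
  shows "(P \<circ> diff_op f) - (P \<circ> diff_op g) \<in> weyl_ext C"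
  using weyl_extD(3)[OF diff_op_in_weyl_ext[OF assms(2)] assms(1)] assms(1)
  by (simp add: diff_op_diff weyl_ops_comp_diff)

lemma eval_pairs_rels:
  assumes "c \<in> rels" shows "eval_pairs c \<in> weyl_ext C"
proof -
  note E = subgroup_setD[OF weyl_extD(1)[of C]]
  have "rels \<subseteq> {c \<in> rels. eval_pairs c \<in> weyl_ext C}"
  proof (rule rels_least)
    show "relators \<subseteq> {c \<in> rels. eval_pairs c \<in> weyl_ext C}"
    proof
      fix x assume x: "x \<in> relators"
      then have "x \<in> rels" unfolding rels_eq by (rule generate.incl)
      moreover from x have "eval_pairs x \<in> weyl_ext C"
      proof (unfold relators_def, elim UnE CollectE exE conjE)
        fix Q Q' v assume "x = frag_of (Q + Q', v) - frag_of (Q, v) - frag_of (Q', v)" "Q \<in> weyl_ops" "Q' \<in> weyl_ops" "v \<in> carrier V"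
        then have "eval_pairs x = 0" by (auto simp: eval_pairs_diff eval_pairs_frag fun_eq_iff)
        then show ?thesis using E(1) by simp
      next
        fix Q v w assume x: "x = frag_of (Q, v \<oplus>\<^bsub>V\<^esub> w) - frag_of (Q, v) - frag_of (Q, w)" "Q \<in> weyl_ops" "v \<in> carrier V" "w \<in> carrier V"
        have "cls (rep (v \<oplus>\<^bsub>V\<^esub> w)) = cls (rep v + rep w)"
          using V.q_add[of "rep v" "rep w"] x V_closed(1) by (simp add: cls_rep)
        then have "rep (v \<oplus>\<^bsub>V\<^esub> w) - (rep v + rep w) \<in> C" by (simp add: cls_eq_iff)
        from comp_diff_op_cong[OF x(2) this] show ?thesis
          using x(2) by (simp add: x(1) eval_pairs_diff eval_pairs_frag diff_op_add weyl_ops_comp_add diff_diff_eq eval_pairs_add)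
      next
        fix Q r v assume x: "x = frag_of (Q \<circ> diff_op r, v) - frag_of (Q, r \<odot>\<^bsub>V\<^esub> v)" "Q \<in> weyl_ops" "v \<in> carrier V"
        have "cls (r * rep v) = cls (rep (r \<odot>\<^bsub>V\<^esub> v))"
          using x V_closed(2)[of v r] cls_mult[of r "rep v"] by (simp add: cls_rep)
        then have "r * rep v - rep (r \<odot>\<^bsub>V\<^esub> v) \<in> C" by (simp add: cls_eq_iff)
        from comp_diff_op_cong[OF x(2) this] show ?thesis
          by (simp add: x(1) eval_pairs_diff eval_pairs_frag diff_op_mult comp_assoc)
      qed
      ultimately show "x \<in> {c \<in> rels. eval_pairs c \<in> weyl_ext C}" by blast
    qed
    show "additive_subgroup_set {c \<in> rels. eval_pairs c \<in> weyl_ext C}"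
      using rels(1,2) E(1,2) by (simp add: additive_subgroup_set_def eval_pairs_0 eval_pairs_diff)
  qed (use rels_subgroup(1) in blast)
  then show ?thesis using assms by blast
qed

lemma frag_0_rels: "v \<in> carrier V \<Longrightarrow> frag_of (0, v) \<in> rels"
  using rels(3)[OF relator_add_left[OF weyl_ops_zero weyl_ops_zero, of v]] by simp

lemma frag_diff_rels:
  assumes "P \<in> weyl_ops" "Q \<in> weyl_ops" "v \<in> carrier V"
  shows "frag_of (P, v) - frag_of (Q, v) - frag_of (P - Q, v) \<in> rels"
proof -
  have "frag_of (P - Q + Q, v) - frag_of (P - Q, v) - frag_of (Q, v) \<in> rels"
    using assms subgroup_setD(2)[OF weyl_ops_subgroup] by (intro relator_add_left) auto
  then show ?thesis by (simp add: algebra_simps)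
qed

text \<open>
  The operators \<open>x\<close> with \<open>x \<otimes> 1 = 0\<close> form a left ideal, and it contains \<open>C\<close> because
  \<open>c \<otimes> 1 = 1 \<otimes> (c + C)\<close> for polynomials \<open>c\<close>.
\<close>

lemma frag_weyl_ext_rels:
  assumes "x \<in> weyl_ext C" shows "frag_of (x, cls 1) \<in> rels"
proof -
  have "weyl_ext C \<subseteq> {x \<in> weyl_ops. frag_of (x, cls 1) \<in> rels}"
  proof (rule weyl_ext_least)
    show "left_stable {x \<in> weyl_ops. frag_of (x, cls 1) \<in> rels}"
      unfolding left_stable_def additive_subgroup_set_def
    proof (intro conjI ballI)
      show "0 \<in> {x \<in> weyl_ops. frag_of (x, cls 1) \<in> rels}"
        by (simp add: weyl_ops_zero frag_0_rels cls_closed)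
      fix x assume x: "x \<in> {x \<in> weyl_ops. frag_of (x, cls 1) \<in> rels}"
      {
        fix y assume y: "y \<in> {x \<in> weyl_ops. frag_of (x, cls 1) \<in> rels}"
        have "frag_of (x, cls 1) - frag_of (y, cls 1) - (frag_of (x, cls 1) - frag_of (y, cls 1) - frag_of (x - y, cls 1)) \<in> rels"
          using x y by (intro rels(2) frag_diff_rels cls_closed) auto
        then show "x - y \<in> {x \<in> weyl_ops. frag_of (x, cls 1) \<in> rels}"
          using x y by (simp add: subgroup_setD(2)[OF weyl_ops_subgroup])
      next
        fix P :: "'n cpoly \<Rightarrow> 'n cpoly" assume P: "P \<in> weyl_ops"
        then show "P \<circ> x \<in> {x \<in> weyl_ops. frag_of (x, cls 1) \<in> rels}"
          using rels_action[OF P, of "frag_of (x, cls 1)"] x weyl_ops.comp[OF P] by simp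
      }
    qed blast
    show "diff_op ` C \<subseteq> {x \<in> weyl_ops. frag_of (x, cls 1) \<in> rels}"
    proof safe
      fix c assume c: "c \<in> C"
      have 0: "cls c = cls 0" using c by (simp add: cls_eq_iff)
      have "frag_of (id, cls 0 \<oplus>\<^bsub>V\<^esub> cls 0) - frag_of (id, cls 0) - frag_of (id, cls 0) \<in> rels"
        by (intro relator_add_right weyl_ops_id cls_closed)
      moreover have "cls 0 \<oplus>\<^bsub>V\<^esub> cls 0 = cls 0" using V.q_add[of 0 0] by simp
      ultimately have id0: "frag_of (id, cls 0) \<in> rels" using rels(3)[of "- frag_of (id, cls 0)"] by simp
      have "frag_of (id \<circ> diff_op c, cls 1) - frag_of (id, c \<odot>\<^bsub>V\<^esub> cls 1) \<in> rels"
        by (intro relator_balanced weyl_ops_id cls_closed)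
      from rels(4)[OF this id0] show "frag_of (diff_op c, cls 1) \<in> rels"
        by (simp add: cls_mult 0)
      show "diff_op c \<in> weyl_ops" by (rule diff_op_in_weyl)
    qed
  qed
  then show ?thesis using assms by blast
qed

text \<open>
  By \<open>frag_weyl_ext_rels\<close> the kernel of \<open>P \<mapsto> P \<otimes> 1\<close> contains \<open>D C\<close>, and by \<open>eval_pairs_rels\<close> it is not
  larger.  Surjectivity is due to \<open>P \<otimes> (f + C) = P f \<otimes> 1\<close>.
\<close>

sublocale D: presentation weyl "(\<circ>)" weyl_ops "weyl_ext C" "weyl_tensor V" pt
proof
  note fr = frag_in_chains[OF _ cls_closed]
  show "additive_subgroup_set weyl_ops" by (rule weyl_ops_subgroup)
  show "r \<circ> (z + w) = (r \<circ> z) + (r \<circ> w)" if "r \<in> carrier weyl" for r z w :: "'n cpoly \<Rightarrow> 'n cpoly"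
    using that by (simp add: weyl_ops_comp_add)
  show "r \<circ> z \<in> weyl_ops" if "r \<in> carrier weyl" "z \<in> weyl_ops" for r z :: "'n cpoly \<Rightarrow> 'n cpoly"
    using that by (simp add: weyl_ops.comp)
  show "pt (z + w) = pt z \<oplus>\<^bsub>weyl_tensor V\<^esub> pt w" if zw: "z \<in> weyl_ops" "w \<in> weyl_ops" for z w
  proof -
    have "tq (frag_of (z + w, cls 1)) = tq (frag_of (z, cls 1) + frag_of (w, cls 1))"
      using relator_add_left[OF zw cls_closed] zw
      by (subst W.q_eq_iff) (auto intro!: fr W.Z_closed(4) weyl_ops_plus simp: diff_diff_eq)
    then show ?thesis unfolding pt_def using W.q_add[OF fr[OF zw(1)] fr[OF zw(2)]] by simp
  qed
  show "pt (r \<circ> z) = r \<odot>\<^bsub>weyl_tensor V\<^esub> pt z" if "r \<in> carrier weyl" "z \<in> weyl_ops" for r z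
    using W.q_act[OF that(1) fr[OF that(2)]] by (simp add: pt_def)
  show "pt 0 = \<zero>\<^bsub>weyl_tensor V\<^esub>"
    unfolding pt_def W.q_0[symmetric] using frag_0_rels[OF cls_closed]
    by (subst W.q_eq_iff) (auto intro!: fr weyl_ops_zero W.Z_closed(1))
  show "pt z = pt w \<longleftrightarrow> z - w \<in> weyl_ext C" if zw: "z \<in> weyl_ops" "w \<in> weyl_ops" for z w
  proof -
    have "pt z = pt w \<longleftrightarrow> frag_of (z, cls 1) - frag_of (w, cls 1) \<in> rels"
      unfolding pt_def by (rule W.q_eq_iff[OF fr[OF zw(1)] fr[OF zw(2)]])
    also have "\<dots> \<longleftrightarrow> z - w \<in> weyl_ext C"
    proof
      assume "z - w \<in> weyl_ext C"
      then show "frag_of (z, cls 1) - frag_of (w, cls 1) \<in> rels"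
        using rels(4)[OF frag_diff_rels[OF zw cls_closed[of 1]] frag_weyl_ext_rels[of "z - w"]] by simp
    next
      assume "frag_of (z, cls 1) - frag_of (w, cls 1) \<in> rels"
      then have 1: "(z \<circ> diff_op (rep (cls 1))) - (w \<circ> diff_op (rep (cls 1))) \<in> weyl_ext C"
        using eval_pairs_rels by (fastforce simp: eval_pairs_diff eval_pairs_frag)
      have "rep (cls 1) - 1 \<in> C" using cls_rep[OF cls_closed, of 1] by (simp add: cls_eq_iff)
      then have 2: "(z \<circ> diff_op (rep (cls 1))) - z \<in> weyl_ext C" "(w \<circ> diff_op (rep (cls 1))) - w \<in> weyl_ext C"
        using comp_diff_op_cong[OF zw(1), of "rep (cls 1)" 1] comp_diff_op_cong[OF zw(2), of "rep (cls 1)" 1]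
        by (simp_all add: diff_op_1)
      note E = subgroup_setD[OF weyl_extD(1)[of C]]
      show "z - w \<in> weyl_ext C"
        using E(4)[OF E(2)[OF 1 2(1)] 2(2)] by (simp add: algebra_simps)
    qed
    finally show ?thesis .
  qed
  show "pt ` weyl_ops = carrier (weyl_tensor V)"
  proof
    show "pt ` weyl_ops \<subseteq> carrier (weyl_tensor V)"
      unfolding pt_def using W.q_closed[OF fr] by blast
    have "\<exists>P\<in>weyl_ops. c - frag_of (P, cls 1) \<in> rels" if "Poly_Mapping.keys c \<subseteq> weyl_ops \<times> carrier V" for c
      using that
    proof (induction rule: frag_induction)
      case zero
      show ?case
      proof (intro bexI[of _ 0] weyl_ops_zero)
        show "0 - frag_of (0, cls 1) \<in> rels"
          using rels(3)[OF frag_0_rels[OF cls_closed[of 1]]] unfolding diff_0 .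
      qed
    next
      case (one x)
      then obtain P v where x: "x = (P, v)" "P \<in> weyl_ops" "v \<in> carrier V" by blast
      have "frag_of (P \<circ> diff_op (rep v), cls 1) - frag_of (P, v) \<in> rels"
        using relator_balanced[OF x(2) cls_closed, of "rep v" 1] x(3) by (simp add: cls_mult cls_rep)
      from rels(3)[OF this, unfolded minus_diff_eq] show ?case
        unfolding x(1)
        by (rule bexI[where P = "\<lambda>R. frag_of (P, v) - frag_of (R, cls 1) \<in> rels"])
          (rule weyl_ops.comp[OF x(2) diff_op_in_weyl])
    next
      case (diff a b)
      then obtain P Q where P: "P \<in> weyl_ops" "a - frag_of (P, cls 1) \<in> rels" and Q: "Q \<in> weyl_ops" "b - frag_of (Q, cls 1) \<in> rels" by blast
      have "a - b - frag_of (P - Q, cls 1) \<in> rels"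
        using rels(4)[OF rels(2)[OF P(2) Q(2)] frag_diff_rels[OF P(1) Q(1) cls_closed, of 1]]
        by (simp add: algebra_simps)
      then show ?case using subgroup_setD(2)[OF weyl_ops_subgroup P(1) Q(1)] by blast
    qed
    note generated = this
    have "tq c \<in> pt ` weyl_ops" if c: "c \<in> frags" for c
    proof -
      obtain P where P: "P \<in> weyl_ops" "c - frag_of (P, cls 1) \<in> rels"
        using generated[of c] c unfolding pair_chains_def by blast
      have "tq c = pt P" unfolding pt_def using W.q_eq_iff[OF c fr[OF P(1)]] P(2) by blast
      then show ?thesis using P(1) by blast
    qed
    then show "carrier (weyl_tensor V) \<subseteq> pt ` weyl_ops" unfolding W.q_surj[symmetric] by blast
  qed
qed

end

section \<open>The Euler endomorphisms as right multiplications\<close>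

text \<open>
  A consequence of being homogeneous of degree \<open>\<alpha>\<close>, and all that is needed of homogeneity; in contrast
  to the latter it does not refer to the generators of the homogeneous part.
\<close>

definition euler_degree :: "int^'n::finite^'d::finite \<Rightarrow> int^'d \<Rightarrow> ('n cpoly \<Rightarrow> 'n cpoly) \<Rightarrow> bool" where
  "euler_degree A \<alpha> R \<longleftrightarrow> (\<forall>\<beta> i. R \<circ> euler_op A \<beta> i = euler_op A (\<beta> + of_int_vec \<alpha>) i \<circ> R)"

lemma euler_degreeD: "euler_degree A \<alpha> R \<Longrightarrow> R \<circ> euler_op A \<beta> i = euler_op A (\<beta> + of_int_vec \<alpha>) i \<circ> R"
  by (simp only: euler_degree_def)

lemma euler_degree_0: "euler_degree A \<alpha> 0"
  unfolding euler_degree_def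
  by (intro allI ext) (simp add: weyl_ops_zero_apply[OF euler_op_in_weyl])

lemma euler_degree_add:
  assumes "euler_degree A \<alpha> R" "euler_degree A \<alpha> S"
  shows "euler_degree A \<alpha> (R + S)"
  unfolding euler_degree_def
proof (intro allI ext)
  fix \<beta> i f
  show "((R + S) \<circ> euler_op A \<beta> i) f = (euler_op A (\<beta> + of_int_vec \<alpha>) i \<circ> (R + S)) f"
    using fun_cong[OF euler_degreeD[OF assms(1), of \<beta> i], of f] fun_cong[OF euler_degreeD[OF assms(2), of \<beta> i], of f]
    by (simp only: o_apply plus_fun_apply weyl_ops_add[OF euler_op_in_weyl])
qed

lemma euler_degree_uminus:
  assumes "euler_degree A \<alpha> R"
  shows "euler_degree A \<alpha> (- R)"
  unfolding euler_degree_def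
proof (intro allI ext)
  fix \<beta> i f
  show "(- R \<circ> euler_op A \<beta> i) f = (euler_op A (\<beta> + of_int_vec \<alpha>) i \<circ> - R) f"
    using fun_cong[OF euler_degreeD[OF assms, of \<beta> i], of f]
    by (simp only: o_apply uminus_apply weyl_ops_minus_apply[OF euler_op_in_weyl])
qed

lemma euler_degree_diff_op: "p \<in> poly_degree_part A \<alpha> \<Longrightarrow> euler_degree A \<alpha> (diff_op p)"
  unfolding euler_degree_def by (intro allI diff_op_euler)

lemma euler_degree_comp:
  assumes "euler_degree A \<gamma> P" "euler_degree A \<delta> Q"
  shows "euler_degree A (\<gamma> + \<delta>) (P \<circ> Q)"
  unfolding euler_degree_def
proof (intro allI)
  fix \<beta> i
  have "(P \<circ> Q) \<circ> euler_op A \<beta> i = (P \<circ> euler_op A (\<beta> + of_int_vec \<delta>) i) \<circ> Q"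
    by (simp only: comp_assoc euler_degreeD[OF assms(2)])
  also have "\<dots> = (euler_op A (\<beta> + of_int_vec \<delta> + of_int_vec \<gamma>) i \<circ> P) \<circ> Q"
    by (simp only: euler_degreeD[OF assms(1)])
  also have "\<beta> + of_int_vec \<delta> + of_int_vec \<gamma> = \<beta> + of_int_vec (\<gamma> + \<delta>)"
    by (simp add: of_int_vec_def vec_eq_iff)
  finally show "(P \<circ> Q) \<circ> euler_op A \<beta> i = euler_op A (\<beta> + of_int_vec (\<gamma> + \<delta>)) i \<circ> (P \<circ> Q)"
    by (simp only: comp_assoc)
qed

lemma weyl_degree_part_props:
  fixes P :: "'n::finite cpoly \<Rightarrow> 'n cpoly"
  assumes "P \<in> weyl_degree_part A \<gamma>"
  shows "P \<in> weyl_ops" "euler_degree A \<gamma> P"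
proof -
  let ?G = "{(\<lambda>f. monomial u c * dmon v f) | u v c. A *v exp_vec u - A *v exp_vec v = \<gamma>}"
  let ?X = "{P \<in> weyl_ops. euler_degree A \<gamma> P}"
  have "weyl_degree_part A \<gamma> \<subseteq> ?X"
    unfolding weyl_degree_part_def
  proof (rule generate_weyl_least)
    show "?G \<subseteq> ?X"
    proof
      fix x assume "x \<in> ?G"
      then obtain u v c where x: "x = (\<lambda>f. monomial u c * dmon v f)" "A *v exp_vec u - A *v exp_vec v = \<gamma>" by blast
      have "(\<lambda>f. monomial u c * f) \<circ> dmon v \<in> weyl_ops" by (intro weyl_ops.comp weyl_ops_monomial dmon_in_weyl)
      then have "x \<in> weyl_ops" unfolding x(1) o_def .
      moreover have "euler_degree A \<gamma> x"
        unfolding euler_degree_def x(1) by (intro allI monomial_dmon_euler x(2))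
      ultimately show "x \<in> ?X" by blast
    qed
    show "additive_subgroup_set ?X"
      unfolding additive_subgroup_set_def
    proof (intro conjI ballI)
      show "0 \<in> ?X" using weyl_ops_zero euler_degree_0 by blast
      show "x - y \<in> ?X" if "x \<in> ?X" "y \<in> ?X" for x y
        using that euler_degree_add[of A \<gamma> x "- y"] euler_degree_uminus[of A \<gamma> y]
        by (simp add: subgroup_setD(2)[OF weyl_ops_subgroup])
    qed
  qed blast
  then show "P \<in> weyl_ops" "euler_degree A \<gamma> P" using assms by blast+
qed

lemma id_in_weyl_degree_part: "id \<in> weyl_degree_part A 0"
proof -
  have id: "id = (\<lambda>f. monomial 0 1 * dmon 0 f)" by (auto simp: dmon_0)
  show ?thesis
    unfolding weyl_degree_part_def
  proof (rule generate.incl)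
    show "id \<in> {(\<lambda>f. monomial u c * dmon v f) | u v c. A *v exp_vec u - A *v exp_vec v = 0}"
      unfolding id by (intro CollectI exI conjI) (rule refl, simp)
  qed
qed

lemma one_in_degree_part: "1 \<in> poly_degree_part A 0"
  by (auto simp: poly_degree_part_def exp_vec_def matrix_vector_mult_def vec_eq_iff)

lemma lmodule_hom_smult:
  "h \<in> lmodule_hom R M N \<Longrightarrow> r \<in> carrier R \<Longrightarrow> x \<in> carrier M \<Longrightarrow> h (r \<odot>\<^bsub>M\<^esub> x) = r \<odot>\<^bsub>N\<^esub> h x"
  by (simp add: lmodule_hom_def)

context tensor_quotient
begin

text \<open>
  Homogeneous tensors of degree \<open>\<alpha>\<close> are sums of pure tensors \<open>P \<otimes> (f + C) = P f \<otimes> 1\<close> with homogeneous \<open>P\<close>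
  and \<open>f\<close> whose degrees add up to \<open>\<alpha>\<close>.
\<close>

lemma tensor_grading_obtain:
  assumes "z \<in> weyl_tensor_grading A V (poly_quot_grading A C) \<alpha>"
  obtains R where "R \<in> weyl_ops" "z = pt R" "euler_degree A \<alpha> R"
proof -
  let ?gens = "{pure_tensor poly_ring weyl diff_op V P v | P v \<gamma> \<delta>.
      P \<in> weyl_degree_part A \<gamma> \<and> v \<in> poly_quot_grading A C \<delta> \<and> \<gamma> + \<delta> = \<alpha>}"
  have gen: "\<exists>R\<in>weyl_ops. x = pt R \<and> euler_degree A \<alpha> R" if x: "x \<in> ?gens" for x
  proof -
    obtain P v \<gamma> \<delta> where x: "x = pure_tensor poly_ring weyl diff_op V P v" "P \<in> weyl_degree_part A \<gamma>" "v \<in> poly_quot_grading A C \<delta>" "\<gamma> + \<delta> = \<alpha>"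
      using x by blast
    obtain f where f: "v = cls f" "f \<in> poly_degree_part A \<delta>"
      using x(3) unfolding poly_quot_grading_def quot_grading_def by blast
    note P = weyl_degree_part_props[OF x(2)]
    have "euler_degree A \<alpha> (P \<circ> diff_op f)"
      unfolding x(4)[symmetric] by (intro euler_degree_comp P(2) euler_degree_diff_op f(2))
    then show ?thesis
      unfolding x(1) f(1) pure_tensor_pt[OF P(1)] using weyl_ops.comp[OF P(1) diff_op_in_weyl] by blast
  qed
  have "z \<in> generate (add_monoid (weyl_tensor V)) ?gens"
    using assms unfolding weyl_tensor_grading_def tensor_grading_def weyl_tensor_def .
  then have "\<exists>R\<in>weyl_ops. z = pt R \<and> euler_degree A \<alpha> R"
  proof (induction rule: generate.induct)
    case one
    have "\<one>\<^bsub>add_monoid (weyl_tensor V)\<^esub> = pt 0" unfolding D.q_0 by simp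
    then show ?case using weyl_ops_zero euler_degree_0 by blast
  next
    case (incl h)
    then show ?case by (rule gen)
  next
    case (inv h)
    obtain R where R: "R \<in> weyl_ops" "h = pt R" "euler_degree A \<alpha> R" using gen[OF inv] by blast
    have "inv\<^bsub>add_monoid (weyl_tensor V)\<^esub> h = pt (- R)"
      using D.q_minus[OF R(1)] by (simp add: R(2) a_inv_def)
    then show ?case using weyl_ops_uminus[OF R(1)] euler_degree_uminus[OF R(3)] by blast
  next
    case (eng h1 h2)
    then obtain R S where R: "R \<in> weyl_ops" "h1 = pt R" "euler_degree A \<alpha> R"
      and S: "S \<in> weyl_ops" "h2 = pt S" "euler_degree A \<alpha> S" by blast
    have "h1 \<otimes>\<^bsub>add_monoid (weyl_tensor V)\<^esub> h2 = pt (R + S)"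
      using D.q_add[OF R(1) S(1)] by (simp add: R(2) S(2))
    then show ?case using weyl_ops_plus[OF R(1) S(1)] euler_degree_add[OF R(3) S(3)] by blast
  qed
  then show thesis using that by blast
qed

lemma pt_id_grading: "pt id \<in> weyl_tensor_grading A V (poly_quot_grading A C) 0"
proof -
  have "cls 1 \<in> poly_quot_grading A C 0"
    unfolding poly_quot_grading_def quot_grading_def using one_in_degree_part by blast
  moreover have "pt id = pure_tensor poly_ring weyl diff_op V id (cls 1)"
    using pure_tensor_pt[OF weyl_ops_id, of 1] by (simp add: diff_op_1)
  ultimately have "pt id \<in> {pure_tensor poly_ring weyl diff_op V P v | P v \<gamma> \<delta>.
      P \<in> weyl_degree_part A \<gamma> \<and> v \<in> poly_quot_grading A C \<delta> \<and> \<gamma> + \<delta> = 0}"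
    using id_in_weyl_degree_part[of A]
    by (intro CollectI exI[of _ id] exI[of _ "cls 1"] exI[of _ "0 :: int^_"] conjI) auto
  then show ?thesis
    unfolding weyl_tensor_grading_def tensor_grading_def by (rule generate.incl)
qed

text \<open>
  Right multiplication by the Euler operator is well defined on \<open>D/DC\<close> as \<open>C\<close> is graded.  It is
  \<open>D\<close>-linear, and on the class of \<open>R\<close> of degree \<open>\<alpha>\<close> it acts as required, since
  \<open>R (E\<^sub>i - \<beta>\<^sub>i) = (E\<^sub>i - \<beta>\<^sub>i - \<alpha>\<^sub>i) R\<close>.  Conversely, a \<open>D\<close>-linear map is determined by its value at the generator
  \<open>1 \<otimes> 1\<close>, which is homogeneous of degree zero.
\<close>

lemma euler_endo_pt:
  assumes graded: "A_graded_ideal A C" and P: "P \<in> weyl_ops"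
  shows "euler_endo A \<beta> V (poly_quot_grading A C) i (pt P) = pt (P \<circ> euler_op A \<beta> i)"
proof -
  let ?M = "weyl_tensor V"
  let ?G = "weyl_tensor_grading A V (poly_quot_grading A C)"
  let ?spec = "\<lambda>\<phi>. \<phi> \<in> lmodule_hom weyl ?M ?M \<and> \<phi> \<in> extensional (carrier ?M) \<and>
     (\<forall>\<alpha>. \<forall>z\<in>?G \<alpha>. \<phi> z = euler_op A (\<beta> + of_int_vec \<alpha>) i \<odot>\<^bsub>?M\<^esub> z)"
  define \<phi> where "\<phi> = (\<lambda>z\<in>carrier ?M. pt ((SOME P. P \<in> weyl_ops \<and> pt P = z) \<circ> euler_op A \<beta> i))"
  have \<phi>: "\<phi> (pt P) = pt (P \<circ> euler_op A \<beta> i)" if P: "P \<in> weyl_ops" for P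
  proof -
    let ?R = "SOME R. R \<in> weyl_ops \<and> pt R = pt P"
    have R: "?R \<in> weyl_ops \<and> pt ?R = pt P" by (rule someI[of _ P]) (simp add: P)
    then have "?R - P \<in> weyl_ext C" using D.q_eq_iff P by blast
    then have "(?R - P) \<circ> euler_op A \<beta> i \<in> weyl_ext C" by (rule weyl_ext_euler_stable[OF graded])
    then have "pt (?R \<circ> euler_op A \<beta> i) = pt (P \<circ> euler_op A \<beta> i)"
      using R P by (subst D.q_eq_iff) (auto simp: comp_diff_left intro: weyl_ops.comp euler_op_in_weyl)
    then show ?thesis using D.q_closed[OF P] by (simp add: \<phi>_def)
  qed
  have spec: "?spec \<phi>"
  proof (intro conjI allI ballI)
    show "\<phi> \<in> lmodule_hom weyl ?M ?M"
      unfolding lmodule_hom_def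
    proof (intro CollectI conjI ballI Pi_I)
      fix x assume "x \<in> carrier ?M"
      then obtain P where P: "P \<in> weyl_ops" "x = pt P" by (rule D.carrier_obtain)
      note Pe = weyl_ops.comp[OF P(1) euler_op_in_weyl, of A \<beta> i]
      show "\<phi> x \<in> carrier ?M" using D.q_closed[OF Pe] by (simp add: P(2) \<phi>[OF P(1)])
      show "\<phi> (r \<odot>\<^bsub>?M\<^esub> x) = r \<odot>\<^bsub>?M\<^esub> \<phi> x" if r: "r \<in> carrier weyl" for r
      proof -
        have "r \<odot>\<^bsub>?M\<^esub> x = pt (r \<circ> P)" using D.q_act[OF r P(1)] by (simp only: P(2))
        moreover have "pt (r \<circ> (P \<circ> euler_op A \<beta> i)) = r \<odot>\<^bsub>?M\<^esub> pt (P \<circ> euler_op A \<beta> i)" by (rule D.q_act[OF r Pe])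
        moreover have "\<phi> (pt (r \<circ> P)) = pt (r \<circ> (P \<circ> euler_op A \<beta> i))"
          using \<phi>[OF weyl_ops.comp[OF _ P(1), of r]] r by (simp only: weyl_simps comp_assoc)
        ultimately show ?thesis by (simp only: P(2) \<phi>[OF P(1)])
      qed
      fix y assume "y \<in> carrier ?M"
      then obtain Q where Q: "Q \<in> weyl_ops" "y = pt Q" by (rule D.carrier_obtain)
      have "x \<oplus>\<^bsub>?M\<^esub> y = pt (P + Q)" using D.q_add[OF P(1) Q(1)] by (simp only: P(2) Q(2))
      moreover have "(P + Q) \<circ> euler_op A \<beta> i = (P \<circ> euler_op A \<beta> i) + (Q \<circ> euler_op A \<beta> i)" by auto
      ultimately show "\<phi> (x \<oplus>\<^bsub>?M\<^esub> y) = \<phi> x \<oplus>\<^bsub>?M\<^esub> \<phi> y"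
        using \<phi>[OF weyl_ops_plus[OF P(1) Q(1)]] \<phi>[OF P(1)] \<phi>[OF Q(1)]
          D.q_add[OF Pe weyl_ops.comp[OF Q(1) euler_op_in_weyl], of A \<beta> i] by (simp only: P(2) Q(2))
    qed
    show "\<phi> \<in> extensional (carrier ?M)" by (simp add: \<phi>_def)
    fix \<alpha> z assume "z \<in> ?G \<alpha>"
    then obtain R where R: "R \<in> weyl_ops" "z = pt R" "euler_degree A \<alpha> R"
      by (rule tensor_grading_obtain)
    show "\<phi> z = euler_op A (\<beta> + of_int_vec \<alpha>) i \<odot>\<^bsub>?M\<^esub> z"
      using \<phi>[OF R(1)] D.q_act[unfolded weyl_simps, OF euler_op_in_weyl R(1)]
      by (simp only: R(2) euler_degreeD[OF R(3)])
  qed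
  have unique: "\<psi> = \<phi>" if \<psi>: "?spec \<psi>" for \<psi>
  proof
    fix z
    show "\<psi> z = \<phi> z"
    proof (cases "z \<in> carrier ?M")
      case True
      then obtain P where P: "P \<in> weyl_ops" "z = pt P" by (rule D.carrier_obtain)
      have z: "P \<odot>\<^bsub>?M\<^esub> pt id = z"
        using D.q_act[unfolded weyl_simps, OF P(1) weyl_ops_id] by (simp only: P(2) comp_id)
      have *: "\<eta> z = P \<odot>\<^bsub>?M\<^esub> (euler_op A (\<beta> + of_int_vec 0) i \<odot>\<^bsub>?M\<^esub> pt id)" if \<eta>: "?spec \<eta>" for \<eta>
      proof -
        have "\<eta> (P \<odot>\<^bsub>?M\<^esub> pt id) = P \<odot>\<^bsub>?M\<^esub> \<eta> (pt id)"
          by (rule lmodule_hom_smult[OF \<eta>[THEN conjunct1] _ D.q_closed[OF weyl_ops_id]])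
            (simp only: weyl_simps P(1))
        moreover have "\<eta> (pt id) = euler_op A (\<beta> + of_int_vec 0) i \<odot>\<^bsub>?M\<^esub> pt id"
          by (rule \<eta>[THEN conjunct2, THEN conjunct2, rule_format, OF pt_id_grading])
        ultimately show ?thesis by (simp only: z)
      qed
      show ?thesis using *[OF \<psi>] *[OF spec] by (simp only:)
    next
      case False
      have "\<psi> \<in> extensional (carrier ?M)" "\<phi> \<in> extensional (carrier ?M)"
        by (rule \<psi>[THEN conjunct2, THEN conjunct1], rule spec[THEN conjunct2, THEN conjunct1])
      then show ?thesis using False by (simp add: extensional_def)
    qed
  qed
  have "euler_endo A \<beta> V (poly_quot_grading A C) i = \<phi>"
    unfolding euler_endo_def by (rule the_equality) (rule spec, rule unique)
  then show ?thesis using \<phi>[OF P] by simp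
qed

lemma koszul_presentation_weyl:
  assumes graded: "A_graded_ideal A C"
  shows "koszul_presentation weyl (\<circ>) weyl_ops (weyl_ext C) (weyl_tensor V) pt (right_euler A \<beta>)
     (euler_endo A \<beta> V (poly_quot_grading A C))"
proof -
  show ?thesis
  proof (intro koszul_presentation.intro koszul_presentation_axioms.intro D.presentation_axioms right_euler_endos)
    show "weyl_ext C \<subseteq> weyl_ops" using weyl_extD(2) by blast
    show "additive_subgroup_set (weyl_ext C)" by (rule weyl_extD(1))
    show "r \<circ> b \<in> weyl_ext C" if "r \<in> carrier weyl" "b \<in> weyl_ext C" for r b
      using weyl_extD(3)[OF that(2)] that(1) by simp
    show "right_euler A \<beta> i z \<in> weyl_ops" if "z \<in> weyl_ops" for z i
      unfolding right_euler_def using that euler_op_in_weyl by (rule weyl_ops.comp)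
    show "right_euler A \<beta> i b \<in> weyl_ext C" if "b \<in> weyl_ext C" for b i
      unfolding right_euler_def by (rule weyl_ext_euler_stable[OF graded that])
    show "r \<circ> right_euler A \<beta> i z = right_euler A \<beta> i (r \<circ> z)" for r z i
      by (simp only: right_euler_def comp_assoc)
    show "euler_endo A \<beta> V (poly_quot_grading A C) i (pt z) = pt (right_euler A \<beta> i z)" if "z \<in> weyl_ops" for z i
      unfolding right_euler_def by (rule euler_endo_pt[OF graded that])
  qed
qed

end

definition weyl_cycles :: "int^'n::finite^'d::{finite,linorder} \<Rightarrow> complex^'d::{finite,linorder} \<Rightarrow> 'n cpoly set \<Rightarrow> nat \<Rightarrow> ('d set \<Rightarrow> 'n cpoly \<Rightarrow> 'n cpoly) set" where
  "weyl_cycles A \<beta> C p = {z. (\<forall>T. z T \<in> weyl_ops) \<and> (\<forall>T. Suc (card T) = p \<longrightarrow> kdiff (right_euler A \<beta>) z T \<in> weyl_ext C)}"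

definition weyl_boundaries :: "int^'n::finite^'d::{finite,linorder} \<Rightarrow> complex^'d::{finite,linorder} \<Rightarrow> 'n cpoly set \<Rightarrow> nat \<Rightarrow> ('d set \<Rightarrow> 'n cpoly \<Rightarrow> 'n cpoly) set" where
  "weyl_boundaries A \<beta> C p = {z. (\<forall>T. z T \<in> weyl_ops) \<and>
     (\<exists>w. (\<forall>T. w T \<in> weyl_ops) \<and> (\<forall>T. card T = p \<longrightarrow> z T - kdiff (right_euler A \<beta>) w T \<in> weyl_ext C))}"

lemma presentation_EK_quot:
  assumes "A_graded_ideal A C"
  shows "\<exists>h. presentation weyl (\<lambda>P z T. P \<circ> z T) (weyl_cycles A \<beta> C p) (weyl_boundaries A \<beta> C p) (EK_quot A \<beta> C p) h"
proof -
  interpret tensor_quotient C by standard (rule A_graded_idealD[OF assms])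
  interpret K: koszul_presentation weyl "(\<circ>)" weyl_ops "weyl_ext C" "weyl_tensor V" pt "right_euler A \<beta>"
     "euler_endo A \<beta> V (poly_quot_grading A C)"
    using assms by (rule koszul_presentation_weyl)
  show ?thesis
    using K.homology_presentation[of p]
    unfolding EK_quot_def euler_koszul_homology_def weyl_cycles_def weyl_boundaries_def K.cycles_def K.boundaries_def .
qed

section \<open>From quasidegrees to vanishing\<close>

lemma zero_poly_quot: "\<zero>\<^bsub>poly_quot C\<^esub> = C"
  by (simp add: poly_quot_def quot_module_def)

lemma poly_class_eq_iff:
  assumes "poly_ideal C"
  shows "poly_class C f = poly_class C g \<longleftrightarrow> f - g \<in> C"
  using presentation.q_eq_iff[OF presentation_poly_quot[OF assms], of f g] by simp

lemma poly_class_0: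
  assumes "poly_ideal C"
  shows "poly_class C 0 = C"
  using presentation.q_0[OF presentation_poly_quot[OF assms]] by (simp add: zero_poly_quot)

text \<open>
  The natural map to a component, on residue classes.
\<close>

lemma set_add_poly_class:
  assumes "poly_ideal I" "poly_ideal C" "I \<subseteq> C"
  shows "C <+>\<^bsub>poly_ring\<^esub> poly_class I g = poly_class C g"
proof -
  have "C <+>\<^bsub>poly_ring\<^esub> poly_class I g = {c + (a + g) |c a. c \<in> C \<and> a \<in> I}"
    by (auto simp: set_add_def' a_r_coset_def' poly_ring_def regular_module_def)
  also have "\<dots> = {c + g |c. c \<in> C}"
  proof (intro subset_antisym subsetI)
    fix x assume "x \<in> {c + (a + g) |c a. c \<in> C \<and> a \<in> I}"
    then obtain c a where x: "x = c + a + g" "c \<in> C" "a \<in> I" by (auto simp: add.assoc)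
    then have "c + a \<in> C" using subgroup_setD(4)[OF poly_idealD(1)[OF assms(2)]] assms(3) by blast
    then show "x \<in> {c + g |c. c \<in> C}" using x(1) by blast
  next
    fix x assume "x \<in> {c + g |c. c \<in> C}"
    then obtain c where "x = c + (0 + g)" "c \<in> C" by auto
    then show "x \<in> {c + (a + g) |c a. c \<in> C \<and> a \<in> I}"
      using subgroup_setD(1)[OF poly_idealD(1)[OF assms(1)]] by blast
  qed
  also have "\<dots> = poly_class C g" by (auto simp: a_r_coset_def' poly_ring_def regular_module_def)
  finally show ?thesis .
qed

lemma outside_qdeg_polynomial:
  assumes "z \<notin> qdeg V G"
  shows "\<exists>p. poly_eval p z \<noteq> 0 \<and> (\<forall>\<alpha>. \<forall>v\<in>G \<alpha>. v \<noteq> \<zero>\<^bsub>V\<^esub> \<longrightarrow> poly_eval p (of_int_vec \<alpha>) = 0)"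
proof -
  obtain p where p: "poly_eval p z \<noteq> 0" "\<forall>s\<in>of_int_vec ` {\<alpha>. \<exists>v\<in>G \<alpha>. v \<noteq> \<zero>\<^bsub>V\<^esub>}. poly_eval p s = 0"
    using assms unfolding qdeg_def zariski_closure_def mem_Collect_eq not_all not_imp by (elim exE conjE)
  have "poly_eval p (of_int_vec \<alpha>) = 0" if "v \<in> G \<alpha>" "v \<noteq> \<zero>\<^bsub>V\<^esub>" for \<alpha> v
    by (rule bspec[OF p(2)]) (use that in blast)
  then show ?thesis using p(1) by blast
qed

text \<open>
  A single component is treated as a family over a one-element index set.
\<close>

lemma acyclic_component_outside_qdeg:
  fixes A :: "int^'n::finite^'d::{finite,linorder}"
  assumes C: "A_graded_ideal A C"
    and out: "- \<beta> \<notin> qdeg (poly_quot C) (poly_quot_grading A C)"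
  shows "acyclic_over (right_euler A \<beta>) weyl_ops (weyl_ext C)"
proof -
  have ideal: "poly_ideal C" using C by (rule A_graded_idealD)
  obtain p where nz: "poly_eval p (- \<beta>) \<noteq> 0"
    and p: "\<And>\<alpha> v. v \<in> poly_quot_grading A C \<alpha> \<Longrightarrow> v \<noteq> \<zero>\<^bsub>poly_quot C\<^esub> \<Longrightarrow> poly_eval p (of_int_vec \<alpha>) = 0"
    using outside_qdeg_polynomial[OF out] by blast
  let ?X = "{F :: unit \<Rightarrow> 'n cpoly \<Rightarrow> 'n cpoly. F () \<in> weyl_ext C}"
  have "acyclic_over (family_euler A \<beta>) {F. \<forall>Q\<in>{()}. F Q \<in> weyl_ops} ?X"
  proof (rule acyclic_families[OF nz])
    show "bistable A \<beta> ?X"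
      unfolding bistable_def additive_subgroup_set_def family_euler_def
      using subgroup_setD(1,2)[OF weyl_extD(1)[of C]] weyl_extD(3)[of _ C] weyl_ext_euler_stable[OF C] by simp
    show "finite {()}" by simp
    show "?X \<subseteq> {F. \<forall>Q\<in>{()}. F Q \<in> weyl_ops}" using weyl_extD(2) by blast
    show "F \<in> ?X" if "\<forall>Q\<in>{()}. F Q = 0" for F :: "unit \<Rightarrow> 'n cpoly \<Rightarrow> 'n cpoly"
      using that subgroup_setD(1)[OF weyl_extD(1)[of C]] by simp
    fix \<alpha> and v :: "unit \<Rightarrow> 'n cpoly"
    assume v: "\<And>Q. v Q \<in> poly_degree_part A \<alpha>" "op_family v \<notin> ?X"
    then have "v () \<notin> C" using diff_op_in_weyl_ext by (auto simp: op_family_def)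
    then have "poly_class C (v ()) \<noteq> \<zero>\<^bsub>poly_quot C\<^esub>"
      using poly_class_eq_iff[OF ideal, of "v ()" 0] by (simp add: poly_class_0[OF ideal] zero_poly_quot)
    moreover have "poly_class C (v ()) \<in> poly_quot_grading A C \<alpha>"
      unfolding poly_quot_grading_def quot_grading_def using v(1) by blast
    ultimately show "poly_eval p (of_int_vec \<alpha>) = 0" using p by blast
  qed
  then have acy: "\<exists>w. (\<forall>T. w T () \<in> weyl_ops) \<and> (\<forall>T. z T () - kdiff (right_euler A \<beta>) (\<lambda>T. w T ()) T \<in> weyl_ext C)"
    if "\<And>T. z T () \<in> weyl_ops" "\<And>T. kdiff (right_euler A \<beta>) (\<lambda>T. z T ()) T \<in> weyl_ext C" for z
    using that unfolding acyclic_over_def by (simp add: kdiff_family)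
  show ?thesis
    unfolding acyclic_over_def
  proof (intro allI impI)
    fix z :: "'d set \<Rightarrow> 'n cpoly \<Rightarrow> 'n cpoly"
    assume z: "(\<forall>T. z T \<in> weyl_ops) \<and> (\<forall>T. kdiff (right_euler A \<beta>) z T \<in> weyl_ext C)"
    obtain w where w: "\<And>T. w T () \<in> weyl_ops" "\<And>T. z T - kdiff (right_euler A \<beta>) (\<lambda>T. w T ()) T \<in> weyl_ext C"
      using acy[of "\<lambda>T _. z T"] z by auto
    then show "\<exists>w. (\<forall>T. w T \<in> weyl_ops) \<and> (\<forall>T. z T - kdiff (right_euler A \<beta>) w T \<in> weyl_ext C)"
      by (intro exI[of _ "\<lambda>T. w T ()"] conjI allI)
  qed
qed

text \<open>
  A homogeneous vector \<open>v\<close> of polynomials whose class in \<open>P\<^sub>I\<close> is zero is congruent modulo the \<open>C\<^sub>Q\<close> to a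
  single polynomial \<open>g\<close>, and then the family of operators given by \<open>v\<close> is congruent to \<open>g\<close> modulo the
  \<open>D C\<^sub>Q\<close>.  So vectors outside of \<open>common_families\<close> contribute degrees of \<open>P\<^sub>I\<close>, where \<open>p\<close> vanishes.
\<close>

lemma acyclic_cokernel_outside_qdeg:
  fixes A :: "int^'n::finite^'d::{finite,linorder}"
  assumes I: "poly_ideal I" and fin: "finite (assoc_primes I)"
    and C: "\<And>Q. Q \<in> assoc_primes I \<Longrightarrow> A_graded_ideal A (C Q)"
    and IC: "\<And>Q. Q \<in> assoc_primes I \<Longrightarrow> I \<subseteq> C Q"
    and out: "- \<beta> \<notin> qdeg (P_module I C) (P_grading A I C)"
  shows "acyclic_over (family_euler A \<beta>) {F. \<forall>Q\<in>assoc_primes I. F Q \<in> weyl_ops} (common_families (assoc_primes I) C)"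
proof -
  let ?S = "assoc_primes I"
  let ?N = "natural_map I C ` carrier (poly_quot I)"
  have ideal: "poly_ideal (C Q)" if "Q \<in> ?S" for Q using C[OF that] by (rule A_graded_idealD)
  obtain p where nz: "poly_eval p (- \<beta>) \<noteq> 0"
    and p: "\<And>\<alpha> v. v \<in> P_grading A I C \<alpha> \<Longrightarrow> v \<noteq> \<zero>\<^bsub>P_module I C\<^esub> \<Longrightarrow> poly_eval p (of_int_vec \<alpha>) = 0"
    using outside_qdeg_polynomial[OF out] by blast
  show ?thesis
  proof (rule acyclic_families[OF nz])
    show "bistable A \<beta> (common_families ?S C)" using C by (rule bistable_common_families)
    show "finite ?S" by (rule fin)
    show "common_families ?S C \<subseteq> {F. \<forall>Q\<in>?S. F Q \<in> weyl_ops}" unfolding common_families_def by blast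
    show "F \<in> common_families ?S C" if "\<forall>Q\<in>?S. F Q = 0" for F
      unfolding common_families_def using that weyl_ops_zero subgroup_setD(1)[OF weyl_extD(1)]
      by (auto intro!: bexI[of _ 0] weyl_ops_zero)
    fix \<alpha> and v :: "'n cpoly set \<Rightarrow> 'n cpoly"
    assume v: "\<And>Q. v Q \<in> poly_degree_part A \<alpha>" "op_family v \<notin> common_families ?S C"
    \<comment> \<open>The element of \<open>\<Oplus>\<^sub>Q \<complex>[\<partial>]/C\<^sub>Q\<close> represented by \<open>v\<close>.\<close>
    define f where "f = (\<lambda>Q\<in>?S. poly_class (C Q) (v Q))"
    have "f \<in> direct_sum_grading ?S (\<lambda>Q. poly_quot (C Q)) (\<lambda>Q. poly_quot_grading A (C Q)) \<alpha>"
      unfolding direct_sum_grading_def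
    proof (intro CollectI conjI ballI)
      show "f \<in> carrier (direct_sum ?S (\<lambda>Q. poly_quot (C Q)))"
        using presentation.q_closed[OF presentation_poly_quot[OF ideal]] fin
        by (simp add: direct_sum_def f_def)
      show "f Q \<in> poly_quot_grading A (C Q) \<alpha>" if "Q \<in> ?S" for Q
        unfolding poly_quot_grading_def quot_grading_def using v(1)[of Q] that by (simp add: f_def)
    qed
    then have "?N +>\<^bsub>component_sum I C\<^esub> f \<in> P_grading A I C \<alpha>"
      unfolding P_grading_def quot_grading_def by (rule imageI)
    moreover have "?N +>\<^bsub>component_sum I C\<^esub> f \<noteq> \<zero>\<^bsub>P_module I C\<^esub>"
    proof
      assume "?N +>\<^bsub>component_sum I C\<^esub> f = \<zero>\<^bsub>P_module I C\<^esub>"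
      then have eq: "?N +>\<^bsub>component_sum I C\<^esub> f = ?N" by (simp add: P_module_def quot_module_def)
      have nat: "natural_map I C (poly_class I g) = (\<lambda>Q\<in>?S. poly_class (C Q) g)" for g
        unfolding natural_map_def using set_add_poly_class[OF I ideal IC] by (intro restrict_ext) simp
      have carr: "poly_class I g \<in> carrier (poly_quot I)" for g
        using presentation.q_closed[OF presentation_poly_quot[OF I]] by simp
      have zero_f: "natural_map I C (poly_class I 0) \<oplus>\<^bsub>component_sum I C\<^esub> f = f"
      proof -
        have "poly_class (C Q) 0 \<oplus>\<^bsub>poly_quot (C Q)\<^esub> poly_class (C Q) (v Q) = poly_class (C Q) (v Q)" if "Q \<in> ?S" for Q
          using presentation.q_add[OF presentation_poly_quot[OF ideal[OF that]], of 0 "v Q"] by simp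
        then show ?thesis
          unfolding nat component_sum_def direct_sum_def f_def by (auto simp: fun_eq_iff restrict_def)
      qed
      have "f \<in> ?N +>\<^bsub>component_sum I C\<^esub> f"
        unfolding a_r_coset_def'
        by (rule UN_I[OF imageI[OF carr[of 0]]]) (simp only: zero_f singleton_iff)
      then have "f \<in> ?N" by (simp only: eq)
      then obtain X where X: "X \<in> carrier (poly_quot I)" "f = natural_map I C X" by blast
      obtain g where "X = poly_class I g"
        using presentation.carrier_obtain[OF presentation_poly_quot[OF I] X(1)] by blast
      then have fg: "f = (\<lambda>Q\<in>?S. poly_class (C Q) g)" using X(2) by (simp only: nat)
      have "diff_op (v Q) - diff_op g \<in> weyl_ext (C Q)" if "Q \<in> ?S" for Q
      proof -
        have "poly_class (C Q) (v Q) = poly_class (C Q) g" using fun_cong[OF fg, of Q] that by (simp add: f_def)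
        then show ?thesis
          unfolding diff_op_diff[symmetric] poly_class_eq_iff[OF ideal[OF that]] by (rule diff_op_in_weyl_ext)
      qed
      then have "op_family v \<in> common_families ?S C"
        unfolding common_families_def op_family_def using diff_op_in_weyl by blast
      then show False using v(2) by blast
    qed
    ultimately show "poly_eval p (of_int_vec \<alpha>) = 0" using p by blast
  qed
qed

section \<open>The decomposition of Euler-Koszul homology\<close>

theorem theorem6p8:
  fixes A :: "int^'n::finite^'d::{finite,linorder}"
    and I :: "'n cpoly set"
    and C :: "'n cpoly set \<Rightarrow> 'n cpoly set"
    and \<beta> :: "complex^'d::{finite,linorder}"
  assumes "grading_matrix A"
    and "binomial_ideal I"
    and "A_graded_ideal A I"
    and "binomial_primary_decomposition A I C"
    and "- \<beta> \<notin> Z_primary A I C"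
  shows "(\<forall>i. lmodule_iso weyl
            (EK_quot A \<beta> I i)
            (direct_sum {Q\<in>assoc_primes I. toral A Q} (\<lambda>Q. EK_quot A \<beta> (C Q) i)))
       \<and> lmodule_iso weyl
            (D_mod_H A I \<beta>)
            (direct_sum {Q\<in>assoc_primes I. toral A Q} (\<lambda>Q. D_mod_H A (C Q) \<beta>))"
proof -
  let ?T = "{Q\<in>assoc_primes I. toral A Q}"
  have I: "poly_ideal I" using assms(3) by (rule A_graded_idealD)
  have fin: "finite (assoc_primes I)" using I by (rule finite_assoc_primes)
  have graded: "A_graded_ideal A (C Q)" if "Q \<in> assoc_primes I" for Q
    using assms(4) that unfolding binomial_primary_decomposition_def by blast
  have I_eq: "I = (\<Inter>Q\<in>assoc_primes I. C Q)"
    using assms(4) unfolding binomial_primary_decomposition_def by (elim conjE)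
  \<comment> \<open>A lattice prime that is not toral is Andean, by any of its descriptions.\<close>
  have Andean: "Andean A Q" if Q: "Q \<in> assoc_primes I - ?T" for Q
  proof -
    obtain L \<rho> J where "partial_character L \<rho> J" "Q = lattice_prime L \<rho> J"
      using bspec[OF assms(4)[unfolded binomial_primary_decomposition_def, THEN conjunct1] DiffD1[OF Q]]
      by (elim conjE exE)
    moreover from this have "L \<noteq> kernel_lattice A J" using Q unfolding toral_def by blast
    ultimately show ?thesis unfolding Andean_def by blast
  qed
  have outside: "- \<beta> \<notin> qdeg (P_module I C) (P_grading A I C)"
    "\<And>Q. Q \<in> assoc_primes I - ?T \<Longrightarrow> - \<beta> \<notin> qdeg (poly_quot (C Q)) (poly_quot_grading A (C Q))"
  proof -
    show "- \<beta> \<notin> qdeg (P_module I C) (P_grading A I C)"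
      using assms(5) unfolding Z_primary_def by simp
    have "- \<beta> \<notin> Z_Andean A I C" using assms(5) unfolding Z_primary_def by simp
    then show "- \<beta> \<notin> qdeg (poly_quot (C Q)) (poly_quot_grading A (C Q))" if "Q \<in> assoc_primes I - ?T" for Q
      using Andean[OF that] that unfolding Z_Andean_def by blast
  qed
  interpret split_components A \<beta> I C "assoc_primes I" ?T
  proof
    show "acyclic_over (family_euler A \<beta>) {F. \<forall>Q\<in>assoc_primes I. F Q \<in> weyl_ops} (common_families (assoc_primes I) C)"
      using I_eq by (intro acyclic_cokernel_outside_qdeg I fin graded outside(1)) auto
    show "acyclic_over (right_euler A \<beta>) weyl_ops (weyl_ext (C Q))" if "Q \<in> assoc_primes I - ?T" for Q
      using that by (intro acyclic_component_outside_qdeg graded outside(2)) auto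
  qed (use fin graded I_eq in auto)
  have ext_sub: "x \<in> weyl_ext (C Q)" if "Q \<in> ?T" "x \<in> weyl_ext I" for Q x
    using weyl_ext_I_subset[of Q] that by blast
  have fin_T: "finite ?T" using fin by simp
  \<comment> \<open>Representatives of both sides are chains of operators, and the isomorphism is the identity on
    them.\<close>
  have "lmodule_iso weyl (EK_quot A \<beta> I i) (direct_sum ?T (\<lambda>Q. EK_quot A \<beta> (C Q) i))" for i
  proof -
    obtain h where h: "presentation weyl (\<lambda>P z T. P \<circ> z T) (weyl_cycles A \<beta> I i) (weyl_boundaries A \<beta> I i) (EK_quot A \<beta> I i) h"
      using presentation_EK_quot[OF assms(3)] by blast
    have "\<forall>Q\<in>?T. \<exists>k. presentation weyl (\<lambda>P z T. P \<circ> z T) (weyl_cycles A \<beta> (C Q) i) (weyl_boundaries A \<beta> (C Q) i) (EK_quot A \<beta> (C Q) i) k"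
      using presentation_EK_quot[OF graded] by blast
    from bchoice[OF this] obtain k where k: "\<And>Q. Q \<in> ?T \<Longrightarrow>
      presentation weyl (\<lambda>P z T. P \<circ> z T) (weyl_cycles A \<beta> (C Q) i) (weyl_boundaries A \<beta> (C Q) i) (EK_quot A \<beta> (C Q) i) (k Q)" by blast
    show ?thesis
    proof (rule lmodule_iso_direct_sum[OF h k fin_T])
      show "weyl_cycles A \<beta> I i \<subseteq> weyl_cycles A \<beta> (C Q) i" if "Q \<in> ?T" for Q
        using ext_sub[OF that] unfolding weyl_cycles_def by blast
      show "z \<in> weyl_boundaries A \<beta> (C Q) i" if "Q \<in> ?T" "z \<in> weyl_boundaries A \<beta> I i" for Q z
        using ext_sub[OF that(1)] that(2) unfolding weyl_boundaries_def by blast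
      show "z \<in> weyl_boundaries A \<beta> I i"
        if "z \<in> weyl_cycles A \<beta> I i" "\<And>Q. Q \<in> ?T \<Longrightarrow> z \<in> weyl_boundaries A \<beta> (C Q) i" for z
        using boundary_if_component_boundaries[of i z] that unfolding weyl_boundaries_def weyl_cycles_def by simp
      show "\<exists>y\<in>weyl_cycles A \<beta> I i. \<forall>Q\<in>?T. f Q - y \<in> weyl_boundaries A \<beta> (C Q) i"
        if f: "\<And>Q. Q \<in> ?T \<Longrightarrow> f Q \<in> weyl_cycles A \<beta> (C Q) i" for f
      proof -
        have "\<And>Q T'. Q \<in> ?T \<Longrightarrow> card T' = i \<Longrightarrow> f Q T' \<in> weyl_ops"
          "\<And>Q T'. Q \<in> ?T \<Longrightarrow> Suc (card T') = i \<Longrightarrow> kdiff (right_euler A \<beta>) (f Q) T' \<in> weyl_ext (C Q)"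
          and all: "\<And>Q T'. Q \<in> ?T \<Longrightarrow> f Q T' \<in> weyl_ops"
          using f unfolding weyl_cycles_def by blast+
        from cycle_lifts[of i f, OF this(1,2)] obtain y where y: "\<And>T'. y T' \<in> weyl_ops"
          "\<And>T'. Suc (card T') = i \<Longrightarrow> kdiff (right_euler A \<beta>) y T' \<in> weyl_ext I"
          and b: "\<And>Q. Q \<in> ?T \<Longrightarrow> \<exists>w. (\<forall>T'. w T' \<in> weyl_ops) \<and> (\<forall>T'. card T' = i \<longrightarrow>
             f Q T' - y T' - kdiff (right_euler A \<beta>) w T' \<in> weyl_ext (C Q))" by blast
        have "f Q - y \<in> weyl_boundaries A \<beta> (C Q) i" if "Q \<in> ?T" for Q
          using b[OF that] subgroup_setD(2)[OF weyl_ops_subgroup all[OF that] y(1)]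
          unfolding weyl_boundaries_def by simp
        moreover have "y \<in> weyl_cycles A \<beta> I i" using y unfolding weyl_cycles_def by simp
        ultimately show ?thesis by blast
      qed
    qed
  qed
  moreover have "lmodule_iso weyl (D_mod_H A I \<beta>) (direct_sum ?T (\<lambda>Q. D_mod_H A (C Q) \<beta>))"
  proof (rule lmodule_iso_direct_sum[OF presentation_D_mod_H presentation_D_mod_H fin_T subset_refl])
    show "P \<in> H_ideal A (C Q) \<beta>" if "Q \<in> ?T" "P \<in> H_ideal A I \<beta>" for Q P
      using ext_sub[OF that(1)] that(2) unfolding H_ideal_iff by blast
    show "P \<in> H_ideal A I \<beta>" if "P \<in> weyl_ops" "\<And>Q. Q \<in> ?T \<Longrightarrow> P \<in> H_ideal A (C Q) \<beta>" for P
      using boundary_if_component_boundaries[of 0 "\<lambda>_. P"] that unfolding H_ideal_iff by simp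
    show "\<exists>y\<in>weyl_ops. \<forall>Q\<in>?T. f Q - y \<in> H_ideal A (C Q) \<beta>" if f: "\<And>Q. Q \<in> ?T \<Longrightarrow> f Q \<in> weyl_ops" for f
    proof -
      from cycle_lifts[of 0 "\<lambda>Q _. f Q"] f obtain y where y: "\<And>T'. y T' \<in> weyl_ops"
        and b: "\<And>Q. Q \<in> ?T \<Longrightarrow> \<exists>w. (\<forall>T'. w T' \<in> weyl_ops) \<and>
             f Q - y {} - kdiff (right_euler A \<beta>) w {} \<in> weyl_ext (C Q)" by force
      then show ?thesis unfolding H_ideal_iff by (intro bexI[of _ "y {}"]) auto
    qed
  qed
  ultimately show ?thesis by blast
qed

end
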